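(* Let $G$ be a finite connected graph without vertices of degree $1$ and with first Betti number $b>1$, with universal covering tree $\mathcal{T}$, fundamental group $\Gamma$, base point $x_0\in\mathcal{T}$ lying over the vertex $v_0$ of $G$, and $\alpha\colon\mathbf{F}_b\to\Gamma$, $\ell$, $\tau$, $C$, $\Phi_G$ as defined in the context. Let $\mu_{x_0}$ be the Patterson–Sullivan measure on $\partial\mathcal{T}$ based at $x_0$. Then the push-forward measure $\mu=\Phi_{G*}\mu_{x_0}$ on $C$ is characterised (up to scaling by a global constant) by $$\mu(\mathrm{Cyl}(g))=\lambda_{\mathrm{PF}}^{-\ell(\alpha(g))+d_{G-\tau(g)}(v_0,o(\tau(g)))}\cdot\mathbf{p}_{\tau(g)}\qquad (g\in\mathbf{F}_b\setminus\{1\}),$$ where $\lambda_{\mathrm{PF}}$ is the Perron–Frobenius eigenvalue, and $\mathbf{p}$ a Perron–Frobenius eigenvector, of the edge adjacency matrix $T$ of $G$.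
   Context: Graphs have edges that are unordered pairs of vertices. An oriented edge $\vec e=(v_1,v_2)$ has origin $o(\vec e)=v_1$ and end point $t(\vec e)=v_2$; its inverse is $(v_2,v_1)$. Let $\mathbf{E}$ be the set of all $2|E|$ oriented edges of $G$. The edge adjacency matrix $T$ is the $2|E|\times2|E|$ matrix indexed by $\mathbf{E}$ with $T_{\vec e_1,\vec e_2}=1$ if $t(\vec e_1)=o(\vec e_2)$ and $\vec e_2$ is not the inverse of $\vec e_1$, and $0$ otherwise. It is an irreducible non-negative matrix. The boundary $\partial\mathcal{T}$ is the space of ends of $\mathcal{T}$, i.e. of infinite non-backtracking paths from $x_0$, with topology generated by the cylinder sets of paths passing through a given edge. With $d$ the combinatorial distance on $\mathcal{T}$, the Patterson–Sullivan measure $\mu_{x_0}$ is the weak limit, as $s\to\log\lambda_{\mathrm{PF}}$, of $$\frac{\sum_{\gamma\in\Gamma}e^{-s\,d(x_0,\gamma x_0)}\,\delta_{\gamma x_0}}{\sum_{\gamma\in\Gamma}e^{-s\,d(x_0,\gamma x_0)}},$$ where $\delta_x$ is the Dirac delta measure at $x$. Choose a spanning tree $\mathcal{B}$ of $G$, and let $e_1,\dots,e_b$ be the edges of $G$ outside $\mathcal{B}$, with chosen orientations $\vec e_1,\dots,\vec e_b$. Let $\gamma_1,\dots,\gamma_b$ be generators of the fundamental group of $G$, seen as closed walks based at $v_0$ through an isomorphism $\Gamma\to\pi_1(G,v_0)$, such that $\gamma_i$ is a closed walk that passes through $\mathcal{B}$ and $\vec e_i$, but not through $e_j$ for $j\neq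 i$. Choose an isomorphism $\alpha\colon\mathbf{F}_b\to\Gamma$, where $\mathbf{F}_b$ is the free group of rank $b$, and take $g_i=\alpha^{-1}(\gamma_i)$ as generators of $\mathbf{F}_b$. For $\gamma\in\Gamma$, $\ell(\gamma)$ is the length of the closed walk $\gamma$. For $g\in\mathbf{F}_b\setminus\{1\}$ written as a reduced word in the $g_i^{\pm1}$, the final edge $\tau(g)\in\mathbf{E}$ is $\vec e_i$ if the final letter is $g_i$, and the inverse of $\vec e_i$ if the final letter is $g_i^{-1}$. $d_{G-\tau(g)}$ denotes distance in the graph obtained from $G$ by removing the edge underlying $\tau(g)$. $C$ is the boundary of the Cayley graph of $\mathbf{F}_b$ (with respect to $g_1^{\pm1},\dots,g_b^{\pm1}$), and $\mathrm{Cyl}(g)\subseteq C$ is the set of limits of reduced words that begin with $g$. The map $\Phi_G\colon\partial\mathcal{T}\to C$ is the homeomorphism inverse to $C\to\partial\mathcal{T}$, $\lim g\mapsto\lim\alpha(g)(x_0)$. Push-forward is $\Phi_{G*}\mu_{x_0}(A)=\mu_{x_0}(\Phi_G^{-1}(A))$.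
   Formalization: Added: for each edge e outside the spanning tree and each end v of e, d_{G-e}(v0,v)=d_B(v0,v); the formula fails for other trees (e.g. a path in K4). The closed walk of γ is the projected path from γx0 to x0, and p is a positive row eigenvector (pT=λp). *)

theory Defs
  imports
    "HOL-Probability.Probability"
    "HOL-Algebra.Bij"
    "HOL-Algebra.Generated_Groups"
    "HOL-Library.Sublist"
    "Graph_Theory.Graph_Theory"
begin

section \<open>Graphs and the edge adjacency matrix\<close>

text \<open>
  A graph is a symmetric loop-free \<^typ>\<open>'a pair_pre_digraph\<close>; its arcs are the oriented edges,
  with origin \<^const>\<open>fst\<close>, end point \<^const>\<open>snd\<close> and inverse \<^const>\<open>prod.swap\<close>. Finite graphs are
  instances of \<^locale>\<open>pair_graph\<close>, possibly infinite ones of \<^locale>\<open>pair_bidirected_digraph\<close>.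
\<close>

abbreviation connected_graph :: "'a pair_pre_digraph \<Rightarrow> bool" where
  "connected_graph G \<equiv> Digraph_Component.connected (with_proj G)"

abbreviation walk :: "'a pair_pre_digraph \<Rightarrow> 'a \<Rightarrow> ('a \<times> 'a) list \<Rightarrow> 'a \<Rightarrow> bool" where
  "walk G u p v \<equiv> pre_digraph.awalk (with_proj G) u p v"

abbreviation degree :: "'a pair_pre_digraph \<Rightarrow> 'a \<Rightarrow> nat" where
  "degree G v \<equiv> out_degree (with_proj G) v"

definition first_betti :: "'a pair_pre_digraph \<Rightarrow> int" where
  \<comment> \<open>for connected graphs; every edge contributes two arcs\<close>
  "first_betti G = int (card (parcs G) div 2) - int (card (pverts G)) + 1"

definition gdist :: "'a pair_pre_digraph \<Rightarrow> 'a \<Rightarrow> 'a \<Rightarrow> nat" where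
  \<comment> \<open>unspecified if \<open>v\<close> is not reachable from \<open>u\<close>\<close>
  "gdist G u v = (LEAST n. \<exists>p. walk G u p v \<and> length p = n)"

definition remove_edge :: "'a pair_pre_digraph \<Rightarrow> 'a \<times> 'a \<Rightarrow> 'a pair_pre_digraph" where
  "remove_edge G e = G\<lparr>parcs := parcs G - {e, prod.swap e}\<rparr>"

definition graph_tree :: "'a pair_pre_digraph \<Rightarrow> bool" where
  \<comment> \<open>Going back and forth along an edge is a directed cycle of length 2, so the directed
    \<^const>\<open>tree\<close> of the library does not apply to symmetric digraphs.\<close>
  "graph_tree H \<longleftrightarrow> pair_bidirected_digraph H \<and> connected_graph H \<and>
     (\<forall>p. pre_digraph.cycle (with_proj H) p \<longrightarrow> length p \<le> 2)"

definition spanning_graph_tree :: "'a pair_pre_digraph \<Rightarrow> 'a pair_pre_digraph \<Rightarrow> bool" where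
  "spanning_graph_tree B G \<longleftrightarrow> graph_tree B \<and> spanning (with_proj B) (with_proj G)"

definition edge_adj :: "'a \<times> 'a \<Rightarrow> 'a \<times> 'a \<Rightarrow> real" where
  "edge_adj e1 e2 = (if snd e1 = fst e2 \<and> e2 \<noteq> prod.swap e1 then 1 else 0)"

definition edge_adj_eigenvalue :: "'a pair_pre_digraph \<Rightarrow> complex \<Rightarrow> bool" where
  "edge_adj_eigenvalue G z \<longleftrightarrow>
     (\<exists>v. (\<exists>e\<in>parcs G. v e \<noteq> 0) \<and>
        (\<forall>e\<in>parcs G. (\<Sum>e'\<in>parcs G. complex_of_real (edge_adj e e') * v e') = z * v e))"

definition pf_eigenvalue :: "'a pair_pre_digraph \<Rightarrow> real" where
  "pf_eigenvalue G = Max (cmod ` {z. edge_adj_eigenvalue G z})"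

definition pf_eigenvector :: "'a pair_pre_digraph \<Rightarrow> ('a \<times> 'a \<Rightarrow> real) \<Rightarrow> bool" where
  \<comment> \<open>Row vectors: \<open>p T = \<lambda> p\<close>. See the convention for \<open>closed_walk\<close> below.\<close>
  "pf_eigenvector G p \<longleftrightarrow>
     (\<forall>e\<in>parcs G. 0 < p e) \<and>
     (\<forall>e\<in>parcs G. (\<Sum>e'\<in>parcs G. p e' * edge_adj e' e) = pf_eigenvalue G * p e)"

section \<open>Universal covering tree and fundamental group\<close>

definition universal_cover ::
    "'a pair_pre_digraph \<Rightarrow> 'b pair_pre_digraph \<Rightarrow> ('b \<Rightarrow> 'a) \<Rightarrow> bool" where
  "universal_cover G \<T> \<pi> \<longleftrightarrow> graph_tree \<T> \<and> \<pi> ` pverts \<T> = pverts G \<and>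
     (\<forall>x\<in>pverts \<T>. bij_betw \<pi> {y. (x, y) \<in> parcs \<T>} {w. (\<pi> x, w) \<in> parcs G})"

text \<open>The fundamental group, as group of deck transformations; the product is composition.\<close>

definition deck_group :: "'b pair_pre_digraph \<Rightarrow> ('b \<Rightarrow> 'a) \<Rightarrow> ('b \<Rightarrow> 'b) monoid" where
  "deck_group \<T> \<pi> = (BijGroup (pverts \<T>))
     \<lparr>carrier := {\<gamma> \<in> Bij (pverts \<T>).
        (\<forall>x\<in>pverts \<T>. \<forall>y\<in>pverts \<T>. (\<gamma> x, \<gamma> y) \<in> parcs \<T> \<longleftrightarrow> (x, y) \<in> parcs \<T>) \<and>
        (\<forall>x\<in>pverts \<T>. \<pi> (\<gamma> x) = \<pi> x)}\<rparr>"

definition nonbacktracking :: "('a \<times> 'a) list \<Rightarrow> bool" where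
  "nonbacktracking p \<longleftrightarrow> (\<forall>i. Suc i < length p \<longrightarrow> p ! Suc i \<noteq> prod.swap (p ! i))"

text \<open>
  The isomorphism from the deck group to \<open>\<pi>\<^sub>1(G, v\<^sub>0)\<close> sends \<open>\<gamma>\<close> to the class of the projection of the
  path in \<open>\<T>\<close> from \<open>\<gamma> x\<^sub>0\<close> to \<open>x\<^sub>0\<close>, represented by a non-backtracking closed walk. This is a
  homomorphism when products in \<open>\<pi>\<^sub>1\<close> are read from right to left, like compositions of maps.
  Consequently the path from \<open>x\<^sub>0\<close> to \<open>\<gamma> x\<^sub>0\<close> projects to the \<^emph>\<open>inverse\<close> of the closed walk of \<open>\<gamma>\<close>.
  The matching convention for eigenvectors of \<open>T\<close> is by row vectors: inverting oriented
  edges transposes \<open>T\<close>, hence exchanges its row and column eigenvectors.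
\<close>

definition closed_walk ::
    "'b pair_pre_digraph \<Rightarrow> ('b \<Rightarrow> 'a) \<Rightarrow> 'b \<Rightarrow> ('b \<Rightarrow> 'b) \<Rightarrow> ('a \<times> 'a) list" where
  "closed_walk \<T> \<pi> x0 \<gamma> =
     map (map_prod \<pi> \<pi>) (THE p. walk \<T> (\<gamma> x0) p x0 \<and> nonbacktracking p)"

section \<open>Boundary of a tree\<close>

definition ends :: "'b pair_pre_digraph \<Rightarrow> 'b \<Rightarrow> (nat \<Rightarrow> 'b) set" where
  "ends \<T> x0 = {\<xi>. \<xi> 0 = x0 \<and>
     (\<forall>n. (\<xi> n, \<xi> (Suc n)) \<in> parcs \<T> \<and> \<xi> (Suc (Suc n)) \<noteq> \<xi> n)}"

definition ends_topology :: "'b pair_pre_digraph \<Rightarrow> 'b \<Rightarrow> (nat \<Rightarrow> 'b) topology" where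
  "ends_topology \<T> x0 = topology_generated_by
     ((\<lambda>(u, v). {\<xi> \<in> ends \<T> x0. \<exists>n. \<xi> n = u \<and> \<xi> (Suc n) = v}) ` parcs \<T>)"

definition borel_of :: "'c topology \<Rightarrow> 'c measure" where
  "borel_of X = sigma (topspace X) {U. openin X U}"

text \<open>
  The compactification of a locally finite tree by its ends, in which the orbit measures and their
  weak limit live. Points are vertices (\<^const>\<open>Inl\<close>) or ends (\<^const>\<open>Inr\<close>), and the
  half-trees beyond the oriented edges form a subbasis of the topology.
\<close>

definition half_tree ::
    "'b pair_pre_digraph \<Rightarrow> 'b \<Rightarrow> 'b \<times> 'b \<Rightarrow> ('b + (nat \<Rightarrow> 'b)) set" where
  "half_tree \<T> x0 = (\<lambda>(u, v).
     Inl ` {z \<in> pverts \<T>. gdist \<T> z v < gdist \<T> z u} \<union>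
     Inr ` {\<xi> \<in> ends \<T> x0. \<forall>\<^sub>F n in sequentially. gdist \<T> (\<xi> n) v < gdist \<T> (\<xi> n) u})"

definition end_compactification ::
    "'b pair_pre_digraph \<Rightarrow> 'b \<Rightarrow> ('b + (nat \<Rightarrow> 'b)) topology" where
  "end_compactification \<T> x0 = topology_generated_by (half_tree \<T> x0 ` parcs \<T>)"

section \<open>Patterson--Sullivan measure\<close>

definition orbit_measure ::
    "'b pair_pre_digraph \<Rightarrow> ('b \<Rightarrow> 'a) \<Rightarrow> 'b \<Rightarrow> real \<Rightarrow> ('b + (nat \<Rightarrow> 'b)) measure" where
  "orbit_measure \<T> \<pi> x0 s =
     (let \<Gamma> = carrier (deck_group \<T> \<pi>);
          w = (\<lambda>\<gamma>. exp (- s * real (gdist \<T> x0 (\<gamma> x0))))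
      in distr (density (count_space \<Gamma>) (\<lambda>\<gamma>. ennreal (w \<gamma> / (\<Sum>\<^sub>\<infinity>\<gamma>'\<in>\<Gamma>. w \<gamma>'))))
           (borel_of (end_compactification \<T> x0)) (\<lambda>\<gamma>. Inl (\<gamma> x0)))"

definition patterson_sullivan ::
    "'a pair_pre_digraph \<Rightarrow> 'b pair_pre_digraph \<Rightarrow> ('b \<Rightarrow> 'a) \<Rightarrow> 'b \<Rightarrow> (nat \<Rightarrow> 'b) measure \<Rightarrow> bool"
where
  "patterson_sullivan G \<T> \<pi> x0 M \<longleftrightarrow>
     finite_measure M \<and> sets M = sets (borel_of (ends_topology \<T> x0)) \<and>
     (\<forall>f. continuous_map (end_compactification \<T> x0) euclideanreal f \<longrightarrow>
        ((\<lambda>s. \<integral>z. f z \<partial>orbit_measure \<T> \<pi> x0 s) \<longlongrightarrow> (\<integral>\<xi>. f (Inr \<xi>) \<partial>M))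
          (at_right (ln (pf_eigenvalue G))))"

section \<open>Free groups and their Cayley graphs\<close>

text \<open>The letter \<open>(i, True)\<close> stands for the generator \<open>g\<^sub>i\<close>, and \<open>(i, False)\<close> for its inverse.\<close>

fun letter_val :: "'f monoid \<Rightarrow> (nat \<Rightarrow> 'f) \<Rightarrow> nat \<times> bool \<Rightarrow> 'f" where
  "letter_val F g (i, s) = (if s then g i else inv\<^bsub>F\<^esub> (g i))"

definition word_val :: "'f monoid \<Rightarrow> (nat \<Rightarrow> 'f) \<Rightarrow> (nat \<times> bool) list \<Rightarrow> 'f" where
  "word_val F g w = foldr (\<lambda>l h. letter_val F g l \<otimes>\<^bsub>F\<^esub> h) w \<one>\<^bsub>F\<^esub>"

definition reduced_word :: "nat \<Rightarrow> (nat \<times> bool) list \<Rightarrow> bool" where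
  "reduced_word b w \<longleftrightarrow> fst ` set w \<subseteq> {..<b} \<and>
     (\<forall>k. Suc k < length w \<longrightarrow> w ! Suc k \<noteq> (fst (w ! k), \<not> snd (w ! k)))"

definition free_group_of_rank :: "'f monoid \<Rightarrow> nat \<Rightarrow> bool" where
  "free_group_of_rank F b \<longleftrightarrow> group F \<and>
     (\<exists>g \<in> {..<b} \<rightarrow> carrier F. bij_betw (word_val F g) {w. reduced_word b w} (carrier F))"

definition word_of :: "'f monoid \<Rightarrow> (nat \<Rightarrow> 'f) \<Rightarrow> nat \<Rightarrow> 'f \<Rightarrow> (nat \<times> bool) list" where
  "word_of F g b h = (THE w. reduced_word b w \<and> word_val F g w = h)"

definition cayley_graph :: "'f monoid \<Rightarrow> (nat \<Rightarrow> 'f) \<Rightarrow> nat \<Rightarrow> 'f pair_pre_digraph" where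
  "cayley_graph F g b = \<lparr>pverts = carrier F,
     parcs = {(h, h \<otimes>\<^bsub>F\<^esub> letter_val F g l) | h l. h \<in> carrier F \<and> fst l < b}\<rparr>"

definition cayley_ends :: "'f monoid \<Rightarrow> (nat \<Rightarrow> 'f) \<Rightarrow> nat \<Rightarrow> (nat \<Rightarrow> 'f) set" where
  "cayley_ends F g b = ends (cayley_graph F g b) \<one>\<^bsub>F\<^esub>"

definition cayley_ends_borel :: "'f monoid \<Rightarrow> (nat \<Rightarrow> 'f) \<Rightarrow> nat \<Rightarrow> (nat \<Rightarrow> 'f) measure" where
  "cayley_ends_borel F g b = borel_of (ends_topology (cayley_graph F g b) \<one>\<^bsub>F\<^esub>)"

definition Cyl :: "'f monoid \<Rightarrow> (nat \<Rightarrow> 'f) \<Rightarrow> nat \<Rightarrow> 'f \<Rightarrow> (nat \<Rightarrow> 'f) set" where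
  "Cyl F g b h = {\<xi> \<in> cayley_ends F g b.
     \<forall>\<^sub>F n in sequentially. prefix (word_of F g b h) (word_of F g b (\<xi> n))}"

definition final_edge ::
    "'f monoid \<Rightarrow> (nat \<Rightarrow> 'f) \<Rightarrow> nat \<Rightarrow> (nat \<Rightarrow> 'a \<times> 'a) \<Rightarrow> 'f \<Rightarrow> 'a \<times> 'a" where
  "final_edge F g b e h =
     (case last (word_of F g b h) of (i, s) \<Rightarrow> if s then e i else prod.swap (e i))"

section \<open>Edges outside a spanning tree, generators, and the boundary map\<close>

definition cotree_edges ::
    "'a pair_pre_digraph \<Rightarrow> 'a pair_pre_digraph \<Rightarrow> nat \<Rightarrow> (nat \<Rightarrow> 'a \<times> 'a) \<Rightarrow> bool" where
  "cotree_edges G B b e \<longleftrightarrow> inj_on e {..<b} \<and>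
     e ` {..<b} \<inter> prod.swap ` e ` {..<b} = {} \<and>
     e ` {..<b} \<union> prod.swap ` e ` {..<b} = parcs G - parcs B"

definition cotree_generators ::
    "'b pair_pre_digraph \<Rightarrow> ('b \<Rightarrow> 'a) \<Rightarrow> 'b \<Rightarrow> nat \<Rightarrow> (nat \<Rightarrow> 'a \<times> 'a) \<Rightarrow> (nat \<Rightarrow> 'b \<Rightarrow> 'b) \<Rightarrow> bool" where
  "cotree_generators \<T> \<pi> x0 b e \<gamma> \<longleftrightarrow>
     \<gamma> ` {..<b} \<subseteq> carrier (deck_group \<T> \<pi>) \<and>
     generate (deck_group \<T> \<pi>) (\<gamma> ` {..<b}) = carrier (deck_group \<T> \<pi>) \<and>
     (\<forall>i<b. e i \<in> set (closed_walk \<T> \<pi> x0 (\<gamma> i)) \<and>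
        (\<forall>j<b. j \<noteq> i \<longrightarrow> e j \<notin> set (closed_walk \<T> \<pi> x0 (\<gamma> i)) \<and>
                         prod.swap (e j) \<notin> set (closed_walk \<T> \<pi> x0 (\<gamma> i))))"

definition boundary_map ::
    "'b pair_pre_digraph \<Rightarrow> 'b \<Rightarrow> ('f \<Rightarrow> 'b \<Rightarrow> 'b) \<Rightarrow> (nat \<Rightarrow> 'f) \<Rightarrow> (nat \<Rightarrow> 'b)" where
  \<comment> \<open>the map from the boundary of the Cayley graph to that of \<open>\<T>\<close>, \<open>lim h \<mapsto> lim \<alpha>(h)(x\<^sub>0)\<close>\<close>
  "boundary_map \<T> x0 \<alpha> \<xi> = (THE \<eta>. \<eta> \<in> ends \<T> x0 \<and>
     limitin (end_compactification \<T> x0) (\<lambda>n. Inl (\<alpha> (\<xi> n) x0)) (Inr \<eta>) sequentially)"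

definition boundary_iso ::
    "'b pair_pre_digraph \<Rightarrow> 'b \<Rightarrow> 'f monoid \<Rightarrow> (nat \<Rightarrow> 'f) \<Rightarrow> nat \<Rightarrow> ('f \<Rightarrow> 'b \<Rightarrow> 'b)
      \<Rightarrow> (nat \<Rightarrow> 'b) \<Rightarrow> (nat \<Rightarrow> 'f)" where
  "boundary_iso \<T> x0 F g b \<alpha> = the_inv_into (cayley_ends F g b) (boundary_map \<T> x0 \<alpha>)"

definition tree_realises_distances ::
    "'a pair_pre_digraph \<Rightarrow> 'a pair_pre_digraph \<Rightarrow> 'a \<Rightarrow> bool" where
  \<comment> \<open>A closed walk of a generator returns to \<open>v\<^sub>0\<close> inside \<open>B\<close>, so its return length is a distance
    in \<open>B\<close>. A formula in terms of distances in \<open>G\<close> minus an edge needs the two to agree;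
    for arbitrary spanning trees they do not. Every shortest-path spanning tree rooted at
    \<open>v\<^sub>0\<close> has this property. The arc \<open>a\<close> ranges over both orientations, which covers both end points.\<close>
  "tree_realises_distances G B v0 \<longleftrightarrow>
     (\<forall>a \<in> parcs G - parcs B. gdist (remove_edge G a) v0 (fst a) = gdist B v0 (fst a))"

end

theory Submission
  imports Defs
begin

text \<open>
  The vertices of the covering tree are the non-backtracking walks of \<open>G\<close> from \<open>v\<^sub>0\<close>, and its
  ends are the infinite ones. A cylinder at \<open>h\<close> corresponds under the boundary map to a
  shadow: the ends whose ray starts with a certain walk \<open>q\<close>, the stem of the reduced word of
  \<open>h\<close>. So the theorem is a formula for the measure of shadows together with a computation of stems.

  Shadows are measured by \<open>measure_shadow\<close>. The half-tree beyond a walk \<open>q\<close> is open and closed in the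
  compactification, so its mass under the orbit measures converges to the measure of the shadow of
  \<open>q\<close>. An orbit point in this half-tree is the end of a walk \<open>q @ t\<close>, where the possible
  continuations \<open>t\<close> depend on the last arc of \<open>q\<close> only. Its weight is \<open>exp (- s |q|) exp (- s |t|)\<close>.
  In the limit, \<open>\<lambda> ^ |q|\<close> times the measure of the shadow is therefore a function of the last arc
  of \<open>q\<close>. Since a shadow is the disjoint union of the shadows of the prolonged walks, this function is a
  non-negative column eigenvector of \<open>T\<close> for \<open>\<lambda>\<close>. It is not zero, because the total mass is 1,
  and it is unique up to a factor, because \<open>T\<close> is irreducible (\<open>irreducible\<close>,
  \<open>eigenvector_unique\<close>). Inverting arcs turns the row eigenvector \<open>p\<close> into such a vector, so the
  measure of the shadow is a constant times \<open>\<lambda>\<close> to the power \<open>- |q|\<close> times \<open>p\<close> at the inverse of the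
  last arc. The orbit series converges beyond \<open>ln \<lambda>\<close> because the number of walks can be estimated by
  counting them with the weights \<open>p\<close> (\<open>summable_nb_walks\<close>).

  Cutting a non-backtracking closed walk at the arcs outside the spanning tree leaves geodesics of
  the tree, so such walks correspond to reduced words (\<open>word_walk_exists\<close>,
  \<open>nb_word_walk\<close>). The hypotheses on the generators force each of them to be the simple loop through
  its edge (\<open>closed_walk_generator\<close>), whence the walk to the translate of the base point by a product
  of generators is the walk of the word (\<open>word_val_end\<close>). The closed walk of \<open>h\<close> is the inverse of
  this walk. Without its initial piece inside the spanning tree it has the length of the stem, and it
  then starts with the final edge, the inverse of the last arc of the stem
  (\<open>length_closed_walk\<close>). Along an infinite reduced word the stems prolong each other, which
  gives the boundary map and its inverse (\<open>boundary_map\<close>, \<open>boundary_iso_Cyl_iff\<close>).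

  Finally, cylinders are nested or disjoint and generate the Borel sets, so the values on them
  determine a measure (\<open>measure_determined\<close>).
\<close>


section \<open>Non-backtracking walks\<close>

lemma nonbacktracking_successively:
  "nonbacktracking p \<longleftrightarrow> successively (\<lambda>a c. c \<noteq> prod.swap a) p"
  by (simp add: nonbacktracking_def successively_conv_nth)

lemma nonbacktracking_Nil [simp]: "nonbacktracking []"
  by (simp add: nonbacktracking_successively)

lemma nonbacktracking_single [simp]: "nonbacktracking [a]"
  by (simp add: nonbacktracking_successively)

lemma nonbacktracking_Cons:
  "nonbacktracking (a # p) \<longleftrightarrow> nonbacktracking p \<and> (p \<noteq> [] \<longrightarrow> hd p \<noteq> prod.swap a)"
  by (auto simp: nonbacktracking_successively successively_Cons)

lemma nonbacktracking_append:
  "nonbacktracking (p @ q) \<longleftrightarrow> nonbacktracking p \<and> nonbacktracking q \<and>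
     (p \<noteq> [] \<longrightarrow> q \<noteq> [] \<longrightarrow> hd q \<noteq> prod.swap (last p))"
  by (auto simp: nonbacktracking_successively successively_append_iff)

declare rev_path.simps(2) [simp del]

lemma rev_path_Cons [simp]: "rev_path (a # p) = rev_path p @ [prod.swap a]"
  by (simp add: rev_path.simps prod.swap_def)

lemma length_rev_path [simp]: "length (rev_path p) = length p"
  by (induction p) auto

lemma set_rev_path [simp]: "set (rev_path p) = prod.swap ` set p"
  by (induction p) auto

lemma last_rev_path: "p \<noteq> [] \<Longrightarrow> last (rev_path p) = prod.swap (hd p)"
  by (cases p) auto

lemma nonbacktracking_rev_path [simp]:
  "nonbacktracking (rev_path p) \<longleftrightarrow> nonbacktracking p"
proof -
  have "nonbacktracking (rev_path p)" if "nonbacktracking p" for p :: "('a \<times> 'a) list"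
    using that by (induction p) (auto simp: nonbacktracking_Cons nonbacktracking_append last_rev_path)
  from this[of p] this[of "rev_path p"] show ?thesis by auto
qed

text \<open>Cancelling an arc against its inverse is the elementary homotopy of walks. In a tree all walks
  with the same end points are homotopic, and cancelling as long as possible yields the
  geodesic.\<close>

fun reduce :: "('a \<times> 'a) list \<Rightarrow> ('a \<times> 'a) list" where
  "reduce [] = []"
| "reduce (a # p) = (case reduce p of [] \<Rightarrow> [a]
     | c # q \<Rightarrow> if c = prod.swap a then q else a # c # q)"

lemma nonbacktracking_reduce [simp]: "nonbacktracking (reduce p)"
  by (induction p) (auto simp: nonbacktracking_Cons split: list.splits)

lemma length_reduce: "length (reduce p) \<le> length p"
  by (induction p) (auto split: list.splits)

lemma reduce_nonbacktracking: "nonbacktracking p \<Longrightarrow> reduce p = p"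
  by (induction p) (auto simp: nonbacktracking_Cons split: list.splits)

text \<open>The number of passages through an arc, counted with orientation. It is invariant under
  cancellation, so it depends on the homotopy class of the walk only.\<close>

definition net_count :: "'a \<times> 'a \<Rightarrow> ('a \<times> 'a) list \<Rightarrow> int" where
  "net_count c p = int (count_list p c) - int (count_list p (prod.swap c))"

lemma swap_eq_iff: "prod.swap a = c \<longleftrightarrow> a = prod.swap c"
  by (cases a; cases c) auto

lemma net_count_append [simp]: "net_count c (p @ q) = net_count c p + net_count c q"
  by (simp add: net_count_def)

lemma net_count_cancel: "net_count c (a # prod.swap a # p) = net_count c p"
  by (auto simp: net_count_def swap_eq_iff)

lemma net_count_Cons: "net_count c (a # p) = net_count c [a] + net_count c p"
  by (simp add: net_count_def)

lemma net_count_reduce [simp]: "net_count c (reduce p) = net_count c p"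
proof (induction p)
  case (Cons a p)
  show ?case
  proof (cases "reduce p")
    case Nil
    then show ?thesis using Cons by (simp add: net_count_Cons[of c a p]) (simp add: net_count_def)
  next
    case (Cons d q)
    have "net_count c (a # p) = net_count c (a # d # q)"
      using Cons.IH Cons by (metis net_count_Cons)
    then show ?thesis using Cons by (auto simp: net_count_cancel)
  qed
qed simp

lemma net_count_eq_0: "c \<notin> set p \<Longrightarrow> prod.swap c \<notin> set p \<Longrightarrow> net_count c p = 0"
  by (simp add: net_count_def)

context pair_wf_digraph
begin

declare awalk_append_iff [simp del]

lemma walk_Nil [simp]: "walk G u [] v \<longleftrightarrow> u = v \<and> u \<in> pverts G"
  by (auto simp: awalk_def)

lemma walk_Cons [simp]:
  "walk G u (a # p) v \<longleftrightarrow> a \<in> parcs G \<and> fst a = u \<and> walk G (snd a) p v"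
  by (auto simp: awalk_def arc_fst_in_verts arc_snd_in_verts)

lemma walk_append: "walk G u (p @ q) v \<longleftrightarrow> (\<exists>w. walk G u p w \<and> walk G w q v)"
  by (induction p arbitrary: u) (auto dest: awalk_hd_in_verts)

lemma walk_verts: "walk G u p v \<Longrightarrow> u \<in> pverts G" "walk G u p v \<Longrightarrow> v \<in> pverts G"
  by (induction p arbitrary: u) (auto simp: arc_fst_in_verts)

lemma walk_arcs: "walk G u p v \<Longrightarrow> set p \<subseteq> parcs G"
  by (auto simp: awalk_def)

lemma walk_last: "walk G u p v \<Longrightarrow> p \<noteq> [] \<Longrightarrow> v = snd (last p)"
  by (induction p arbitrary: u) auto

lemma walk_end_unique: "walk G u p v \<Longrightarrow> walk G u p w \<Longrightarrow> v = w"
  by (induction p arbitrary: u) auto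

lemma walk_reduce: "walk G u p v \<Longrightarrow> walk G u (reduce p) v"
proof (induction p arbitrary: u)
  case (Cons a p)
  then have "walk G (snd a) (reduce p) v" by simp
  then show ?case using Cons.prems by (auto split: list.splits)
qed simp

lemma closed_subwalk:
  assumes w: "walk G u p v" "nonbacktracking p" and rep: "\<not> distinct (map snd p)"
  shows "\<exists>y q. q \<noteq> [] \<and> length q < length p \<and> walk G y q y \<and> nonbacktracking q"
proof -
  obtain xs ys zs y where d: "map snd p = xs @ [y] @ ys @ [y] @ zs"
    using not_distinct_decomp[OF rep] by blast
  obtain p1 a p2 c p3 where p: "p = p1 @ a # p2 @ c # p3" "snd a = y" "snd c = y"
    using d[symmetric] by (auto simp: append_eq_map_conv Cons_eq_map_conv)
  have "walk G y (p2 @ [c]) y"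
    using w(1) p by (auto simp: walk_append arc_snd_in_verts)
  moreover have "nonbacktracking (p2 @ [c])"
    using w(2) p by (auto simp: nonbacktracking_append nonbacktracking_Cons)
  ultimately show ?thesis using p(1) by (intro exI[of _ y] exI[of _ "p2 @ [c]"]) simp
qed

end

lemma (in pair_bidirected_digraph) swap_arc: "prod.swap a \<in> parcs G \<longleftrightarrow> a \<in> parcs G"
  using pair_sym_arcs by (cases a) (auto simp: symmetric_def sym_def)

section \<open>Geodesics in trees\<close>

locale gtree =
  fixes H :: "'b pair_pre_digraph"
  assumes tree: "graph_tree H"
begin

sublocale pair_bidirected_digraph H
  using tree by (simp add: graph_tree_def)

text \<open>A closed non-backtracking walk could be shrunk until no vertex repeats. It would then be a
  cycle, thus have at most two arcs, and so run along an edge and back.\<close>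

lemma nb_closed_walk_Nil: "walk H u p u \<Longrightarrow> nonbacktracking p \<Longrightarrow> p = []"
proof (induction "length p" arbitrary: p u rule: less_induct)
  case less
  have cas: "pcas u p u" using less.prems(1) by (simp add: awalk_def)
  show ?case
  proof (rule ccontr)
    assume ne: "p \<noteq> []"
    have verts: "tl (pawalk_verts u p) = map snd p"
      using awalk_verts_conv'[OF cas] ne by simp
    show False
    proof (cases "distinct (map snd p)")
      case True
      then have "pre_digraph.cycle (with_proj H) p"
        using less.prems ne verts unfolding cycle_def by auto
      then have "length p \<le> 2" using tree by (simp add: graph_tree_def)
      then consider a where "p = [a]" | a c where "p = [a, c]"
        using ne by (cases p rule: list.exhaust; cases "tl p") auto
      then show False
      proof cases
        case 1 with less.prems show False using pair_no_loops[of a] by auto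
      next
        case 2 with less.prems show False by (auto simp: nonbacktracking_Cons prod_eq_iff)
      qed
    next
      case False
      then show False using closed_subwalk[OF less.prems] less.hyps by blast
    qed
  qed
qed

lemma distinct_nb_walk: "walk H u p v \<Longrightarrow> nonbacktracking p \<Longrightarrow> distinct (map snd p)"
  using closed_subwalk[of u p v] nb_closed_walk_Nil by blast

text \<open>After their common beginning, one of two different geodesics followed by the inverse of the
  other would be a closed non-backtracking walk.\<close>

lemma nb_walk_unique:
  "walk H u p v \<Longrightarrow> nonbacktracking p \<Longrightarrow> walk H u q v \<Longrightarrow> nonbacktracking q \<Longrightarrow> p = q"
proof (induction p arbitrary: u q)
  case Nil
  then have "u = v" by simp
  with Nil show ?case using nb_closed_walk_Nil[of u q] by simp
next
  case (Cons a p)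
  show ?case
  proof (cases q)
    case Nil
    then have "u = v" using Cons.prems(3) by simp
    then show ?thesis using nb_closed_walk_Nil[OF _ Cons.prems(2)] Cons.prems(1) by blast
  next
    case (Cons c q')
    have "a = c"
    proof (rule ccontr)
      assume "a \<noteq> c"
      have "walk H v (rev_path q @ a # p) v"
        using awalk_rev_path[of v q u] Cons.prems(1,3) unfolding walk_append by blast
      moreover have "nonbacktracking (rev_path q @ a # p)"
        using Cons.prems(2,4) \<open>a \<noteq> c\<close> \<open>q = c # q'\<close>
        by (auto simp: nonbacktracking_append nonbacktracking_Cons last_rev_path swap_eq_iff)
      ultimately show False using nb_closed_walk_Nil by blast
    qed
    then show ?thesis using Cons.IH[of "snd a" q'] Cons.prems Cons by (auto simp: nonbacktracking_Cons)
  qed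
qed

definition tpath :: "'b \<Rightarrow> 'b \<Rightarrow> ('b \<times> 'b) list" where
  "tpath u v = (THE p. walk H u p v \<and> nonbacktracking p)"

lemma tpath_eqI: "walk H u p v \<Longrightarrow> nonbacktracking p \<Longrightarrow> tpath u v = p"
  unfolding tpath_def using nb_walk_unique by blast

lemma walk_exists:
  assumes "u \<in> pverts H" "v \<in> pverts H" shows "\<exists>p. walk H u p v"
proof -
  have "strongly_connected (with_proj H)"
    using tree pair_sym_arcs by (auto simp: graph_tree_def intro: symmetric_connected_imp_strongly_connected)
  then have "u \<rightarrow>\<^sup>*\<^bsub>with_proj H\<^esub> v" using assms by (auto simp: strongly_connected_def)
  then show ?thesis by (simp add: reachable_awalk)
qed

lemma tpath:
  assumes "u \<in> pverts H" "v \<in> pverts H"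
  shows walk_tpath: "walk H u (tpath u v) v" and nb_tpath: "nonbacktracking (tpath u v)"
proof -
  obtain p where "walk H u p v" using walk_exists assms by blast
  then have "walk H u (reduce p) v" by (rule walk_reduce)
  then show "walk H u (tpath u v) v" "nonbacktracking (tpath u v)" using tpath_eqI by auto
qed

lemma reduce_eq_tpath: "walk H u p v \<Longrightarrow> reduce p = tpath u v"
  using tpath_eqI walk_reduce by (metis nonbacktracking_reduce)

lemma tpath_self [simp]: "u \<in> pverts H \<Longrightarrow> tpath u u = []"
  by (rule tpath_eqI) auto

lemma rev_tpath: "u \<in> pverts H \<Longrightarrow> v \<in> pverts H \<Longrightarrow> rev_path (tpath u v) = tpath v u"
  using tpath_eqI[of v "rev_path (tpath u v)" u] tpath[of u v] by simp

lemma gdist_eq_length_tpath: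
  assumes "u \<in> pverts H" "v \<in> pverts H" shows "gdist H u v = length (tpath u v)"
  unfolding gdist_def
proof (rule Least_equality)
  show "\<exists>p. walk H u p v \<and> length p = length (tpath u v)" using walk_tpath assms by blast
next
  fix n assume "\<exists>p. walk H u p v \<and> length p = n"
  then show "length (tpath u v) \<le> n" using reduce_eq_tpath length_reduce by metis
qed

end


section \<open>Lifting walks to the universal cover\<close>

locale covering_tree =
  fixes G :: "'a pair_pre_digraph" and \<T> :: "'b pair_pre_digraph" and \<pi> :: "'b \<Rightarrow> 'a"
  assumes base: "pair_graph G" and cover: "universal_cover G \<T> \<pi>"
begin

sublocale G: pair_graph G
  by (rule base)

sublocale T: gtree \<T>
  using cover by unfold_locales (simp add: universal_cover_def)

abbreviation proj :: "('b \<times> 'b) list \<Rightarrow> ('a \<times> 'a) list" where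
  "proj \<equiv> map (map_prod \<pi> \<pi>)"

lemma star_bij:
  "x \<in> pverts \<T> \<Longrightarrow> bij_betw \<pi> {y. (x, y) \<in> parcs \<T>} {w. (\<pi> x, w) \<in> parcs G}"
  using cover by (simp add: universal_cover_def)

lemma proj_vertex: "x \<in> pverts \<T> \<Longrightarrow> \<pi> x \<in> pverts G"
  using cover by (auto simp: universal_cover_def)

lemma proj_arc: "(x, y) \<in> parcs \<T> \<Longrightarrow> (\<pi> x, \<pi> y) \<in> parcs G"
  using star_bij[of x] T.arc_fst_in_verts[of "(x, y)"] by (auto simp: bij_betw_def)

lemma local_inj: "(x, y) \<in> parcs \<T> \<Longrightarrow> (x, z) \<in> parcs \<T> \<Longrightarrow> \<pi> y = \<pi> z \<Longrightarrow> y = z"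
  using star_bij[of x] T.arc_fst_in_verts[of "(x, y)"] by (auto simp: bij_betw_def inj_on_def)

definition lift_step :: "'b \<Rightarrow> 'a \<Rightarrow> 'b" where
  "lift_step x w = (THE y. (x, y) \<in> parcs \<T> \<and> \<pi> y = w)"

definition lift_end :: "'b \<Rightarrow> ('a \<times> 'a) list \<Rightarrow> 'b" where
  "lift_end x q = foldl (\<lambda>x a. lift_step x (snd a)) x q"

lemma lift_end_simps [simp]:
  "lift_end x [] = x"
  "lift_end x (a # q) = lift_end (lift_step x (snd a)) q"
  "lift_end x (q @ q') = lift_end (lift_end x q) q'"
  by (simp_all add: lift_end_def)

lemma lift_step_eq: "(x, y) \<in> parcs \<T> \<Longrightarrow> lift_step x (\<pi> y) = y"
  unfolding lift_step_def using local_inj by blast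

lemma lift_step:
  assumes "x \<in> pverts \<T>" "(\<pi> x, w) \<in> parcs G"
  shows "(x, lift_step x w) \<in> parcs \<T>" "\<pi> (lift_step x w) = w" "lift_step x w \<in> pverts \<T>"
proof -
  obtain y where y: "(x, y) \<in> parcs \<T>" "\<pi> y = w"
    using star_bij[OF assms(1)] assms(2) by (force simp: bij_betw_def)
  then show "(x, lift_step x w) \<in> parcs \<T>" "\<pi> (lift_step x w) = w" "lift_step x w \<in> pverts \<T>"
    using lift_step_eq[OF y(1)] T.arc_snd_in_verts[OF y(1)] by auto
qed

lemma walk_proj: "walk \<T> x p y \<Longrightarrow> walk G (\<pi> x) (proj p) (\<pi> y)"
  by (induction p arbitrary: x) (auto simp: proj_vertex proj_arc)

lemma lift_end_proj: "walk \<T> x p y \<Longrightarrow> lift_end x (proj p) = y"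
  by (induction p arbitrary: x) (auto simp: lift_step_eq)

lemma lift_walk:
  "x \<in> pverts \<T> \<Longrightarrow> walk G (\<pi> x) q v \<Longrightarrow> \<exists>p. walk \<T> x p (lift_end x q) \<and> proj p = q"
proof (induction q arbitrary: x)
  case Nil
  then show ?case by auto
next
  case (Cons a q)
  let ?y = "lift_step x (snd a)"
  have a: "(\<pi> x, snd a) \<in> parcs G" using Cons.prems by (cases a) auto
  note y = lift_step[OF Cons.prems(1) a]
  have "walk G (\<pi> ?y) q v" using Cons.prems y by simp
  then obtain p where "walk \<T> ?y p (lift_end ?y q)" "proj p = q"
    using Cons.IH[OF y(3)] by blast
  moreover have "(\<pi> x, snd a) = a" using Cons.prems(2) by (cases a) simp
  ultimately have "walk \<T> x ((x, ?y) # p) (lift_end x (a # q))" "proj ((x, ?y) # p) = a # q"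
    using y by simp_all
  then show ?case by (intro exI[of _ "(x, ?y) # p"] conjI)
qed

lemma
  assumes "x \<in> pverts \<T>" "walk G (\<pi> x) q v"
  shows lift_end_vertex: "lift_end x q \<in> pverts \<T>" and proj_lift_end: "\<pi> (lift_end x q) = v"
proof -
  obtain p where p: "walk \<T> x p (lift_end x q)" "proj p = q" using lift_walk[OF assms] by blast
  show "lift_end x q \<in> pverts \<T>" by (rule T.walk_verts(2)[OF p(1)])
  show "\<pi> (lift_end x q) = v" using G.walk_end_unique[OF _ assms(2)] walk_proj[OF p(1)] p(2) by simp
qed

text \<open>A covering map is injective on the star of a vertex, so a walk turns back exactly where its
  projection does.\<close>

lemma nonbacktracking_proj: "walk \<T> x p y \<Longrightarrow> nonbacktracking (proj p) \<longleftrightarrow> nonbacktracking p"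
proof (induction p arbitrary: x)
  case (Cons a p)
  have "hd (proj p) \<noteq> prod.swap (map_prod \<pi> \<pi> a) \<longleftrightarrow> hd p \<noteq> prod.swap a" if ne: "p \<noteq> []"
  proof -
    obtain c p' where p: "p = c # p'" using ne by (cases p) auto
    have "a \<in> parcs \<T>" "c \<in> parcs \<T>" and c: "fst c = snd a" using Cons.prems p by auto
    then have "(snd a, fst a) \<in> parcs \<T>" "(snd a, snd c) \<in> parcs \<T>"
      using T.swap_arc[of a] unfolding prod.swap_def by (blast, metis c prod.collapse)
    then show ?thesis using p c local_inj by (cases a; cases c) auto
  qed
  then show ?case using Cons by (auto simp: nonbacktracking_Cons)
qed simp

text \<open>An arc and its inverse lift to an edge traversed back and forth; so the end of a lift depends on
  the homotopy class only.\<close>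

lemma lift_end_reduce: "x \<in> pverts \<T> \<Longrightarrow> walk G (\<pi> x) q v \<Longrightarrow> lift_end x (reduce q) = lift_end x q"
proof (induction q arbitrary: x)
  case (Cons a q)
  let ?y = "lift_step x (snd a)"
  have a: "(\<pi> x, snd a) \<in> parcs G" "fst a = \<pi> x" using Cons.prems by (cases a, auto)+
  note y = lift_step[OF Cons.prems(1) a(1)]
  have "lift_end ?y (reduce q) = lift_end ?y q" using Cons y by auto
  moreover have "lift_step ?y (\<pi> x) = x"
    using lift_step_eq[of ?y x] y(1) T.swap_arc[of "(x, ?y)"] by simp
  ultimately show ?case using a by (auto split: list.splits)
qed simp

text \<open>Reading off the arcs of \<open>G\<close> below the geodesic from \<open>x\<close> identifies the vertices of the
  covering tree with the non-backtracking walks of \<open>G\<close> that start below \<open>x\<close>; the inverse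
  is lifting.\<close>

definition label :: "'b \<Rightarrow> 'b \<Rightarrow> ('a \<times> 'a) list" where
  "label x y = proj (T.tpath x y)"

lemma
  assumes "x \<in> pverts \<T>" "y \<in> pverts \<T>"
  shows walk_label: "walk G (\<pi> x) (label x y) (\<pi> y)"
    and nb_label: "nonbacktracking (label x y)"
    and lift_label: "lift_end x (label x y) = y"
    and gdist_eq_length_label: "gdist \<T> x y = length (label x y)"
    and rev_label: "rev_path (label x y) = label y x"
proof -
  note p = T.tpath[OF assms]
  show "walk G (\<pi> x) (label x y) (\<pi> y)" using walk_proj p by (simp add: label_def)
  show "nonbacktracking (label x y)" using nonbacktracking_proj p by (simp add: label_def)
  show "lift_end x (label x y) = y" using lift_end_proj p by (simp add: label_def)
  show "gdist \<T> x y = length (label x y)" using assms by (simp add: label_def T.gdist_eq_length_tpath)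
  have "rev_path (proj r) = proj (rev_path r)" for r by (induction r) auto
  then show "rev_path (label x y) = label y x" using assms by (simp add: label_def T.rev_tpath)
qed

lemma label_lift_end:
  assumes "x \<in> pverts \<T>" "walk G (\<pi> x) q v" "nonbacktracking q"
  shows "label x (lift_end x q) = q"
proof -
  obtain p where p: "walk \<T> x p (lift_end x q)" "proj p = q" using lift_walk[OF assms(1,2)] by blast
  then have "T.tpath x (lift_end x q) = p"
    using T.tpath_eqI[OF p(1)] nonbacktracking_proj[OF p(1)] assms(3) by simp
  then show ?thesis using p(2) by (simp add: label_def)
qed

lemma label_lift_end_reduce:
  assumes "x \<in> pverts \<T>" "walk G (\<pi> x) q v"
  shows "label x (lift_end x q) = reduce q"
  using label_lift_end[of x "reduce q" v] lift_end_reduce[of x q v] G.walk_reduce assms by simp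

lemma closed_walk_eq_label: "closed_walk \<T> \<pi> x \<gamma> = label (\<gamma> x) x"
  by (simp add: closed_walk_def label_def T.tpath_def)

lemma label_arc:
  assumes "x \<in> pverts \<T>" "(y, z) \<in> parcs \<T>"
  shows "label x z = reduce (label x y @ [(\<pi> y, \<pi> z)])"
proof -
  have y: "y \<in> pverts \<T>" using assms(2) T.arc_fst_in_verts by force
  have "walk G (\<pi> x) (label x y @ [(\<pi> y, \<pi> z)]) (\<pi> z)"
    using walk_label[OF assms(1) y] proj_arc[OF assms(2)] G.arc_snd_in_verts[OF proj_arc[OF assms(2)]]
    by (auto simp: G.walk_append)
  from label_lift_end_reduce[OF assms(1) this] show ?thesis
    using lift_label[OF assms(1) y] lift_step_eq[OF assms(2)] by simp
qed


section \<open>The group of deck transformations\<close>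

abbreviation deck :: "('b \<Rightarrow> 'b) monoid" where
  "deck \<equiv> deck_group \<T> \<pi>"

lemma deckD:
  assumes "\<gamma> \<in> carrier deck"
  shows "\<gamma> \<in> Bij (pverts \<T>)" "x \<in> pverts \<T> \<Longrightarrow> \<gamma> x \<in> pverts \<T>" "x \<in> pverts \<T> \<Longrightarrow> \<pi> (\<gamma> x) = \<pi> x"
    "(x, y) \<in> parcs \<T> \<Longrightarrow> (\<gamma> x, \<gamma> y) \<in> parcs \<T>"
proof -
  show 1: "\<gamma> \<in> Bij (pverts \<T>)" using assms by (simp add: deck_group_def)
  show "x \<in> pverts \<T> \<Longrightarrow> \<gamma> x \<in> pverts \<T>" using 1 by (auto simp: Bij_def bij_betw_def)
  show "x \<in> pverts \<T> \<Longrightarrow> \<pi> (\<gamma> x) = \<pi> x" using assms by (simp add: deck_group_def)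
  show "(x, y) \<in> parcs \<T> \<Longrightarrow> (\<gamma> x, \<gamma> y) \<in> parcs \<T>"
    using assms T.in_arcsD1[of x y] T.in_arcsD2[of x y] by (simp add: deck_group_def)
qed

lemma deck_mult:
  assumes "\<gamma> \<in> carrier deck" "\<delta> \<in> carrier deck" "x \<in> pverts \<T>"
  shows "(\<gamma> \<otimes>\<^bsub>deck\<^esub> \<delta>) x = \<gamma> (\<delta> x)"
  using deckD(1)[OF assms(1)] deckD(1)[OF assms(2)] assms(3)
  by (simp add: deck_group_def BijGroup_def compose_def)

lemma deck_one: "x \<in> pverts \<T> \<Longrightarrow> \<one>\<^bsub>deck\<^esub> x = x"
  by (simp add: deck_group_def BijGroup_def)

text \<open>The image of a lift under a deck transformation lifts the same walk, and a lift is determined by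
  its first vertex.\<close>

lemma deck_lift_end:
  assumes "\<gamma> \<in> carrier deck"
  shows "x \<in> pverts \<T> \<Longrightarrow> walk G (\<pi> x) q v \<Longrightarrow> \<gamma> (lift_end x q) = lift_end (\<gamma> x) q"
proof (induction q arbitrary: x)
  case (Cons a q)
  have a: "(\<pi> x, snd a) \<in> parcs G" using Cons.prems by (cases a) auto
  note y = lift_step[OF Cons.prems(1) a]
  have "lift_step (\<gamma> x) (snd a) = \<gamma> (lift_step x (snd a))"
    using lift_step_eq[OF deckD(4)[OF assms y(1)]] y deckD(3)[OF assms y(3)] by simp
  then show ?case using Cons y by auto
qed simp

text \<open>Every vertex ends a lift that starts at \<open>x\<close>, so the image of \<open>x\<close> determines all other images.\<close>

lemma deck_eqI:
  assumes "\<gamma> \<in> carrier deck" "\<delta> \<in> carrier deck" "x \<in> pverts \<T>" "\<gamma> x = \<delta> x"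
  shows "\<gamma> = \<delta>"
proof (rule extensionalityI[of _ "pverts \<T>"])
  show "\<gamma> \<in> extensional (pverts \<T>)" "\<delta> \<in> extensional (pverts \<T>)"
    using deckD(1) assms by (auto simp: Bij_def)
next
  fix y assume y: "y \<in> pverts \<T>"
  show "\<gamma> y = \<delta> y"
    using deck_lift_end[OF assms(1,3) walk_label[OF assms(3) y]]
      deck_lift_end[OF assms(2,3) walk_label[OF assms(3) y]] assms(4) lift_label[OF assms(3) y] by simp
qed

text \<open>The deck transformation that takes \<open>x\<close> to \<open>y\<close> transports a vertex by keeping its label:
  it replaces the lift of a walk from \<open>x\<close> by the lift of the same walk from \<open>y\<close>.\<close>

lemma deck_exists:
  assumes x: "x \<in> pverts \<T>" and y: "y \<in> pverts \<T>" and xy: "\<pi> x = \<pi> y"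
  shows "\<exists>\<gamma>\<in>carrier deck. \<gamma> x = y"
proof -
  \<comment> \<open>The transport from \<open>x\<close> to \<open>y\<close>; its inverse is the transport from \<open>y\<close> to \<open>x\<close>.\<close>
  define tr where "tr = (\<lambda>x y. \<lambda>z\<in>pverts \<T>. lift_end y (label x z))"
  have key: "tr x y z \<in> pverts \<T>" "\<pi> (tr x y z) = \<pi> z" "tr y x (tr x y z) = z"
    if "x \<in> pverts \<T>" "y \<in> pverts \<T>" "\<pi> x = \<pi> y" "z \<in> pverts \<T>" for x y z
  proof -
    have w: "walk G (\<pi> y) (label x z) (\<pi> z)" using walk_label that by metis
    show 1: "tr x y z \<in> pverts \<T>" using lift_end_vertex[OF _ w] that by (simp add: tr_def)
    show "\<pi> (tr x y z) = \<pi> z" using proj_lift_end[OF _ w] that by (simp add: tr_def)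
    have "label y (tr x y z) = label x z"
      using label_lift_end[OF _ w nb_label] that by (simp add: tr_def)
    moreover have "tr y x z' = lift_end x (label y z')" if "z' \<in> pverts \<T>" for z'
      using that by (simp add: tr_def)
    ultimately show "tr y x (tr x y z) = z" using 1 lift_label[OF that(1,4)] by metis
  qed
  have arc: "(tr x y z, tr x y z') \<in> parcs \<T>"
    if "x \<in> pverts \<T>" "y \<in> pverts \<T>" "\<pi> x = \<pi> y" "(z, z') \<in> parcs \<T>" for x y z z'
  proof -
    have z: "z \<in> pverts \<T>" "z' \<in> pverts \<T>" using that T.arc_fst_in_verts T.arc_snd_in_verts by force+
    have a: "(\<pi> (tr x y z), \<pi> z') \<in> parcs G" using key(2) that z proj_arc by simp
    have w: "walk G (\<pi> y) (label x z @ [(\<pi> z, \<pi> z')]) (\<pi> z')"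
      using walk_label[OF that(1) z(1)] that proj_arc[OF that(4)] proj_vertex[OF z(2)]
      by (auto simp: G.walk_append)
    have "tr x y z' = lift_end y (reduce (label x z @ [(\<pi> z, \<pi> z')]))"
      using label_arc[OF that(1,4)] z by (simp add: tr_def)
    also have "\<dots> = lift_step (tr x y z) (\<pi> z')"
      using lift_end_reduce[OF that(2) w] z by (simp add: tr_def)
    finally show ?thesis using lift_step(1)[OF key(1)[OF that(1-3) z(1)] a] by simp
  qed
  have "bij_betw (tr x y) (pverts \<T>) (pverts \<T>)"
    by (rule bij_betw_byWitness[where f' = "tr y x"]) (use x y xy key in auto)
  then have "tr x y \<in> Bij (pverts \<T>)" by (simp add: Bij_def tr_def)
  moreover have "(tr x y z, tr x y z') \<in> parcs \<T> \<longleftrightarrow> (z, z') \<in> parcs \<T>"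
    if "z \<in> pverts \<T>" "z' \<in> pverts \<T>" for z z'
    using arc[of x y z z'] arc[of y x "tr x y z" "tr x y z'"] key(3) x y xy that by metis
  ultimately have "tr x y \<in> carrier deck" using key(2) x y xy by (simp add: deck_group_def)
  moreover have "tr x y x = y" using x by (simp add: tr_def label_def)
  ultimately show ?thesis by blast
qed

text \<open>Equations between deck transformations are tested at one vertex; inverses exist because the
  action is transitive on fibres.\<close>

lemma group_deck: "group deck"
proof -
  have ne: "pverts \<T> \<noteq> {}"
    using T.tree by (auto simp: graph_tree_def Digraph_Component.connected_def strongly_connected_def)
  then obtain x where x: "x \<in> pverts \<T>" by blast
  have closed: "\<gamma> \<otimes>\<^bsub>deck\<^esub> \<delta> \<in> carrier deck" if g: "\<gamma> \<in> carrier deck" "\<delta> \<in> carrier deck" for \<gamma> \<delta>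
  proof -
    have "\<gamma> \<otimes>\<^bsub>deck\<^esub> \<delta> \<in> Bij (pverts \<T>)"
      using compose_Bij deckD(1)[OF g(1)] deckD(1)[OF g(2)] by (simp add: deck_group_def BijGroup_def)
    moreover have "((\<gamma> \<otimes>\<^bsub>deck\<^esub> \<delta>) x, (\<gamma> \<otimes>\<^bsub>deck\<^esub> \<delta>) y) \<in> parcs \<T> \<longleftrightarrow> (x, y) \<in> parcs \<T>"
      if "x \<in> pverts \<T>" "y \<in> pverts \<T>" for x y
      using that g deckD(2)[OF g(2)] unfolding deck_mult[OF g that(1)] deck_mult[OF g that(2)]
      by (simp add: deck_group_def)
    moreover have "\<pi> ((\<gamma> \<otimes>\<^bsub>deck\<^esub> \<delta>) x) = \<pi> x" if "x \<in> pverts \<T>" for x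
      using that g deckD by (simp add: deck_mult)
    ultimately show ?thesis by (simp add: deck_group_def)
  qed
  have one: "\<one>\<^bsub>deck\<^esub> \<in> carrier deck"
    using id_Bij by (auto simp: deck_group_def BijGroup_def)
  show ?thesis
  proof (rule groupI)
    fix \<gamma> assume g: "\<gamma> \<in> carrier deck"
    show "\<one>\<^bsub>deck\<^esub> \<otimes>\<^bsub>deck\<^esub> \<gamma> = \<gamma>"
      using deck_eqI[OF closed[OF one g] g x] g deckD x by (simp add: deck_mult one deck_one)
    obtain \<delta> where d: "\<delta> \<in> carrier deck" "\<delta> (\<gamma> x) = x"
      using deck_exists[of "\<gamma> x" x] deckD[OF g] x by blast
    then show "\<exists>\<delta>\<in>carrier deck. \<delta> \<otimes>\<^bsub>deck\<^esub> \<gamma> = \<one>\<^bsub>deck\<^esub>"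
      using deck_eqI[OF closed[OF d(1) g] one x] g x by (auto simp: deck_mult deck_one)
  next
    fix \<gamma> \<delta> \<epsilon> assume g: "\<gamma> \<in> carrier deck" "\<delta> \<in> carrier deck" "\<epsilon> \<in> carrier deck"
    show "\<gamma> \<otimes>\<^bsub>deck\<^esub> \<delta> \<otimes>\<^bsub>deck\<^esub> \<epsilon> = \<gamma> \<otimes>\<^bsub>deck\<^esub> (\<delta> \<otimes>\<^bsub>deck\<^esub> \<epsilon>)"
      by (rule deck_eqI[OF closed[OF closed[OF g(1,2)] g(3)] closed[OF g(1) closed[OF g(2,3)]] x])
        (simp add: deck_mult[OF closed[OF g(1,2)] g(3) x] deck_mult[OF g(1) closed[OF g(2,3)] x]
          deck_mult[OF g(2,3) x] deck_mult[OF g(1,2) deckD(2)[OF g(3) x]])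
  qed (use closed one in auto)
qed

end


section \<open>Words in the edges outside a spanning tree\<close>

abbreviation flip :: "nat \<times> bool \<Rightarrow> nat \<times> bool" where
  "flip l \<equiv> (fst l, \<not> snd l)"

lemma reduced_word_Nil [simp]: "reduced_word b []"
  by (simp add: reduced_word_def)

lemma reduced_word_successively:
  "reduced_word b w \<longleftrightarrow> fst ` set w \<subseteq> {..<b} \<and> successively (\<lambda>l l'. l' \<noteq> flip l) w"
  by (simp add: reduced_word_def successively_conv_nth)

lemma reduced_word_Cons:
  "reduced_word b (l # w) \<longleftrightarrow> fst l < b \<and> reduced_word b w \<and> (w \<noteq> [] \<longrightarrow> hd w \<noteq> flip l)"
  by (auto simp: reduced_word_successively successively_Cons)

lemma reduced_word_append:
  "reduced_word b (w @ w') \<longleftrightarrow> reduced_word b w \<and> reduced_word b w' \<and>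
     (w \<noteq> [] \<longrightarrow> w' \<noteq> [] \<longrightarrow> hd w' \<noteq> flip (last w))"
  by (auto simp: reduced_word_successively successively_append_iff)

lemma reduced_wordD: "reduced_word b w \<Longrightarrow> l \<in> set w \<Longrightarrow> fst l < b"
  by (auto simp: reduced_word_def)

text \<open>When only one index occurs, a letter can be followed by itself or by its inverse, and the latter
  cancels.\<close>

lemma reduced_word_single_index:
  assumes "reduced_word b w" "\<And>l. l \<in> set w \<Longrightarrow> fst l = i" "(i, s) \<in> set w"
  shows "w = replicate (length w) (i, s)"
proof -
  have "\<exists>t. w = replicate (length w) (i, t)"
    using assms(1,2)
  proof (induction w)
    case (Cons l w)
    then obtain t where t: "w = replicate (length w) (i, t)" by (auto simp: reduced_word_Cons)
    show ?case
    proof (cases w)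
      case Nil
      then show ?thesis using Cons.prems by (cases l) auto
    next
      case (Cons l' w')
      then have "l' = (i, t)" using t by auto
      moreover have "l' \<noteq> flip l" "fst l = i" using Cons.prems Cons by (auto simp: reduced_word_Cons)
      ultimately have "l = (i, t)" by (cases l) auto
      then show ?thesis using t by (metis length_Cons replicate_Suc)
    qed
  qed simp
  then show ?thesis using assms(3) by (metis in_set_replicate prod.inject)
qed

lemma net_count_filter:
  assumes "P c" "P (prod.swap c)"
  shows "net_count c (filter P q) = net_count c q"
  by (induction q) (use assms in \<open>auto simp: net_count_def\<close>)

locale marked_cover = covering_tree G \<T> \<pi>
  for G :: "'a pair_pre_digraph" and \<T> :: "'b pair_pre_digraph" and \<pi> :: "'b \<Rightarrow> 'a" +
  fixes B :: "'a pair_pre_digraph" and x0 :: 'b and b :: nat and e :: "nat \<Rightarrow> 'a \<times> 'a"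
  assumes x0: "x0 \<in> pverts \<T>"
    and spanning_tree: "spanning_graph_tree B G"
    and cotree: "cotree_edges G B b e"
begin

sublocale B: gtree B
  using spanning_tree by unfold_locales (simp add: spanning_graph_tree_def)

abbreviation v0 :: 'a where "v0 \<equiv> \<pi> x0"

lemma verts_B [simp]: "pverts B = pverts G"
  using spanning_tree by (simp add: spanning_graph_tree_def spanning_def)

lemma arcs_B: "a \<in> parcs B \<Longrightarrow> a \<in> parcs G"
  using spanning_tree by (auto simp: spanning_graph_tree_def spanning_def subgraph_def)

lemma v0: "v0 \<in> pverts G"
  using x0 by (rule proj_vertex)

lemma walk_B: "walk B u p v \<Longrightarrow> walk G u p v"
  by (induction p arbitrary: u) (auto simp: arcs_B)

lemma walk_in_B: "walk G u p v \<Longrightarrow> set p \<subseteq> parcs B \<Longrightarrow> walk B u p v"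
  by (induction p arbitrary: u) auto

lemma walk_tpath_B: "u \<in> pverts G \<Longrightarrow> v \<in> pverts G \<Longrightarrow> walk G u (B.tpath u v) v"
  using B.walk_tpath walk_B by simp

lemma set_tpath_B: "u \<in> pverts G \<Longrightarrow> v \<in> pverts G \<Longrightarrow> set (B.tpath u v) \<subseteq> parcs B"
  by (rule B.walk_arcs[OF B.walk_tpath]) simp_all

text \<open>The arc that the geodesic from the base point to its translate crosses for a letter. The closed
  walk of a deck transformation runs from the translate back to the base point, so that geodesic
  crosses the edge of a generator against its chosen orientation.\<close>

definition letter_arc :: "nat \<times> bool \<Rightarrow> 'a \<times> 'a" where
  "letter_arc l = (if snd l then prod.swap (e (fst l)) else e (fst l))"

lemma letter_arc_flip: "letter_arc (flip l) = prod.swap (letter_arc l)"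
  by (simp add: letter_arc_def)

lemma letter_arc:
  assumes "fst l < b" shows "letter_arc l \<in> parcs G" "letter_arc l \<notin> parcs B"
  using assms cotree unfolding cotree_edges_def letter_arc_def by auto

lemma letter_arc_verts:
  assumes "fst l < b" shows "fst (letter_arc l) \<in> pverts G" "snd (letter_arc l) \<in> pverts G"
  using letter_arc(1)[OF assms] G.arc_fst_in_verts G.arc_snd_in_verts by auto

lemma letter_arc_inj:
  assumes "fst l < b" "fst l' < b" "letter_arc l = letter_arc l'" shows "l = l'"
proof -
  have d: "e i \<noteq> prod.swap (e j)" if "i < b" "j < b" for i j
    using that cotree unfolding cotree_edges_def by auto
  have i: "i = j" if "e i = e j" "i < b" "j < b" for i j
    using that cotree unfolding cotree_edges_def by (auto dest: inj_onD)
  have "prod.swap (e i) = prod.swap (e j) \<longleftrightarrow> e i = e j" for i j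
    by (metis prod.swap_def swap_swap)
  then show ?thesis
    using assms d[of "fst l" "fst l'"] d[of "fst l'" "fst l"] i[of "fst l" "fst l'"]
    by (cases l; cases l') (auto simp: letter_arc_def split: if_splits)
qed

lemma letter_arc_surj:
  assumes "a \<in> parcs G" "a \<notin> parcs B" shows "\<exists>l. fst l < b \<and> letter_arc l = a"
proof -
  have "a \<in> e ` {..<b} \<union> prod.swap ` e ` {..<b}" using assms cotree by (auto simp: cotree_edges_def)
  then consider i where "i < b" "a = e i" | i where "i < b" "a = prod.swap (e i)" by auto
  then show ?thesis
  proof cases
    case 1 then show ?thesis by (intro exI[of _ "(i, False)"]) (simp add: letter_arc_def)
  next
    case 2 then show ?thesis by (intro exI[of _ "(i, True)"]) (simp add: letter_arc_def)
  qed
qed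

text \<open>The walk of a word crosses the arcs of its letters in order and follows geodesics of the spanning
  tree in between and at both ends. The stem is the part up to the last letter; unlike the whole
  walk it is prolonged, not altered, when the word is prolonged.\<close>

fun stem :: "'a \<Rightarrow> (nat \<times> bool) list \<Rightarrow> ('a \<times> 'a) list" where
  "stem v [] = []"
| "stem v (l # w) = B.tpath v (fst (letter_arc l)) @ letter_arc l # stem (snd (letter_arc l)) w"

definition stem_end :: "'a \<Rightarrow> (nat \<times> bool) list \<Rightarrow> 'a" where
  "stem_end v w = (if w = [] then v else snd (letter_arc (last w)))"

definition word_walk :: "'a \<Rightarrow> (nat \<times> bool) list \<Rightarrow> 'a \<Rightarrow> ('a \<times> 'a) list" where
  "word_walk v w u = stem v w @ B.tpath (stem_end v w) u"

lemma stem_end_simps [simp]: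
  "stem_end v [] = v" "stem_end v (l # w) = stem_end (snd (letter_arc l)) w"
  by (auto simp: stem_end_def)

lemma word_walk_simps [simp]:
  "word_walk v [] u = B.tpath v u"
  "word_walk v (l # w) u =
     B.tpath v (fst (letter_arc l)) @ letter_arc l # word_walk (snd (letter_arc l)) w u"
  by (simp_all add: word_walk_def)

lemma stem_append: "stem v (w @ w') = stem v w @ stem (stem_end v w) w'"
  by (induction w arbitrary: v) auto

lemma length_stem: "length w \<le> length (stem v w)"
  by (induction w arbitrary: v) (auto simp: le_SucI trans_le_add2)

lemma stem_ne: "w \<noteq> [] \<Longrightarrow> stem v w \<noteq> []"
  by (cases w) auto

lemma last_stem: "w \<noteq> [] \<Longrightarrow> last (stem v w) = letter_arc (last w)"
proof (induction w arbitrary: v)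
  case (Cons l w)
  then show ?case by (cases w) auto
qed simp

lemma stem_end_vert: "v \<in> pverts G \<Longrightarrow> fst ` set w \<subseteq> {..<b} \<Longrightarrow> stem_end v w \<in> pverts G"
  by (cases w rule: rev_cases) (auto simp: stem_end_def intro!: letter_arc_verts)

lemma walk_stem: "v \<in> pverts G \<Longrightarrow> fst ` set w \<subseteq> {..<b} \<Longrightarrow> walk G v (stem v w) (stem_end v w)"
proof (induction w arbitrary: v)
  case (Cons l w)
  then have l: "fst l < b" by simp
  have "walk G (snd (letter_arc l)) (stem (snd (letter_arc l)) w) (stem_end (snd (letter_arc l)) w)"
    using Cons letter_arc_verts(2)[OF l] by simp
  then show ?case
    using walk_tpath_B[OF Cons.prems(1) letter_arc_verts(1)[OF l]] letter_arc(1)[OF l]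
    by (auto simp: G.walk_append)
qed simp

lemma walk_word_walk:
  "v \<in> pverts G \<Longrightarrow> u \<in> pverts G \<Longrightarrow> fst ` set w \<subseteq> {..<b} \<Longrightarrow> walk G v (word_walk v w u) u"
  unfolding word_walk_def G.walk_append
  using walk_stem[of v w] walk_tpath_B[OF stem_end_vert] by blast

lemma filter_tpath_B:
  assumes "u \<in> pverts G" "v \<in> pverts G" shows "filter (\<lambda>a. a \<notin> parcs B) (B.tpath u v) = []"
  using set_tpath_B[OF assms] by (auto simp: filter_empty_conv)

lemma filter_word_walk:
  "v \<in> pverts G \<Longrightarrow> u \<in> pverts G \<Longrightarrow> fst ` set w \<subseteq> {..<b} \<Longrightarrow>
     filter (\<lambda>a. a \<notin> parcs B) (word_walk v w u) = map letter_arc w"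
  by (induction w arbitrary: v) (auto simp: filter_tpath_B letter_arc letter_arc_verts)

lemma map_letter_arc_inj:
  "fst ` set w \<subseteq> {..<b} \<Longrightarrow> fst ` set w' \<subseteq> {..<b} \<Longrightarrow> map letter_arc w = map letter_arc w' \<Longrightarrow> w = w'"
proof (induction w arbitrary: w')
  case (Cons l w)
  then obtain l' w'' where "w' = l' # w''" by (cases w') auto
  with Cons letter_arc_inj show ?case by auto
qed simp

text \<open>Where a geodesic of the tree meets a letter, only one of the two arcs lies in the tree, so they
  are not inverse to each other; letters that meet directly do not cancel because the word is reduced.\<close>

lemma nb_word_walk:
  "v \<in> pverts G \<Longrightarrow> u \<in> pverts G \<Longrightarrow> reduced_word b w \<Longrightarrow> nonbacktracking (word_walk v w u)"
proof (induction w arbitrary: v)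
  case Nil
  then show ?case using B.nb_tpath by simp
next
  case (Cons l w)
  let ?a = "letter_arc l"
  let ?p = "B.tpath v (fst ?a)" and ?q = "word_walk (snd ?a) w u"
  have l: "fst l < b" and w: "reduced_word b w" using Cons.prems by (auto simp: reduced_word_Cons)
  note a = letter_arc[OF l] letter_arc_verts[OF l]
  have a': "prod.swap ?a \<notin> parcs B" using a B.swap_arc by blast
  have "nonbacktracking ?p" using B.nb_tpath Cons.prems a by simp
  moreover have "nonbacktracking ?q" using Cons a w by blast
  moreover have "?a \<noteq> prod.swap (last ?p)" if "?p \<noteq> []"
  proof
    assume "?a = prod.swap (last ?p)"
    moreover have "last ?p \<in> parcs B"
      using set_tpath_B[OF Cons.prems(1) a(3)] last_in_set[OF that] by blast
    ultimately show False using a(2) B.swap_arc[of "last ?p"] by simp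
  qed
  moreover have "hd ?q \<noteq> prod.swap ?a" if "?q \<noteq> []"
  proof (cases w)
    case Nil
    then show ?thesis
      using set_tpath_B[OF a(4) Cons.prems(2)] hd_in_set[OF that] a' by auto
  next
    case (Cons l' w')
    with w have l': "fst l' < b" by (simp add: reduced_word_Cons)
    show ?thesis
    proof (cases "B.tpath (snd ?a) (fst (letter_arc l'))")
      case Nil
      have "letter_arc l' \<noteq> letter_arc (flip l)"
        using letter_arc_inj[OF l', of "flip l"] l Cons.prems Cons by (auto simp: reduced_word_Cons)
      then show ?thesis using Nil Cons by (simp add: letter_arc_flip)
    next
      case (Cons c p')
      then have "c \<in> parcs B" using set_tpath_B[OF a(4) letter_arc_verts(1)[OF l']] by auto
      then show ?thesis using Cons \<open>w = l' # w'\<close> a' by auto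
    qed
  qed
  ultimately show ?case by (auto simp: nonbacktracking_append nonbacktracking_Cons)
qed

lemma nb_stem: "v \<in> pverts G \<Longrightarrow> reduced_word b w \<Longrightarrow> nonbacktracking (stem v w)"
  using nb_word_walk[of v v w] by (simp add: word_walk_def nonbacktracking_append)

text \<open>Conversely, cutting a non-backtracking walk at the arcs outside the spanning tree leaves
  non-backtracking walks in the tree, which are geodesics.\<close>

lemma word_walk_exists:
  "walk G v q u \<Longrightarrow> nonbacktracking q \<Longrightarrow> \<exists>w. reduced_word b w \<and> q = word_walk v w u"
proof (induction "length q" arbitrary: q v rule: less_induct)
  case less
  show ?case
  proof (cases "set q \<subseteq> parcs B")
    case True
    then have "q = B.tpath v u" using B.tpath_eqI walk_in_B less.prems by metis
    then show ?thesis by (intro exI[of _ "[]"]) simp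
  next
    case False
    then obtain q1 a q2 where q: "q = q1 @ a # q2" "a \<notin> parcs B" "set q1 \<subseteq> parcs B"
      using split_list_first_prop[of q "\<lambda>a. a \<notin> parcs B"] by blast
    have w1: "walk G v q1 (fst a)" and a: "a \<in> parcs G" and w2: "walk G (snd a) q2 u"
      using less.prems(1) q by (auto simp: G.walk_append)
    have q1: "q1 = B.tpath v (fst a)"
      using B.tpath_eqI[OF walk_in_B[OF w1 q(3)]] less.prems(2) q by (simp add: nonbacktracking_append)
    obtain l where l: "fst l < b" "letter_arc l = a" using letter_arc_surj a q by blast
    obtain w where w: "reduced_word b w" "q2 = word_walk (snd a) w u"
      using less.hyps[of q2 "snd a"] w2 less.prems(2) q
      by (auto simp: nonbacktracking_append nonbacktracking_Cons)
    have "hd w \<noteq> flip l" if ne: "w \<noteq> []"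
    proof
      assume h: "hd w = flip l"
      obtain w' where w': "w = flip l # w'" using ne h by (cases w) auto
      have "q2 = prod.swap a # word_walk (fst a) w' u"
        using w(2) w' l letter_arc_flip[of l] G.arc_snd_in_verts[OF a] by simp
      then show False using less.prems(2) q by (auto simp: nonbacktracking_append nonbacktracking_Cons)
    qed
    then have "reduced_word b (l # w)" using l w by (simp add: reduced_word_Cons)
    moreover have "q = word_walk v (l # w) u" using q q1 l w by simp
    ultimately show ?thesis by blast
  qed
qed

text \<open>Inside the tree, every detour is homotopic to the geodesic.\<close>

lemma lift_tpath_tpath:
  assumes "x \<in> pverts \<T>" "u \<in> pverts G" "t \<in> pverts G"
  shows "lift_end x (B.tpath (\<pi> x) u @ B.tpath u t) = lift_end x (B.tpath (\<pi> x) t)"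
proof -
  have x: "\<pi> x \<in> pverts G" using assms proj_vertex by blast
  have w: "walk B (\<pi> x) (B.tpath (\<pi> x) u @ B.tpath u t) t"
    using B.walk_tpath assms x unfolding B.walk_append by fastforce
  show ?thesis
    using lift_end_reduce[OF assms(1) walk_B[OF w]] B.reduce_eq_tpath[OF w] by simp
qed

lemma lift_tpath_word_walk:
  assumes "x \<in> pverts \<T>" "u \<in> pverts G" "t \<in> pverts G" "fst ` set w \<subseteq> {..<b}"
  shows "lift_end x (B.tpath (\<pi> x) u @ word_walk u w t) = lift_end x (word_walk (\<pi> x) w t)"
proof (cases w)
  case Nil
  then show ?thesis using lift_tpath_tpath[OF assms(1-3)] by simp
next
  case (Cons l w')
  then have "fst (letter_arc l) \<in> pverts G" using letter_arc_verts assms(4) by simp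
  from lift_tpath_tpath[OF assms(1,2) this] show ?thesis using Cons by simp
qed

lemma rev_word_walk_single:
  assumes "fst l < b"
  shows "rev_path (word_walk v0 [l] v0) = word_walk v0 [flip l] v0"
  using letter_arc_verts[OF assms] v0 by (simp add: letter_arc_flip B.rev_tpath)

end


section \<open>Reduced words and deck transformations\<close>

locale marked_deck = marked_cover G \<T> \<pi> B x0 b e
  for G :: "'a pair_pre_digraph" and \<T> :: "'b pair_pre_digraph" and \<pi> :: "'b \<Rightarrow> 'a"
    and B :: "'a pair_pre_digraph" and x0 :: 'b and b :: nat and e :: "nat \<Rightarrow> 'a \<times> 'a" +
  fixes \<gamma> :: "nat \<Rightarrow> 'b \<Rightarrow> 'b" and F :: "'f monoid" and \<alpha> :: "'f \<Rightarrow> 'b \<Rightarrow> 'b" and g :: "nat \<Rightarrow> 'f"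
  assumes generators: "cotree_generators \<T> \<pi> x0 b e \<gamma>"
    and group_F: "group F"
    and iso: "\<alpha> \<in> iso F (deck_group \<T> \<pi>)"
    and g_def: "\<And>i. i < b \<Longrightarrow> g i = inv_into (carrier F) \<alpha> (\<gamma> i)"
begin

sublocale F: group F
  by (rule group_F)

sublocale D: group deck
  by (rule group_deck)

sublocale \<alpha>: group_hom F deck \<alpha>
  using iso by unfold_locales (simp add: iso_def)

lemma gen_deck: "i < b \<Longrightarrow> \<gamma> i \<in> carrier deck"
  using generators by (auto simp: cotree_generators_def)

text \<open>The signed number of passages through \<open>c\<close> on the way from the base point to its translate is a
  homomorphism to the integers, because concatenation followed by cancellation computes the
  product.\<close>

definition net_passages :: "'a \<times> 'a \<Rightarrow> ('b \<Rightarrow> 'b) \<Rightarrow> int" where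
  "net_passages c \<delta> = net_count c (label x0 (\<delta> x0))"

lemma label_deck_mult:
  assumes "\<delta> \<in> carrier deck" "\<epsilon> \<in> carrier deck"
  shows "label x0 ((\<delta> \<otimes>\<^bsub>deck\<^esub> \<epsilon>) x0) = reduce (label x0 (\<delta> x0) @ label x0 (\<epsilon> x0))"
proof -
  note d = deckD(2)[OF assms(1) x0] deckD(3)[OF assms(1) x0]
  note e = deckD(2)[OF assms(2) x0] deckD(3)[OF assms(2) x0]
  have wd: "walk G v0 (label x0 (\<delta> x0)) v0" using walk_label[OF x0 d(1)] d by simp
  have we: "walk G v0 (label x0 (\<epsilon> x0)) v0" using walk_label[OF x0 e(1)] e by simp
  have "(\<delta> \<otimes>\<^bsub>deck\<^esub> \<epsilon>) x0 = \<delta> (lift_end x0 (label x0 (\<epsilon> x0)))"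
    using deck_mult[OF assms x0] lift_label[OF x0 e(1)] by simp
  also have "\<dots> = lift_end (\<delta> x0) (label x0 (\<epsilon> x0))" by (rule deck_lift_end[OF assms(1) x0 we])
  also have "\<dots> = lift_end x0 (label x0 (\<delta> x0) @ label x0 (\<epsilon> x0))"
    using lift_label[OF x0 d(1)] by simp
  finally show ?thesis
    using label_lift_end_reduce[OF x0, of "label x0 (\<delta> x0) @ label x0 (\<epsilon> x0)" v0] wd we
    by (auto simp: G.walk_append)
qed

lemma net_passages_mult:
  "\<delta> \<in> carrier deck \<Longrightarrow> \<epsilon> \<in> carrier deck \<Longrightarrow>
     net_passages c (\<delta> \<otimes>\<^bsub>deck\<^esub> \<epsilon>) = net_passages c \<delta> + net_passages c \<epsilon>"
  by (simp add: net_passages_def label_deck_mult)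

lemma net_passages_one: "net_passages c \<one>\<^bsub>deck\<^esub> = 0"
  using net_passages_mult[OF D.one_closed D.one_closed] by simp

lemma net_passages_inv:
  "\<delta> \<in> carrier deck \<Longrightarrow> net_passages c (inv\<^bsub>deck\<^esub> \<delta>) = - net_passages c \<delta>"
  using net_passages_mult[of \<delta> "inv\<^bsub>deck\<^esub> \<delta>" c] net_passages_one by simp

lemma net_count_rev_path: "net_count c (rev_path q) = - net_count c q"
proof (induction q)
  case (Cons a q)
  have "net_count c [prod.swap a] = - net_count c [a]"
    using swap_eq_iff[of a c] swap_eq_iff[of a "prod.swap c"] by (auto simp: net_count_def)
  with Cons show ?case by (simp add: net_count_Cons[of c a q])
qed (simp add: net_count_def)

lemma net_count_word_walk:
  assumes "v \<in> pverts G" "u \<in> pverts G" "fst ` set w \<subseteq> {..<b}" "c \<notin> parcs B"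
  shows "net_count c (word_walk v w u) = net_count c (map letter_arc w)"
  using net_count_filter[of "\<lambda>a. a \<notin> parcs B" c "word_walk v w u"] filter_word_walk[OF assms(1-3)]
    assms(4) B.swap_arc by simp

text \<open>The closed walk of a generator meets only one edge outside the spanning tree, so it is a
  power of the simple loop through that edge. Since the generators generate, and the net number of
  passages through that edge is a homomorphism that vanishes on all other generators, this power is 1 or -1;
  it is 1 because the edge is passed in its chosen orientation.\<close>

lemma closed_walk_generator:
  assumes i: "i < b"
  shows "label (\<gamma> i x0) x0 = word_walk v0 [(i, False)] v0"
proof -
  note d = deckD(2)[OF gen_deck[OF i] x0] deckD(3)[OF gen_deck[OF i] x0]
  have ci: "e i \<notin> parcs B" using letter_arc(2)[of "(i, False)"] i by (simp add: letter_arc_def)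
  have "walk G v0 (label (\<gamma> i x0) x0) v0" using walk_label[OF d(1) x0] d(2) by simp
  then obtain w where w: "reduced_word b w" and lw: "label (\<gamma> i x0) x0 = word_walk v0 w v0"
    using word_walk_exists nb_label[OF d(1) x0] by blast
  have wb: "fst ` set w \<subseteq> {..<b}" using w by (simp add: reduced_word_def)
  \<comment> \<open>The walk meets no edge outside the tree except \<open>e i\<close>, so all its letters have index \<open>i\<close>.\<close>
  have filt: "map letter_arc w = filter (\<lambda>a. a \<notin> parcs B) (label (\<gamma> i x0) x0)"
    using filter_word_walk[OF v0 v0 wb] lw by simp
  have mem: "letter_arc l \<in> set (label (\<gamma> i x0) x0)" if "l \<in> set w" for l
  proof -
    have "letter_arc l \<in> set (map letter_arc w)" using that by simp
    then show ?thesis unfolding filt by simp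
  qed
  have gi: "e i \<in> set (label (\<gamma> i x0) x0)"
    and gj: "\<And>i j. i < b \<Longrightarrow> j < b \<Longrightarrow> j \<noteq> i \<Longrightarrow> e j \<notin> set (label (\<gamma> i x0) x0)"
      "\<And>i j. i < b \<Longrightarrow> j < b \<Longrightarrow> j \<noteq> i \<Longrightarrow> prod.swap (e j) \<notin> set (label (\<gamma> i x0) x0)"
    using generators i by (auto simp: cotree_generators_def closed_walk_eq_label)
  have idx: "fst l = i" if "l \<in> set w" for l
  proof (rule ccontr)
    assume "fst l \<noteq> i"
    moreover have "fst l < b" using reduced_wordD[OF w that] .
    ultimately show False using mem[OF that] gj[OF i, of "fst l"] by (auto simp: letter_arc_def split: if_splits)
  qed
  have "e i \<in> set (map letter_arc w)" using filt gi ci by simp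
  then obtain l where l: "l \<in> set w" "letter_arc l = letter_arc (i, False)"
    by (auto simp: letter_arc_def)
  then have "l = (i, False)" using letter_arc_inj[of l "(i, False)"] reduced_wordD[OF w] i by simp
  then have rep: "w = replicate (length w) (i, False)"
    using reduced_word_single_index[OF w idx] l by blast
  \<comment> \<open>The generator is the \<open>n\<close>-th power of the simple loop through \<open>e i\<close>.\<close>
  define n where "n = length w"
  have single: "net_count (e i) [e i] = 1"
  proof -
    have "letter_arc (i, False) \<noteq> letter_arc (i, True)"
      using letter_arc_inj[of "(i, False)" "(i, True)"] i by auto
    then have "prod.swap (e i) \<noteq> e i" by (simp add: letter_arc_def)
    then show ?thesis by (auto simp: net_count_def)
  qed
  have "net_count (e i) (replicate m (e i)) = int m" for m
  proof (induction m)
    case (Suc m)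
    then show ?case using single net_count_Cons[of "e i" "e i" "replicate m (e i)"] by simp
  qed (simp add: net_count_def)
  moreover have "map letter_arc w = replicate n (e i)"
    using arg_cong[OF rep, of "map letter_arc"] by (simp add: n_def letter_arc_def)
  ultimately have "net_count (e i) (label (\<gamma> i x0) x0) = int n"
    using net_count_word_walk[OF v0 v0 wb ci] lw by simp
  then have gen_i: "net_passages (e i) (\<gamma> i) = - int n"
    using rev_label[OF d(1) x0] net_count_rev_path by (metis net_passages_def)
  have gen_j: "net_passages (e i) (\<gamma> j) = 0" if j: "j < b" "j \<noteq> i" for j
  proof -
    have "net_count (e i) (label (\<gamma> j x0) x0) = 0"
      using gj[OF j(1) i] j by (intro net_count_eq_0) auto
    then show ?thesis
      using rev_label[OF deckD(2)[OF gen_deck[OF j(1)] x0] x0] net_count_rev_path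
      by (metis net_passages_def neg_equal_0_iff_equal)
  qed
  have dvd: "int n dvd net_passages (e i) \<delta>" if "\<delta> \<in> generate deck (\<gamma> ` {..<b})" for \<delta>
    using that
  proof (induction rule: generate.induct)
    case one
    then show ?case by (simp add: net_passages_one)
  next
    case (incl h)
    then show ?case using gen_i gen_j by (metis dvd_0_right dvd_minus_iff dvd_refl imageE lessThan_iff)
  next
    case (inv h)
    then obtain j where j: "j < b" "h = \<gamma> j" by auto
    then show ?case
      using gen_i gen_j net_passages_inv[OF gen_deck[OF j(1)]]
      by (metis add.inverse_inverse dvd_0_right dvd_refl neg_equal_0_iff_equal)
  next
    case (eng h1 h2)
    have "generate deck (\<gamma> ` {..<b}) = carrier deck" using generators by (simp add: cotree_generators_def)
    then show ?case using eng net_passages_mult by auto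
  qed
  \<comment> \<open>The simple loop itself comes from some deck transformation, with one passage through \<open>e i\<close>.\<close>
  have wi: "walk G v0 (word_walk v0 [(i, False)] v0) v0" using i by (intro walk_word_walk v0) auto
  have nbi: "nonbacktracking (word_walk v0 [(i, False)] v0)"
    by (intro nb_word_walk v0) (use i in \<open>auto simp: reduced_word_Cons\<close>)
  let ?y = "lift_end x0 (word_walk v0 [(i, False)] v0)"
  obtain \<delta> where \<delta>: "\<delta> \<in> carrier deck" "\<delta> x0 = ?y"
    using deck_exists[OF x0 lift_end_vertex[OF x0 wi]] proj_lift_end[OF x0 wi] by auto
  have "net_passages (e i) \<delta> = 1"
    using \<delta> label_lift_end[OF x0 wi nbi] net_count_word_walk[OF v0 v0 _ ci, of "[(i, False)]"] i single
    by (simp add: net_passages_def letter_arc_def)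
  moreover have "\<delta> \<in> generate deck (\<gamma> ` {..<b})"
    using \<delta> generators by (simp add: cotree_generators_def)
  ultimately have "int n dvd 1" using dvd by metis
  then have "n = 1" by simp
  then have "w = [(i, False)]" using rep by (simp add: n_def)
  then show ?thesis using lw by simp
qed

lemma generator_end:
  assumes "i < b" shows "\<gamma> i x0 = lift_end x0 (word_walk v0 [(i, True)] v0)"
proof -
  have "label x0 (\<gamma> i x0) = word_walk v0 [(i, True)] v0"
    using rev_label[OF deckD(2)[OF gen_deck[OF assms] x0] x0] closed_walk_generator[OF assms]
      rev_word_walk_single[of "(i, False)"] assms by simp
  then show ?thesis using lift_label[OF x0 deckD(2)[OF gen_deck[OF assms] x0]] by simp
qed

lemma \<alpha>_bij: "bij_betw \<alpha> (carrier F) (carrier deck)"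
  using iso by (simp add: iso_def)

lemma g: "i < b \<Longrightarrow> g i \<in> carrier F" "i < b \<Longrightarrow> \<alpha> (g i) = \<gamma> i"
  using gen_deck[of i] \<alpha>_bij g_def[of i] f_inv_into_f[of "\<gamma> i" \<alpha> "carrier F"]
    inv_into_into[of "\<gamma> i" \<alpha> "carrier F"] by (auto simp: bij_betw_def)

lemma letter_val: "fst l < b \<Longrightarrow> letter_val F g l \<in> carrier F"
  by (cases l) (auto simp: g)

lemma word_val_simps [simp]:
  "word_val F g [] = \<one>\<^bsub>F\<^esub>" "word_val F g (l # w) = letter_val F g l \<otimes>\<^bsub>F\<^esub> word_val F g w"
  by (simp_all add: word_val_def)

lemma word_val_closed: "fst ` set w \<subseteq> {..<b} \<Longrightarrow> word_val F g w \<in> carrier F"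
  by (induction w) (auto simp: letter_val simp del: letter_val.simps)

lemma word_val_append:
  "fst ` set w \<subseteq> {..<b} \<Longrightarrow> fst ` set w' \<subseteq> {..<b} \<Longrightarrow>
     word_val F g (w @ w') = word_val F g w \<otimes>\<^bsub>F\<^esub> word_val F g w'"
  by (induction w) (auto simp: letter_val word_val_closed F.m_assoc simp del: letter_val.simps)

lemma letter_end:
  assumes "fst l < b" shows "\<alpha> (letter_val F g l) x0 = lift_end x0 (word_walk v0 [l] v0)"
proof -
  obtain i s where l: "l = (i, s)" by (cases l)
  with assms have i: "i < b" by simp
  show ?thesis
  proof (cases s)
    case True
    then show ?thesis using l i g generator_end by simp
  next
    case False
    let ?d = "inv\<^bsub>deck\<^esub> (\<gamma> i)"
    have wi: "walk G v0 (word_walk v0 [(i, False)] v0) v0" using i by (intro walk_word_walk v0) auto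
    have d: "?d \<in> carrier deck" using gen_deck[OF i] by simp
    note gx = deckD(2)[OF gen_deck[OF i] x0]
    have "lift_end (\<gamma> i x0) (word_walk v0 [(i, False)] v0) = x0"
      using closed_walk_generator[OF i] lift_label[OF gx x0] by simp
    then have "\<gamma> i (lift_end x0 (word_walk v0 [(i, False)] v0)) = x0"
      using deck_lift_end[OF gen_deck[OF i] x0 wi] by simp
    moreover have "?d (\<gamma> i y) = y" if "y \<in> pverts \<T>" for y
      using deck_mult[OF d gen_deck[OF i] that] D.l_inv[OF gen_deck[OF i]] deck_one[OF that] by simp
    ultimately have "?d x0 = lift_end x0 (word_walk v0 [(i, False)] v0)"
      using lift_end_vertex[OF x0 wi] by metis
    then show ?thesis using l False g[OF i] by simp
  qed
qed

text \<open>Deck transformations commute with lifting, so a product of generators moves the base point along the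
  concatenated walks of its letters; detours inside the tree do not change the end of the lift.\<close>

lemma word_val_end:
  "fst ` set w \<subseteq> {..<b} \<Longrightarrow> \<alpha> (word_val F g w) x0 = lift_end x0 (word_walk v0 w v0)"
proof (induction w)
  case Nil
  then show ?case using deck_one[OF x0] v0 \<alpha>.hom_one by simp
next
  case (Cons l w)
  then have l: "fst l < b" and w: "fst ` set w \<subseteq> {..<b}" by auto
  let ?l = "letter_val F g l" and ?a = "letter_arc l"
  note hl = letter_val[OF l] and hw = word_val_closed[OF w]
  have al: "\<alpha> ?l \<in> carrier deck" "\<alpha> (word_val F g w) \<in> carrier deck" using hl hw by auto
  note a = letter_arc_verts[OF l]
  have "walk G v0 (B.tpath v0 (fst ?a) @ [?a]) (snd ?a)"
    using walk_tpath_B[OF v0 a(1)] letter_arc(1)[OF l] a by (auto simp: G.walk_append)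
  then have y: "lift_end x0 (B.tpath v0 (fst ?a) @ [?a]) \<in> pverts \<T>"
      "\<pi> (lift_end x0 (B.tpath v0 (fst ?a) @ [?a])) = snd ?a"
    using lift_end_vertex[OF x0] proj_lift_end[OF x0] by blast+
  have "\<alpha> (word_val F g (l # w)) x0 = \<alpha> ?l (\<alpha> (word_val F g w) x0)"
    using \<alpha>.hom_mult[OF hl hw] deck_mult[OF al x0] by simp
  also have "\<dots> = \<alpha> ?l (lift_end x0 (word_walk v0 w v0))" using Cons w by simp
  also have "\<dots> = lift_end (\<alpha> ?l x0) (word_walk v0 w v0)"
    using deck_lift_end[OF al(1) x0 walk_word_walk[OF v0 v0 w]] .
  also have "\<dots> = lift_end (lift_end x0 (B.tpath v0 (fst ?a) @ [?a]))
      (B.tpath (snd ?a) v0 @ word_walk v0 w v0)"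
    unfolding letter_end[OF l] by simp
  also have "\<dots> = lift_end (lift_end x0 (B.tpath v0 (fst ?a) @ [?a])) (word_walk (snd ?a) w v0)"
    using lift_tpath_word_walk[OF y(1) v0 v0 w] y(2) by simp
  finally show ?case by simp
qed

lemma label_word_val:
  assumes "reduced_word b w" shows "label x0 (\<alpha> (word_val F g w) x0) = word_walk v0 w v0"
proof -
  have w: "fst ` set w \<subseteq> {..<b}" using assms by (simp add: reduced_word_def)
  show ?thesis
    using word_val_end[OF w] label_lift_end[OF x0 walk_word_walk[OF v0 v0 w]] nb_word_walk[OF v0 v0 assms]
    by simp
qed

text \<open>The generators are free: a reduced word can be read off from the arcs of its walk outside the
  tree, and every non-backtracking closed walk is the walk of a reduced word.\<close>

lemma word_val_bij: "bij_betw (word_val F g) {w. reduced_word b w} (carrier F)"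
  unfolding bij_betw_def
proof (intro conjI inj_onI)
  fix w w' assume w: "w \<in> {w. reduced_word b w}" "w' \<in> {w. reduced_word b w}"
    and eq: "word_val F g w = word_val F g w'"
  have "word_walk v0 w v0 = word_walk v0 w' v0"
    using label_word_val[of w] label_word_val[of w'] w eq by simp
  moreover have wb: "fst ` set w \<subseteq> {..<b}" "fst ` set w' \<subseteq> {..<b}" using w by (simp_all add: reduced_word_def)
  ultimately have "map letter_arc w = map letter_arc w'"
    using filter_word_walk[OF v0 v0] by metis
  then show "w = w'" using map_letter_arc_inj wb by blast
next
  show "word_val F g ` {w. reduced_word b w} = carrier F"
  proof (intro subset_antisym subsetI)
    fix h assume "h \<in> word_val F g ` {w. reduced_word b w}"
    then show "h \<in> carrier F" using word_val_closed by (auto simp: reduced_word_def)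
  next
    fix h assume h: "h \<in> carrier F"
    then have ah: "\<alpha> h \<in> carrier deck" by simp
    note hx = deckD(2)[OF ah x0] deckD(3)[OF ah x0]
    obtain w where w: "reduced_word b w" "label x0 (\<alpha> h x0) = word_walk v0 w v0"
      using word_walk_exists[of v0 "label x0 (\<alpha> h x0)" v0] walk_label[OF x0 hx(1)] nb_label[OF x0 hx(1)] hx(2)
      by auto
    have wb: "fst ` set w \<subseteq> {..<b}" using w by (simp add: reduced_word_def)
    have "\<alpha> (word_val F g w) x0 = \<alpha> h x0"
      using word_val_end[OF wb] w(2) lift_label[OF x0 hx(1)] by simp
    then have "\<alpha> (word_val F g w) = \<alpha> h"
      using deck_eqI[OF _ ah x0] word_val_closed[OF wb] by simp
    then have "word_val F g w = h"
      using \<alpha>_bij h word_val_closed[OF wb] by (auto simp: bij_betw_def dest: inj_onD)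
    then show "h \<in> word_val F g ` {w. reduced_word b w}" using w by blast
  qed
qed

abbreviation word :: "'f \<Rightarrow> (nat \<times> bool) list" where
  "word \<equiv> word_of F g b"

lemma word_word_val: "reduced_word b w \<Longrightarrow> word (word_val F g w) = w"
  unfolding word_of_def using word_val_bij by (auto simp: bij_betw_def dest: inj_onD)

lemma
  assumes "h \<in> carrier F" shows word_reduced: "reduced_word b (word h)" and word_val_word: "word_val F g (word h) = h"
proof -
  have "h \<in> word_val F g ` {w. reduced_word b w}"
    using assms by (simp only: bij_betw_imp_surj_on[OF word_val_bij])
  then obtain w where "reduced_word b w" "word_val F g w = h" by auto
  then show "reduced_word b (word h)" "word_val F g (word h) = h" using word_word_val by auto
qed

lemma word_letters: "h \<in> carrier F \<Longrightarrow> fst ` set (word h) \<subseteq> {..<b}"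
  using word_reduced by (simp add: reduced_word_def)

lemma word_ne: "h \<in> carrier F \<Longrightarrow> word h \<noteq> [] \<longleftrightarrow> h \<noteq> \<one>\<^bsub>F\<^esub>"
  using word_val_word[of h] word_word_val[of "[]"] by auto

lemma label_\<alpha>: "h \<in> carrier F \<Longrightarrow> label x0 (\<alpha> h x0) = word_walk v0 (word h) v0"
  using label_word_val word_reduced word_val_word by metis

lemma final_edge_eq:
  assumes "h \<in> carrier F" "h \<noteq> \<one>\<^bsub>F\<^esub>"
  shows "final_edge F g b e h = prod.swap (letter_arc (last (word h)))"
  by (cases "last (word h)") (auto simp: final_edge_def letter_arc_def)

text \<open>The exponent in the formula for the measure of a cylinder is the length of the closed walk
  without its initial piece inside the spanning tree, that is, the length of the stem.\<close>

lemma length_closed_walk: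
  assumes "h \<in> carrier F" "h \<noteq> \<one>\<^bsub>F\<^esub>" "tree_realises_distances G B v0"
  defines "\<tau> \<equiv> final_edge F g b e h"
  shows "length (closed_walk \<T> \<pi> x0 (\<alpha> h)) =
    length (stem v0 (word h)) + gdist (remove_edge G \<tau>) v0 (fst \<tau>)"
proof -
  let ?w = "word h"
  have ne: "?w \<noteq> []" using word_ne assms by blast
  then have l: "fst (last ?w) < b" using word_letters[OF assms(1)] last_in_set by fastforce
  have \<tau>: "\<tau> = prod.swap (letter_arc (last ?w))" using final_edge_eq assms by blast
  have "\<tau> \<in> parcs G - parcs B" using letter_arc[OF l] \<tau> G.swap_arc B.swap_arc by simp
  then have "gdist (remove_edge G \<tau>) v0 (fst \<tau>) = gdist B v0 (fst \<tau>)"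
    using assms(3) by (simp add: tree_realises_distances_def)
  also have "\<dots> = length (B.tpath v0 (snd (letter_arc (last ?w))))"
    using \<tau> v0 letter_arc_verts[OF l] by (simp add: B.gdist_eq_length_tpath)
  also have "\<dots> = length (B.tpath (stem_end v0 ?w) v0)"
    using ne B.rev_tpath[of v0 "snd (letter_arc (last ?w))"] v0 letter_arc_verts[OF l]
    by (metis length_rev_path stem_end_def verts_B)
  finally have 1: "gdist (remove_edge G \<tau>) v0 (fst \<tau>) = length (B.tpath (stem_end v0 ?w) v0)" .
  have ax: "\<alpha> h x0 \<in> pverts \<T>" using deckD(2)[OF _ x0] assms(1) by simp
  have "length (closed_walk \<T> \<pi> x0 (\<alpha> h)) = length (label x0 (\<alpha> h x0))"
    using rev_label[OF x0 ax] length_rev_path by (metis closed_walk_eq_label)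
  then show ?thesis using label_\<alpha>[OF assms(1)] 1 by (simp add: word_walk_def)
qed

end


section \<open>Ends of the covering tree\<close>

context marked_cover
begin

abbreviation E :: "(nat \<Rightarrow> 'b) set" where
  "E \<equiv> ends \<T> x0"

lemma endsD:
  assumes "\<xi> \<in> E"
  shows "\<xi> 0 = x0" "(\<xi> n, \<xi> (Suc n)) \<in> parcs \<T>" "\<xi> (Suc (Suc n)) \<noteq> \<xi> n" "\<xi> n \<in> pverts \<T>"
  using assms T.in_arcsD1[of "\<xi> n" "\<xi> (Suc n)"] by (auto simp: ends_def)

text \<open>One more step either prolongs the geodesic from \<open>x\<close> or undoes its last arc.\<close>

lemma arc_label_cases:
  assumes x: "x \<in> pverts \<T>" and uv: "(u, v) \<in> parcs \<T>"
  shows "label x v = label x u @ [(\<pi> u, \<pi> v)] \<or> label x u = label x v @ [(\<pi> v, \<pi> u)]"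
proof -
  have u: "u \<in> pverts \<T>" using T.in_arcsD1[OF uv] .
  note lu = walk_label[OF x u] nb_label[OF x u] lift_label[OF x u]
  show ?thesis
  proof (cases "nonbacktracking (label x u @ [(\<pi> u, \<pi> v)])")
    case True
    then show ?thesis using label_arc[OF x uv] reduce_nonbacktracking by metis
  next
    case False
    define q c where "q = butlast (label x u)" and "c = last (label x u)"
    have "label x u \<noteq> []" "(\<pi> u, \<pi> v) = prod.swap c"
      using False lu(2) by (auto simp: nonbacktracking_append c_def)
    then have c: "c = (\<pi> v, \<pi> u)" and q: "label x u = q @ [c]"
      by (cases c, auto simp: c_def q_def)
    have wq: "walk G (\<pi> x) q (\<pi> v)" using lu(1) q c by (auto simp: G.walk_append)
    have "(\<pi> (lift_end x q), \<pi> u) \<in> parcs G" using proj_lift_end[OF x wq] lu(1) q c by (auto simp: G.walk_append)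
    then have "(lift_end x q, u) \<in> parcs \<T>"
      using lift_step(1)[OF lift_end_vertex[OF x wq]] lu(3) q c by fastforce
    then have "(u, lift_end x q) \<in> parcs \<T>" using T.swap_arc[of "(u, lift_end x q)"] by simp
    then have "v = lift_end x q" using local_inj[OF uv] proj_lift_end[OF x wq] by simp
    then show ?thesis
      using label_lift_end[OF x wq] lu(2) q c by (simp add: nonbacktracking_append)
  qed
qed

lemma label_end_Suc:
  assumes "\<xi> \<in> E"
  shows "label x0 (\<xi> (Suc n)) = label x0 (\<xi> n) @ [(\<pi> (\<xi> n), \<pi> (\<xi> (Suc n)))]"
proof (induction n)
  case 0
  then show ?case using arc_label_cases[OF x0 endsD(2)[OF assms, of 0]] endsD(1)[OF assms] x0
    by (auto simp: label_def)
next
  case (Suc n)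
  consider (a) "label x0 (\<xi> (Suc (Suc n))) = label x0 (\<xi> (Suc n)) @ [(\<pi> (\<xi> (Suc n)), \<pi> (\<xi> (Suc (Suc n))))]"
    | (b) "label x0 (\<xi> (Suc n)) = label x0 (\<xi> (Suc (Suc n))) @ [(\<pi> (\<xi> (Suc (Suc n))), \<pi> (\<xi> (Suc n)))]"
    using arc_label_cases[OF x0 endsD(2)[OF assms, of "Suc n"]] by blast
  then show ?case
  proof cases
    case b
    then have "label x0 (\<xi> (Suc (Suc n))) = label x0 (\<xi> n)" using Suc by simp
    then show ?thesis using lift_label[OF x0 endsD(4)[OF assms]] endsD(3)[OF assms] by metis
  qed
qed

lemma label_x0 [simp]: "label x0 x0 = []"
  using x0 by (simp add: label_def)

lemma length_label_end [simp]: "\<xi> \<in> E \<Longrightarrow> length (label x0 (\<xi> n)) = n"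
  by (induction n) (simp_all add: label_end_Suc endsD(1))

lemma prefix_label_end: "\<xi> \<in> E \<Longrightarrow> n \<le> m \<Longrightarrow> prefix (label x0 (\<xi> n)) (label x0 (\<xi> m))"
proof -
  assume \<xi>: "\<xi> \<in> E"
  assume "n \<le> m"
  then show ?thesis by (induction m rule: dec_induct) (auto simp: label_end_Suc[OF \<xi>])
qed

lemma end_eqI: "\<xi> \<in> E \<Longrightarrow> \<eta> \<in> E \<Longrightarrow> (\<And>n. label x0 (\<xi> n) = label x0 (\<eta> n)) \<Longrightarrow> \<xi> = \<eta>"
  by (rule ext) (metis lift_label x0 endsD(4))

definition shadow :: "('a \<times> 'a) list \<Rightarrow> (nat \<Rightarrow> 'b) set" where
  "shadow q = {\<xi> \<in> E. label x0 (\<xi> (length q)) = q}"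

lemma shadowD: "\<xi> \<in> shadow q \<Longrightarrow> \<xi> \<in> E"
  by (simp add: shadow_def)

lemma prefix_label_iff_shadow:
  assumes "\<xi> \<in> E" "length q \<le> n"
  shows "prefix q (label x0 (\<xi> n)) \<longleftrightarrow> \<xi> \<in> shadow q"
proof -
  have "label x0 (\<xi> (length q)) = take (length q) (label x0 (\<xi> n))"
    using prefix_label_end[OF assms] length_label_end[OF assms(1)] by (auto simp: prefix_def)
  then show ?thesis using assms(1) by (auto simp: shadow_def prefix_def) (metis append_take_drop_id)
qed

lemma shadow_iff: "\<xi> \<in> shadow q \<longleftrightarrow> \<xi> \<in> E \<and> (\<exists>n. prefix q (label x0 (\<xi> n)))"
proof
  assume "\<xi> \<in> E \<and> (\<exists>n. prefix q (label x0 (\<xi> n)))"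
  then obtain n where n: "\<xi> \<in> E" "prefix q (label x0 (\<xi> n))" by blast
  then have "length q \<le> n" using prefix_length_le by fastforce
  then show "\<xi> \<in> shadow q" using n prefix_label_iff_shadow by blast
qed (use prefix_label_iff_shadow shadowD in blast)

lemma shadow_antimono: "prefix q' q \<Longrightarrow> shadow q \<subseteq> shadow q'"
  using prefix_order.trans by (fastforce simp: shadow_iff)

lemma shadow_compatible: "\<xi> \<in> shadow q \<Longrightarrow> \<xi> \<in> shadow q' \<Longrightarrow> prefix q q' \<or> prefix q' q"
proof -
  assume a: "\<xi> \<in> shadow q" "\<xi> \<in> shadow q'"
  define n where "n = max (length q) (length q')"
  have "prefix q (label x0 (\<xi> n))" "prefix q' (label x0 (\<xi> n))"
    using a prefix_label_iff_shadow[of \<xi> _ n] shadowD by (auto simp: n_def)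
  then show ?thesis by (rule prefix_same_cases)
qed

lemma label_in_shadow: "\<xi> \<in> E \<Longrightarrow> \<xi> \<in> shadow (label x0 (\<xi> n))"
  by (auto simp: shadow_iff)

text \<open>Two walks of the chain that are long enough agree in their first \<open>k\<close> arcs, so these arcs lead to
  the \<open>k\<close>-th vertex of a ray.\<close>

lemma end_of_chain:
  assumes w: "\<And>n. \<exists>v. walk G v0 (s n) v" and nb: "\<And>n. nonbacktracking (s n)"
    and pre: "\<And>n. prefix (s n) (s (Suc n))" and len: "\<And>n. n \<le> length (s n)"
  shows "\<exists>\<eta>\<in>E. \<forall>n. \<eta> \<in> shadow (s n)"
proof -
  have chain: "prefix (s n) (s m)" if "n \<le> m" for n m
    using that by (induction m rule: dec_induct) (use pre prefix_order.trans in blast)+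
  define t where "t k = take k (s k)" for k
  have t: "t k = take k (s m)" if "k \<le> m" for k m
    using chain[OF that] len[of k] by (auto simp: t_def prefix_def)
  have lt: "length (t k) = k" for k using len[of k] by (simp add: t_def)
  have tw: "\<exists>v. walk G v0 (t k) v" for k
  proof -
    obtain v where "walk G v0 (take k (s k) @ drop k (s k)) v" using w[of k] by auto
    then show ?thesis unfolding t_def G.walk_append by blast
  qed
  have tn: "nonbacktracking (t k)" for k
    using nb[of k] nonbacktracking_append[of "take k (s k)" "drop k (s k)"] by (simp add: t_def)
  define \<eta> where "\<eta> k = lift_end x0 (t k)" for k
  have lab: "label x0 (\<eta> k) = t k" for k
    using tw[of k] tn[of k] label_lift_end[OF x0] by (auto simp: \<eta>_def)
  have arc: "(\<eta> k, \<eta> (Suc k)) \<in> parcs \<T>" for k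
  proof -
    have "t (Suc k) = t k @ [s (Suc k) ! k]"
      using t[of k "Suc k"] len[of "Suc k"] by (simp add: t_def take_Suc_conv_app_nth)
    then obtain a where a: "t (Suc k) = t k @ [a]" by blast
    obtain v v' where v: "walk G v0 (t k) v'" "walk G v' [a] v"
      using tw[of "Suc k"] unfolding a G.walk_append by blast
    have "(\<pi> (\<eta> k), snd a) \<in> parcs G"
      using v proj_lift_end[OF x0 v(1)] by (cases a) (auto simp: \<eta>_def)
    then show ?thesis
      using lift_step(1)[OF lift_end_vertex[OF x0 v(1)]] a by (simp add: \<eta>_def)
  qed
  have "\<eta> 0 = x0" by (simp add: \<eta>_def t_def)
  moreover have "\<eta> (Suc (Suc n)) \<noteq> \<eta> n" for n
    using lab[of n] lab[of "Suc (Suc n)"] lt[of n] lt[of "Suc (Suc n)"] by (metis n_not_Suc_n Suc_n_not_le_n le_SucI order_refl)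
  ultimately have \<eta>: "\<eta> \<in> E" using arc by (simp add: ends_def)
  have "\<eta> \<in> shadow (s n)" for n
  proof -
    have "label x0 (\<eta> (length (s n))) = s n"
      using t[of "length (s n)" "max n (length (s n))"] chain[of n "max n (length (s n))"] len
      unfolding lab t_def[symmetric] by (auto simp: prefix_def)
    then show ?thesis using \<eta> by (simp add: shadow_def)
  qed
  then show ?thesis using \<eta> by blast
qed

section \<open>Half-trees and the topology of the compactification\<close>

text \<open>The head of an arc is nearer to \<open>z\<close> than its tail exactly if the geodesic from the tail to \<open>z\<close>
  starts with the arc. If the arc points away from the base point, this geodesic continues the one
  from the base point to the tail.\<close>

lemma gdist_less_iff_prefix:
  assumes uv: "(u, v) \<in> parcs \<T>" and out: "label x0 v = label x0 u @ [(\<pi> u, \<pi> v)]"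
    and z: "z \<in> pverts \<T>"
  shows "gdist \<T> z v < gdist \<T> z u \<longleftrightarrow> prefix (label x0 v) (label x0 z)"
    and "gdist \<T> z u < gdist \<T> z v \<longleftrightarrow> \<not> prefix (label x0 v) (label x0 z)"
proof -
  let ?a = "(\<pi> u, \<pi> v)"
  have u: "u \<in> pverts \<T>" and v: "v \<in> pverts \<T>" using T.in_arcsD1[OF uv] T.in_arcsD2[OF uv] by auto
  have dist: "gdist \<T> z y = length (label z y)" if "y \<in> pverts \<T>" for y
    using gdist_eq_length_label[OF z that] .
  have rev: "label z u = label z v @ [(\<pi> v, \<pi> u)] \<longleftrightarrow> label u z = ?a # label v z"
  proof -
    have "label z u = label z v @ [(\<pi> v, \<pi> u)] \<longleftrightarrow> rev_path (label z u) = rev_path (label z v @ [(\<pi> v, \<pi> u)])"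
      by (simp only: rev_path_eq)
    then show ?thesis using rev_label[OF z u] rev_label[OF z v] by simp
  qed
  have key: "label u z = ?a # label v z \<longleftrightarrow> prefix (label x0 v) (label x0 z)"
  proof
    assume eq: "label u z = ?a # label v z"
    have "walk G v0 (label x0 u @ label u z) (\<pi> z)"
      using walk_label[OF x0 u] walk_label[OF u z] by (auto simp: G.walk_append)
    moreover have "nonbacktracking (label x0 u @ label u z)"
      using nb_label[OF x0 v] nb_label[OF u z] unfolding out eq by (auto simp: nonbacktracking_append)
    moreover have "lift_end x0 (label x0 u @ label u z) = z"
      using lift_label[OF x0 u] lift_label[OF u z] by simp
    ultimately have "label x0 z = label x0 u @ label u z" using label_lift_end[OF x0] by metis
    then show "prefix (label x0 v) (label x0 z)" by (simp add: out eq)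
  next
    assume "prefix (label x0 v) (label x0 z)"
    then obtain r where r: "label x0 z = label x0 v @ r" by (auto simp: prefix_def)
    have wr: "walk G (\<pi> v) r (\<pi> z)"
      using walk_label[OF x0 z] walk_label[OF x0 v] G.walk_end_unique unfolding r G.walk_append by blast
    have nb: "nonbacktracking (label x0 u @ ?a # r)" using nb_label[OF x0 z] r out by simp
    have "lift_end v r = z" using lift_label[OF x0 z] lift_label[OF x0 v] r by simp
    moreover from this have "label v z = r"
      using label_lift_end[OF v wr] nb by (simp add: nonbacktracking_append nonbacktracking_Cons)
    moreover have "label u (lift_end u (?a # r)) = ?a # r"
      using label_lift_end[OF u, of "?a # r" "\<pi> z"] wr nb proj_arc[OF uv] by (simp add: nonbacktracking_append)
    ultimately show "label u z = ?a # label v z" using lift_step_eq[OF uv] by simp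
  qed
  consider (a) "label z v = label z u @ [(\<pi> u, \<pi> v)]" | (b) "label z u = label z v @ [(\<pi> v, \<pi> u)]"
    using arc_label_cases[OF z uv] by blast
  then show "gdist \<T> z v < gdist \<T> z u \<longleftrightarrow> prefix (label x0 v) (label x0 z)"
    "gdist \<T> z u < gdist \<T> z v \<longleftrightarrow> \<not> prefix (label x0 v) (label x0 z)"
    unfolding key[symmetric] rev[symmetric] dist[OF u] dist[OF v] by (cases; simp)+
qed

text \<open>The half-tree beyond the lift of a walk, in terms of labels. For the empty walk it is the whole
  compactification.\<close>

definition cone :: "('a \<times> 'a) list \<Rightarrow> ('b + (nat \<Rightarrow> 'b)) set" where
  "cone q = Inl ` {z \<in> pverts \<T>. prefix q (label x0 z)} \<union> Inr ` shadow q"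

abbreviation total :: "('b + (nat \<Rightarrow> 'b)) set" where
  "total \<equiv> Inl ` pverts \<T> \<union> Inr ` E"

lemma cone_Nil [simp]: "cone [] = total"
  by (auto simp: cone_def shadow_iff)

lemma cone_total: "cone q \<subseteq> total"
  by (auto simp: cone_def shadow_def)

text \<open>Half-trees beyond arcs that point towards the base point are complements of cones, so cones are
  both open and closed.\<close>

lemma half_tree_cone:
  assumes uv: "(u, v) \<in> parcs \<T>" and out: "label x0 v = label x0 u @ [(\<pi> u, \<pi> v)]"
  shows "half_tree \<T> x0 (u, v) = cone (label x0 v)"
    and "half_tree \<T> x0 (v, u) = total - cone (label x0 v)"
proof -
  note less = gdist_less_iff_prefix[OF uv out]
  have ev: "\<forall>\<^sub>F n in sequentially. prefix (label x0 v) (label x0 (\<xi> n)) \<longleftrightarrow> \<xi> \<in> shadow (label x0 v)"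
    if "\<xi> \<in> E" for \<xi>
    using prefix_label_iff_shadow[OF that] by (auto simp: eventually_sequentially)
  have 1: "(\<forall>\<^sub>F n in sequentially. gdist \<T> (\<xi> n) v < gdist \<T> (\<xi> n) u) \<longleftrightarrow> \<xi> \<in> shadow (label x0 v)"
    if "\<xi> \<in> E" for \<xi>
  proof -
    have "(\<forall>\<^sub>F n in sequentially. gdist \<T> (\<xi> n) v < gdist \<T> (\<xi> n) u) \<longleftrightarrow>
        (\<forall>\<^sub>F n in sequentially. \<xi> \<in> shadow (label x0 v))"
      unfolding less(1)[OF endsD(4)[OF that]] by (rule eventually_cong[OF ev[OF that]]) simp
    then show ?thesis by simp
  qed
  have 2: "(\<forall>\<^sub>F n in sequentially. gdist \<T> (\<xi> n) u < gdist \<T> (\<xi> n) v) \<longleftrightarrow> \<xi> \<notin> shadow (label x0 v)"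
    if "\<xi> \<in> E" for \<xi>
  proof -
    have "(\<forall>\<^sub>F n in sequentially. gdist \<T> (\<xi> n) u < gdist \<T> (\<xi> n) v) \<longleftrightarrow>
        (\<forall>\<^sub>F n in sequentially. \<xi> \<notin> shadow (label x0 v))"
      unfolding less(2)[OF endsD(4)[OF that]] by (rule eventually_cong[OF ev[OF that]]) simp
    then show ?thesis by simp
  qed
  show "half_tree \<T> x0 (u, v) = cone (label x0 v)"
    unfolding half_tree_def cone_def using less(1) 1 shadowD by (auto simp: image_iff)
  show "half_tree \<T> x0 (v, u) = total - cone (label x0 v)"
    unfolding half_tree_def cone_def using less(2) 2 shadowD by (auto simp: image_iff)
qed

lemma cone_is_half_tree:
  assumes "walk G v0 q v" "nonbacktracking q" "q \<noteq> []"
  shows "\<exists>u y. (u, y) \<in> parcs \<T> \<and> label x0 y = q \<and> label x0 u = butlast q \<and>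
    q = butlast q @ [(\<pi> u, \<pi> y)]"
proof -
  define r a where "r = butlast q" and "a = last q"
  have q: "q = r @ [a]" using assms(3) by (simp add: r_def a_def)
  obtain v' where w: "walk G v0 r v'" "walk G v' [a] v" using assms(1) unfolding q G.walk_append by blast
  let ?u = "lift_end x0 r"
  have a: "a = (\<pi> ?u, snd a)" using w proj_lift_end[OF x0 w(1)] by (cases a) auto
  have "a \<in> parcs G" using w(2) by simp
  then have au: "(\<pi> ?u, snd a) \<in> parcs G" using a by metis
  note y = lift_step[OF lift_end_vertex[OF x0 w(1)] au]
  have "label x0 ?u = r" using label_lift_end[OF x0 w(1)] assms(2) q by (simp add: nonbacktracking_append)
  moreover have "label x0 (lift_step ?u (snd a)) = q"
    using label_lift_end[OF x0 assms(1,2)] q by simp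
  ultimately show ?thesis using y a q by (intro exI[of _ ?u] exI[of _ "lift_step ?u (snd a)"]) simp
qed

abbreviation compactification :: "('b + (nat \<Rightarrow> 'b)) topology" where
  "compactification \<equiv> end_compactification \<T> x0"

lemma half_tree_cases:
  assumes "a \<in> parcs \<T>"
  shows "\<exists>u v. (u, v) \<in> parcs \<T> \<and> label x0 v = label x0 u @ [(\<pi> u, \<pi> v)] \<and>
     half_tree \<T> x0 a \<in> {cone (label x0 v), total - cone (label x0 v)}"
proof -
  obtain u v where a: "a = (u, v)" by (cases a)
  have vu: "(v, u) \<in> parcs \<T>" using assms T.swap_arc[of "(v, u)"] a by simp
  note uv = assms[unfolded a]
  from arc_label_cases[OF x0 uv] show ?thesis
  proof
    assume out: "label x0 v = label x0 u @ [(\<pi> u, \<pi> v)]"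
    show ?thesis using uv out half_tree_cone(1)[OF uv out] by (intro exI[of _ u] exI[of _ v]) (simp add: a)
  next
    assume out: "label x0 u = label x0 v @ [(\<pi> v, \<pi> u)]"
    show ?thesis using vu out half_tree_cone(2)[OF vu out] by (intro exI[of _ v] exI[of _ u]) (simp add: a)
  qed
qed

lemma open_cone:
  assumes "walk G v0 q v" "nonbacktracking q"
  shows "q \<noteq> [] \<Longrightarrow> openin compactification (cone q)"
    and "q \<noteq> [] \<Longrightarrow> openin compactification (total - cone q)"
    and "q \<noteq> [] \<Longrightarrow> topspace compactification = total"
proof -
  assume ne: "q \<noteq> []"
  obtain u y where uy: "(u, y) \<in> parcs \<T>" "label x0 y = q" "label x0 u = butlast q"
      "q = butlast q @ [(\<pi> u, \<pi> y)]"
    using cone_is_half_tree[OF assms ne] by blast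
  have yu: "(y, u) \<in> parcs \<T>" using uy(1) T.swap_arc[of "(y, u)"] by simp
  have out: "label x0 y = label x0 u @ [(\<pi> u, \<pi> y)]" using uy by simp
  note h = half_tree_cone[OF uy(1) out]
  show 1: "openin compactification (cone q)"
    unfolding end_compactification_def
    using h(1) uy by (intro topology_generated_by_Basis) (metis image_eqI)
  show 2: "openin compactification (total - cone q)"
    unfolding end_compactification_def
    using h(2) uy yu by (intro topology_generated_by_Basis) (metis image_eqI)
  have "half_tree \<T> x0 a \<subseteq> total" if "a \<in> parcs \<T>" for a
    using half_tree_cases[OF that] cone_total by blast
  then have "topspace compactification \<subseteq> total"
    by (auto simp: end_compactification_def topology_generated_by_topspace)
  moreover have "total \<subseteq> topspace compactification"
    using openin_subset[OF 1] openin_subset[OF 2] by blast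
  ultimately show "topspace compactification = total" by (rule subset_antisym)
qed

lemma walk_label_x0: "y \<in> pverts \<T> \<Longrightarrow> walk G v0 (label x0 y) (\<pi> y)"
  using walk_label[OF x0] .

text \<open>Convergence can be tested on half-trees, and whether a half-tree contains an end is decided by a
  finite piece of its ray.\<close>

lemma limitin_end_iff:
  assumes y: "\<And>n. y n \<in> pverts \<T>" and \<eta>: "\<eta> \<in> E"
  shows "limitin compactification (\<lambda>n. Inl (y n)) (Inr \<eta>) sequentially \<longleftrightarrow>
    (\<forall>k. \<forall>\<^sub>F n in sequentially. prefix (label x0 (\<eta> k)) (label x0 (y n)))"
proof
  assume lim: "limitin compactification (\<lambda>n. Inl (y n)) (Inr \<eta>) sequentially"
  show "\<forall>k. \<forall>\<^sub>F n in sequentially. prefix (label x0 (\<eta> k)) (label x0 (y n))"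
  proof
    fix k
    show "\<forall>\<^sub>F n in sequentially. prefix (label x0 (\<eta> k)) (label x0 (y n))"
    proof (cases "label x0 (\<eta> k) = []")
      case False
      have "openin compactification (cone (label x0 (\<eta> k)))"
        using open_cone(1)[OF walk_label_x0[OF endsD(4)[OF \<eta>]] nb_label[OF x0 endsD(4)[OF \<eta>]] False] .
      moreover have "Inr \<eta> \<in> cone (label x0 (\<eta> k))" using label_in_shadow[OF \<eta>] by (simp add: cone_def)
      ultimately have "\<forall>\<^sub>F n in sequentially. Inl (y n) \<in> cone (label x0 (\<eta> k))"
        using lim by (auto simp: limitin_def)
      then show ?thesis by (rule eventually_mono) (auto simp: cone_def)
    qed simp
  qed
next
  assume pre: "\<forall>k. \<forall>\<^sub>F n in sequentially. prefix (label x0 (\<eta> k)) (label x0 (y n))"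
  have basis: "\<forall>\<^sub>F n in sequentially. Inl (y n) \<in> half_tree \<T> x0 a"
    if a: "a \<in> parcs \<T>" and mem: "Inr \<eta> \<in> half_tree \<T> x0 a" for a
  proof -
    obtain u v where uv: "(u, v) \<in> parcs \<T>"
      and h: "half_tree \<T> x0 a = cone (label x0 v) \<or> half_tree \<T> x0 a = total - cone (label x0 v)"
      using half_tree_cases[OF a] by blast
    have "\<forall>\<^sub>F n in sequentially. prefix (label x0 (\<eta> (length (label x0 v)))) (label x0 (y n))"
      using pre by blast
    then have "\<forall>\<^sub>F n in sequentially. Inl (y n) \<in> cone (label x0 v) \<longleftrightarrow> Inr \<eta> \<in> cone (label x0 v)"
    proof (rule eventually_mono)
      fix n assume p: "prefix (label x0 (\<eta> (length (label x0 v)))) (label x0 (y n))"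
      have "prefix (label x0 v) (label x0 (y n)) \<longleftrightarrow> label x0 (\<eta> (length (label x0 v))) = label x0 v"
        using p length_label_end[OF \<eta>, of "length (label x0 v)"]
          prefix_length_prefix[of "label x0 v" "label x0 (y n)" "label x0 (\<eta> (length (label x0 v)))"]
        by (auto simp: prefix_def)
      then show "Inl (y n) \<in> cone (label x0 v) \<longleftrightarrow> Inr \<eta> \<in> cone (label x0 v)"
        using y \<eta> by (auto simp: cone_def shadow_def)
    qed
    then show ?thesis
      using h mem y by (elim eventually_mono) (auto simp: image_iff)
  qed
  have "\<forall>\<^sub>F n in sequentially. Inl (y n) \<in> U"
    if U: "generate_topology_on (half_tree \<T> x0 ` parcs \<T>) U" and "Inr \<eta> \<in> U" for U
    using that
  proof (induction rule: generate_topology_on.induct)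
    case (Int U V)
    then show ?case using eventually_conj by fastforce
  next
    case (UN K)
    then obtain V where V: "V \<in> K" "Inr \<eta> \<in> V" by blast
    then have "\<forall>\<^sub>F n in sequentially. Inl (y n) \<in> V" using UN.IH by blast
    then show ?case by (rule eventually_mono) (use V in blast)
  qed (use basis in auto)
  moreover have "Inr \<eta> \<in> topspace compactification"
  proof -
    have "label x0 (\<eta> 1) \<noteq> []" using length_label_end[OF \<eta>, of 1] by auto
    then show ?thesis
      using open_cone(3)[OF walk_label_x0[OF endsD(4)[OF \<eta>]] nb_label[OF x0 endsD(4)[OF \<eta>]]] \<eta> by blast
  qed
  ultimately show "limitin compactification (\<lambda>n. Inl (y n)) (Inr \<eta>) sequentially"
    by (auto simp: limitin_def end_compactification_def openin_topology_generated_by_iff)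
qed

end


section \<open>The boundary of the Cayley graph\<close>

context marked_cover
begin

lemma filter_stem:
  assumes "v \<in> pverts G" "fst ` set w \<subseteq> {..<b}"
  shows "filter (\<lambda>a. a \<notin> parcs B) (stem v w) = map letter_arc w"
  using filter_word_walk[OF assms(1) stem_end_vert[OF assms] assms(2)] assms stem_end_vert[OF assms]
  by (simp add: word_walk_def)

text \<open>An end leaves the spanning tree again and again, because the tree is finite and the ray
  cannot return to a vertex within it.\<close>

lemma end_meets_cotree:
  assumes "\<xi> \<in> E"
  shows "\<exists>n. k \<le> length (filter (\<lambda>a. a \<notin> parcs B) (label x0 (\<xi> n)))"
proof (induction k)
  case (Suc k)
  then obtain n where n: "k \<le> length (filter (\<lambda>a. a \<notin> parcs B) (label x0 (\<xi> n)))" by blast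
  show ?case
  proof (rule ccontr)
    \<comment> \<open>Otherwise the ray stays in the tree from its \<open>n\<close>-th vertex on and passes through infinitely
      many different vertices.\<close>
    assume no: "\<nexists>n. Suc k \<le> length (filter (\<lambda>a. a \<notin> parcs B) (label x0 (\<xi> n)))"
    have step: "\<exists>r. label x0 (\<xi> (n + m)) = label x0 (\<xi> n) @ r \<and> length r = m \<and>
        r = B.tpath (\<pi> (\<xi> n)) (\<pi> (\<xi> (n + m)))" for m
    proof -
      obtain r where r: "label x0 (\<xi> (n + m)) = label x0 (\<xi> n) @ r"
        using prefix_label_end[OF assms, of n "n + m"] by (auto simp: prefix_def)
      have lr: "length r = m"
        using arg_cong[OF r, of length] length_label_end[OF assms] by simp
      have "\<not> Suc k \<le> length (filter (\<lambda>a. a \<notin> parcs B) (label x0 (\<xi> n) @ r))"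
        using no unfolding r[symmetric] by blast
      then have "length (filter (\<lambda>a. a \<notin> parcs B) r) = 0" using n by (simp del: length_0_conv)
      then have "filter (\<lambda>a. a \<notin> parcs B) r = []" by simp
      then have "set r \<subseteq> parcs B" by (auto simp: filter_empty_conv)
      moreover have "walk G (\<pi> (\<xi> n)) r (\<pi> (\<xi> (n + m)))"
        using walk_label_x0[OF endsD(4)[OF assms, of "n + m"]] walk_label_x0[OF endsD(4)[OF assms, of n]]
          G.walk_end_unique unfolding r G.walk_append by blast
      moreover have "nonbacktracking r"
        using nb_label[OF x0 endsD(4)[OF assms, of "n + m"]] r by (simp add: nonbacktracking_append)
      ultimately have "B.tpath (\<pi> (\<xi> n)) (\<pi> (\<xi> (n + m))) = r" by (metis B.tpath_eqI walk_in_B)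
      then show ?thesis using r lr by blast
    qed
    have "inj (\<lambda>m. \<pi> (\<xi> (n + m)))"
      using step by (metis (no_types, lifting) injI)
    moreover have "range (\<lambda>m. \<pi> (\<xi> (n + m))) \<subseteq> pverts G"
      using endsD(4)[OF assms] proj_vertex by blast
    ultimately show False
      using G.pair_finite_verts finite_subset range_inj_infinite by metis
  qed
qed simp

text \<open>The word consists of the first \<open>n\<close> arcs of the ray outside the spanning tree.\<close>

lemma end_word_exists:
  assumes "\<xi> \<in> E"
  shows "\<exists>w. reduced_word b w \<and> length w = n \<and> \<xi> \<in> shadow (stem v0 w)"
proof -
  obtain m where m: "n \<le> length (filter (\<lambda>a. a \<notin> parcs B) (label x0 (\<xi> m)))"
    using end_meets_cotree[OF assms] by blast
  obtain w where w: "reduced_word b w" "label x0 (\<xi> m) = word_walk v0 w (\<pi> (\<xi> m))"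
    using word_walk_exists[OF walk_label_x0[OF endsD(4)[OF assms]] nb_label[OF x0 endsD(4)[OF assms]]] by blast
  have wb: "fst ` set w \<subseteq> {..<b}" using w by (simp add: reduced_word_def)
  have "n \<le> length w"
    using m filter_word_walk[OF v0 proj_vertex[OF endsD(4)[OF assms]] wb] w(2) by simp
  moreover have "reduced_word b (take n w)"
    using w(1) reduced_word_append[of b "take n w" "drop n w"] by simp
  moreover have "prefix (stem v0 (take n w)) (label x0 (\<xi> m))"
  proof -
    have "stem v0 w = stem v0 (take n w) @ stem (stem_end v0 (take n w)) (drop n w)"
      using stem_append[of v0 "take n w" "drop n w"] by simp
    then show ?thesis unfolding w(2) word_walk_def by simp
  qed
  then have "\<xi> \<in> shadow (stem v0 (take n w))" using assms by (auto simp: shadow_iff)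
  ultimately show ?thesis by (intro exI[of _ "take n w"]) simp
qed

lemma end_word_unique:
  assumes "\<xi> \<in> shadow (stem v0 w)" "\<xi> \<in> shadow (stem v0 w')"
    and "fst ` set w \<subseteq> {..<b}" "fst ` set w' \<subseteq> {..<b}" "length w = length w'"
  shows "w = w'"
proof -
  have *: "u = u'" if pre: "prefix (stem v0 u) (stem v0 u')" and u: "fst ` set u \<subseteq> {..<b}" "fst ` set u' \<subseteq> {..<b}"
    and len: "length u = length u'" for u u'
  proof -
    obtain r where "stem v0 u' = stem v0 u @ r" using pre by (auto simp: prefix_def)
    then have "map letter_arc u' = map letter_arc u @ filter (\<lambda>a. a \<notin> parcs B) r"
      using filter_stem[OF v0 u(1)] filter_stem[OF v0 u(2)] by simp
    moreover from this have "length (filter (\<lambda>a. a \<notin> parcs B) r) = 0"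
      using len by (metis add_cancel_right_right length_append length_map)
    ultimately show ?thesis using map_letter_arc_inj[OF u] by simp
  qed
  show ?thesis using shadow_compatible[OF assms(1,2)] *[of w w'] *[of w' w] assms by auto
qed

end

context marked_deck
begin

abbreviation CE :: "(nat \<Rightarrow> 'f) set" where
  "CE \<equiv> cayley_ends F g b"

lemma word_mult_letter:
  assumes h: "h \<in> carrier F" and l: "fst l < b"
  shows "word (h \<otimes>\<^bsub>F\<^esub> letter_val F g l) = word h @ [l] \<or> word h = word (h \<otimes>\<^bsub>F\<^esub> letter_val F g l) @ [flip l]"
proof (cases "reduced_word b (word h @ [l])")
  case True
  have "word_val F g (word h @ [l]) = h \<otimes>\<^bsub>F\<^esub> letter_val F g l"
    using word_val_append[OF word_letters[OF h], of "[l]"] l word_val_word[OF h] letter_val[OF l] by simp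
  then show ?thesis using word_word_val[OF True] by simp
next
  case False
  define w where "w = butlast (word h)"
  have "word h \<noteq> []" and last: "last (word h) = flip l"
    using False word_reduced[OF h] l by (auto simp: reduced_word_append reduced_word_Cons)
  then have w: "word h = w @ [flip l]" by (simp add: w_def flip: last)
  have rw: "reduced_word b w" and wb: "fst ` set w \<subseteq> {..<b}"
    using word_reduced[OF h] word_letters[OF h] unfolding w by (auto simp: reduced_word_append)
  have "letter_val F g (flip l) = inv\<^bsub>F\<^esub> (letter_val F g l)"
    using l by (cases l) (auto simp: g)
  then have "h = word_val F g w \<otimes>\<^bsub>F\<^esub> inv\<^bsub>F\<^esub> (letter_val F g l)"
    using word_val_word[OF h] word_val_append[OF wb, of "[flip l]"] l letter_val[OF l] w
    by (simp del: letter_val.simps)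
  then have "h \<otimes>\<^bsub>F\<^esub> letter_val F g l = word_val F g w"
    using word_val_closed[OF wb] letter_val[OF l] by (simp add: F.m_assoc del: letter_val.simps)
  then show ?thesis using word_word_val[OF rw] w by simp
qed

lemma cayley_arcD:
  assumes "(h, h') \<in> parcs (cayley_graph F g b)"
  shows "h \<in> carrier F" "h' \<in> carrier F"
    "(\<exists>l. word h' = word h @ [l]) \<or> (\<exists>l. word h = word h' @ [l])"
proof -
  obtain l where l: "h \<in> carrier F" "fst l < b" "h' = h \<otimes>\<^bsub>F\<^esub> letter_val F g l"
    using assms by (auto simp: cayley_graph_def)
  show "h \<in> carrier F" "h' \<in> carrier F" using l letter_val[OF l(2)] by simp_all
  show "(\<exists>l. word h' = word h @ [l]) \<or> (\<exists>l. word h = word h' @ [l])"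
    using word_mult_letter[OF l(1,2)] l(3) by blast
qed

lemma cayley_arcI:
  assumes "h \<in> carrier F" "h' \<in> carrier F" "word h' = word h @ [l]"
  shows "(h, h') \<in> parcs (cayley_graph F g b)"
proof -
  have l: "fst l < b" using word_letters[OF assms(2)] assms(3) by simp
  have "h' = h \<otimes>\<^bsub>F\<^esub> letter_val F g l"
    using word_val_append[OF word_letters[OF assms(1)], of "[l]"] l word_val_word[OF assms(1)]
      word_val_word[OF assms(2)] assms(3) letter_val[OF l] by simp
  then have "\<exists>k m. (h, h') = (k, k \<otimes>\<^bsub>F\<^esub> letter_val F g m) \<and> k \<in> carrier F \<and> fst m < b"
    using assms(1) l by (intro exI[of _ h] exI[of _ l]) simp
  then show ?thesis unfolding cayley_graph_def by simp
qed

lemma word_inj: "h \<in> carrier F \<Longrightarrow> h' \<in> carrier F \<Longrightarrow> word h = word h' \<Longrightarrow> h = h'"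
  using word_val_word by metis

lemma word_one [simp]: "word \<one>\<^bsub>F\<^esub> = []"
  using word_word_val[of "[]"] by simp

lemma cayley_endD:
  assumes "\<xi> \<in> CE"
  shows "\<xi> 0 = \<one>\<^bsub>F\<^esub>" "\<xi> n \<in> carrier F" "(\<xi> n, \<xi> (Suc n)) \<in> parcs (cayley_graph F g b)"
    "\<xi> (Suc (Suc n)) \<noteq> \<xi> n"
  using assms cayley_arcD(1)[of "\<xi> n" "\<xi> (Suc n)"] by (auto simp: cayley_ends_def ends_def)

text \<open>A step that cancels the last letter would return to the vertex before the present one.\<close>

lemma word_cayley_end_Suc:
  assumes "\<xi> \<in> CE" shows "\<exists>l. word (\<xi> (Suc n)) = word (\<xi> n) @ [l]"
proof (induction n)
  case 0
  then show ?case using cayley_arcD(3)[OF cayley_endD(3)[OF assms, of 0]] cayley_endD(1)[OF assms] by auto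
next
  case (Suc n)
  then obtain l where l: "word (\<xi> (Suc n)) = word (\<xi> n) @ [l]" by blast
  have "word (\<xi> (Suc n)) \<noteq> word (\<xi> (Suc (Suc n))) @ [l']" for l'
    using l word_inj[OF cayley_endD(2)[OF assms, of "Suc (Suc n)"] cayley_endD(2)[OF assms, of n]]
      cayley_endD(4)[OF assms] by auto
  then show ?case using cayley_arcD(3)[OF cayley_endD(3)[OF assms, of "Suc n"]] by blast
qed

lemma length_word_cayley_end: "\<xi> \<in> CE \<Longrightarrow> length (word (\<xi> n)) = n"
proof (induction n)
  case 0
  then show ?case by (simp add: cayley_endD(1))
next
  case (Suc n)
  then show ?case using word_cayley_end_Suc[OF Suc.prems, of n] by auto
qed

lemma prefix_word_cayley_end:
  assumes "\<xi> \<in> CE" "n \<le> m" shows "prefix (word (\<xi> n)) (word (\<xi> m))"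
  using assms(2)
proof (induction m rule: dec_induct)
  case (step m)
  then show ?case using word_cayley_end_Suc[OF assms(1), of m] by (metis prefix_append prefix_def)
qed simp

lemma Cyl_iff:
  assumes h: "h \<in> carrier F"
  shows "\<xi> \<in> Cyl F g b h \<longleftrightarrow> \<xi> \<in> CE \<and> \<xi> (length (word h)) = h"
proof (intro iffI conjI)
  assume "\<xi> \<in> Cyl F g b h"
  then have \<xi>: "\<xi> \<in> CE" and "\<forall>\<^sub>F n in sequentially. prefix (word h) (word (\<xi> n))"
    by (auto simp: Cyl_def)
  then obtain N where "\<forall>n\<ge>N. prefix (word h) (word (\<xi> n))" unfolding eventually_sequentially by blast
  then have p: "prefix (word h) (word (\<xi> (max N (length (word h)))))" using max.cobounded1 by blast
  have "prefix (word (\<xi> (length (word h)))) (word (\<xi> (max N (length (word h)))))"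
    using prefix_word_cayley_end[OF \<xi>] max.cobounded2 by blast
  from prefix_length_prefix[OF p this] have "prefix (word h) (word (\<xi> (length (word h))))"
    by (simp add: length_word_cayley_end[OF \<xi>])
  then obtain zs where z: "word (\<xi> (length (word h))) = word h @ zs" by (rule prefixE)
  have "zs = []" using arg_cong[OF z, of length] length_word_cayley_end[OF \<xi>] by simp
  then have "word h = word (\<xi> (length (word h)))" using z by simp
  then show "\<xi> (length (word h)) = h" using word_inj[OF h cayley_endD(2)[OF \<xi>]] by metis
  show "\<xi> \<in> CE" by (rule \<xi>)
next
  assume \<xi>: "\<xi> \<in> CE \<and> \<xi> (length (word h)) = h"
  then have "prefix (word h) (word (\<xi> n))" if "n \<ge> length (word h)" for n
    using prefix_word_cayley_end[of \<xi>, OF _ that] by simp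
  then show "\<xi> \<in> Cyl F g b h" using \<xi> by (auto simp: Cyl_def eventually_sequentially)
qed

lemma cayley_end_of_words:
  assumes red: "\<And>n. reduced_word b (w n)" and "w 0 = []" and suc: "\<And>n. \<exists>l. w (Suc n) = w n @ [l]"
  shows "(\<lambda>n. word_val F g (w n)) \<in> CE"
proof -
  have w: "word_val F g (w n) \<in> carrier F" "word (word_val F g (w n)) = w n" for n
    using word_word_val[OF red] word_val_closed[of "w n"] red[of n] by (auto simp: reduced_word_def)
  have "(word_val F g (w n), word_val F g (w (Suc n))) \<in> parcs (cayley_graph F g b)" for n
    using suc[of n] cayley_arcI[OF w(1) w(1)] w(2) by metis
  moreover have "word_val F g (w (Suc (Suc n))) \<noteq> word_val F g (w n)" for n
  proof
    assume "word_val F g (w (Suc (Suc n))) = word_val F g (w n)"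
    then have "w (Suc (Suc n)) = w n" using w(2)[of n] w(2)[of "Suc (Suc n)"] by simp
    moreover obtain l l' where "w (Suc n) = w n @ [l]" "w (Suc (Suc n)) = w (Suc n) @ [l']"
      using suc by blast
    ultimately show False by simp
  qed
  ultimately show ?thesis using assms(2) by (simp add: cayley_ends_def ends_def)
qed

section \<open>The boundary map\<close>

text \<open>The orbit points along an infinite reduced word move along the stems of its prefixes, so they
  converge to the end that the stems run to.\<close>

lemma boundary_map:
  assumes \<xi>: "\<xi> \<in> CE"
  shows "boundary_map \<T> x0 \<alpha> \<xi> \<in> E" "boundary_map \<T> x0 \<alpha> \<xi> \<in> shadow (stem v0 (word (\<xi> n)))"
proof -
  let ?s = "\<lambda>n. stem v0 (word (\<xi> n))"
  note c = cayley_endD(2)[OF \<xi>]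
  have ax: "\<alpha> (\<xi> n) x0 \<in> pverts \<T>" for n using deckD(2)[OF _ x0] c by simp
  have pre: "prefix (?s n) (?s (Suc n))" for n
    using word_cayley_end_Suc[OF \<xi>, of n] stem_append by (metis prefixI)
  have len: "n \<le> length (?s n)" for n
    using length_stem[of "word (\<xi> n)" v0] length_word_cayley_end[OF \<xi>] by simp
  obtain \<eta> where \<eta>: "\<eta> \<in> E" "\<And>n. \<eta> \<in> shadow (?s n)"
    using end_of_chain[of ?s] walk_stem[OF v0 word_letters[OF c]] nb_stem[OF v0 word_reduced[OF c]] pre len
    by blast
  have lim: "limitin compactification (\<lambda>n. Inl (\<alpha> (\<xi> n) x0)) (Inr \<eta>) sequentially"
    unfolding limitin_end_iff[OF ax \<eta>(1)]
  proof
    fix k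
    have "prefix (label x0 (\<eta> k)) (label x0 (\<alpha> (\<xi> n) x0))" if "n \<ge> k" for n
    proof -
      have "k \<le> length (?s n)" using len[of n] that by simp
      then have "prefix (label x0 (\<eta> k)) (?s n)"
        using \<eta>(2)[of n] prefix_label_end[OF \<eta>(1), of k "length (?s n)"] by (simp add: shadow_def)
      then show ?thesis using label_\<alpha>[OF c] by (simp add: word_walk_def)
    qed
    then show "\<forall>\<^sub>F n in sequentially. prefix (label x0 (\<eta> k)) (label x0 (\<alpha> (\<xi> n) x0))"
      by (auto simp: eventually_sequentially)
  qed
  have "boundary_map \<T> x0 \<alpha> \<xi> = \<eta>"
    unfolding boundary_map_def
  proof (rule the_equality)
    show "\<eta> \<in> E \<and> limitin compactification (\<lambda>n. Inl (\<alpha> (\<xi> n) x0)) (Inr \<eta>) sequentially"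
      using \<eta> lim by blast
  next
    fix \<eta>' assume \<eta>': "\<eta>' \<in> E \<and> limitin compactification (\<lambda>n. Inl (\<alpha> (\<xi> n) x0)) (Inr \<eta>') sequentially"
    show "\<eta>' = \<eta>"
    proof (rule end_eqI)
      fix k
      have "\<forall>\<^sub>F n in sequentially. prefix (label x0 (\<eta>' k)) (label x0 (\<alpha> (\<xi> n) x0)) \<and>
          prefix (label x0 (\<eta> k)) (label x0 (\<alpha> (\<xi> n) x0))"
        using lim \<eta>' limitin_end_iff[OF ax, of \<eta>] limitin_end_iff[OF ax, of \<eta>'] \<eta>(1)
        by (intro eventually_conj) simp_all
      then obtain n where "prefix (label x0 (\<eta>' k)) (label x0 (\<alpha> (\<xi> n) x0))"
          "prefix (label x0 (\<eta> k)) (label x0 (\<alpha> (\<xi> n) x0))"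
        using eventually_happens' sequentially_bot by blast
      then show "label x0 (\<eta>' k) = label x0 (\<eta> k)"
        using \<eta>' \<eta>(1) by (auto simp: prefix_def append_eq_append_conv)
    qed (use \<eta> \<eta>' in auto)
  qed
  then show "boundary_map \<T> x0 \<alpha> \<xi> \<in> E" "boundary_map \<T> x0 \<alpha> \<xi> \<in> shadow (stem v0 (word (\<xi> n)))"
    using \<eta> by auto
qed

text \<open>The inverse reads off the arcs of a ray outside the spanning tree as the letters of an infinite
  reduced word.\<close>

lemma boundary_map_bij: "bij_betw (boundary_map \<T> x0 \<alpha>) CE E"
  unfolding bij_betw_def
proof (intro conjI inj_onI)
  fix \<xi> \<xi>' assume \<xi>: "\<xi> \<in> CE" "\<xi>' \<in> CE" "boundary_map \<T> x0 \<alpha> \<xi> = boundary_map \<T> x0 \<alpha> \<xi>'"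
  show "\<xi> = \<xi>'"
  proof
    fix n
    note c = cayley_endD(2)[OF \<xi>(1), of n] cayley_endD(2)[OF \<xi>(2), of n]
    have "word (\<xi> n) = word (\<xi>' n)"
      using end_word_unique[of "boundary_map \<T> x0 \<alpha> \<xi>" "word (\<xi> n)" "word (\<xi>' n)"]
        boundary_map(2)[OF \<xi>(1), of n] boundary_map(2)[OF \<xi>(2), of n] \<xi>(3) word_letters[OF c(1)] word_letters[OF c(2)]
        length_word_cayley_end[OF \<xi>(1)] length_word_cayley_end[OF \<xi>(2)] by simp
    then show "\<xi> n = \<xi>' n" using word_inj c by blast
  qed
next
  show "boundary_map \<T> x0 \<alpha> ` CE = E"
  proof (intro subset_antisym subsetI)
    fix \<eta> assume \<eta>: "\<eta> \<in> E"
    obtain w where w: "\<And>n. reduced_word b (w n)" "\<And>n. length (w n) = n" "\<And>n. \<eta> \<in> shadow (stem v0 (w n))"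
      using end_word_exists[OF \<eta>] by metis
    have wb: "fst ` set (w n) \<subseteq> {..<b}" for n using w(1) by (simp add: reduced_word_def)
    have "\<exists>l. w (Suc n) = w n @ [l]" for n
    proof -
      have "prefix (stem v0 (take n (w (Suc n)))) (stem v0 (w (Suc n)))"
        using stem_append[of v0 "take n (w (Suc n))" "drop n (w (Suc n))"] by simp
      then have "\<eta> \<in> shadow (stem v0 (take n (w (Suc n))))" using w(3)[of "Suc n"] shadow_antimono by blast
      moreover have "fst ` set (take n (w (Suc n))) \<subseteq> {..<b}" using wb[of "Suc n"] set_take_subset by fast
      ultimately have "take n (w (Suc n)) = w n"
        using end_word_unique[OF _ w(3)[of n] _ wb[of n]] w(2)[of n] w(2)[of "Suc n"] by simp
      then show ?thesis using w(2)[of "Suc n"] by (metis lessI take_Suc_conv_app_nth take_all_iff order_refl)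
    qed
    then have \<xi>: "(\<lambda>n. word_val F g (w n)) \<in> CE" using w(1) w(2)[of 0] by (intro cayley_end_of_words) auto
    have "boundary_map \<T> x0 \<alpha> (\<lambda>n. word_val F g (w n)) = \<eta>"
    proof (rule end_eqI[OF boundary_map(1)[OF \<xi>] \<eta>])
      fix n
      let ?\<eta> = "boundary_map \<T> x0 \<alpha> (\<lambda>n. word_val F g (w n))"
      have "?\<eta> \<in> shadow (stem v0 (w n))" using boundary_map(2)[OF \<xi>, of n] word_word_val[OF w(1)] by simp
      moreover note w(3)[of n]
      moreover have "n \<le> length (stem v0 (w n))" using length_stem[of "w n" v0] w(2)[of n] by simp
      ultimately have "prefix (label x0 (?\<eta> n)) (stem v0 (w n))" "prefix (label x0 (\<eta> n)) (stem v0 (w n))"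
        using prefix_label_end[OF boundary_map(1)[OF \<xi>], of n "length (stem v0 (w n))"]
          prefix_label_end[OF \<eta>, of n "length (stem v0 (w n))"] by (auto simp: shadow_def)
      then show "label x0 (?\<eta> n) = label x0 (\<eta> n)"
        by (metis append_eq_append_conv length_label_end boundary_map(1)[OF \<xi>] \<eta> prefix_def)
    qed
    then show "\<eta> \<in> boundary_map \<T> x0 \<alpha> ` CE" using \<xi> by blast
  qed (use boundary_map(1) in blast)
qed

text \<open>An end starts with the stem of a word exactly if the letters read off from it start with that
  word.\<close>

lemma boundary_iso_Cyl_iff:
  assumes \<eta>: "\<eta> \<in> E" and h: "h \<in> carrier F"
  shows "boundary_iso \<T> x0 F g b \<alpha> \<eta> \<in> CE"
    and "boundary_iso \<T> x0 F g b \<alpha> \<eta> \<in> Cyl F g b h \<longleftrightarrow> \<eta> \<in> shadow (stem v0 (word h))"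
proof -
  define \<xi> where "\<xi> = boundary_iso \<T> x0 F g b \<alpha> \<eta>"
  have \<xi>: "\<xi> \<in> CE" "boundary_map \<T> x0 \<alpha> \<xi> = \<eta>"
    using \<eta> boundary_map_bij f_the_inv_into_f_bij_betw[OF boundary_map_bij, of \<eta>]
      bij_betwE[OF bij_betw_the_inv_into[OF boundary_map_bij]]
    by (auto simp: \<xi>_def boundary_iso_def)
  show "boundary_iso \<T> x0 F g b \<alpha> \<eta> \<in> CE" using \<xi>(1) by (simp add: \<xi>_def)
  let ?n = "length (word h)"
  have "\<xi> ?n = h \<longleftrightarrow> \<eta> \<in> shadow (stem v0 (word h))"
  proof
    assume "\<xi> ?n = h"
    then show "\<eta> \<in> shadow (stem v0 (word h))" using boundary_map(2)[OF \<xi>(1), of ?n] \<xi>(2) by simp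
  next
    assume "\<eta> \<in> shadow (stem v0 (word h))"
    moreover have "\<eta> \<in> shadow (stem v0 (word (\<xi> ?n)))" using boundary_map(2)[OF \<xi>(1), of ?n] \<xi>(2) by simp
    ultimately have "word h = word (\<xi> ?n)"
      using end_word_unique word_letters[OF h] word_letters[OF cayley_endD(2)[OF \<xi>(1)]]
        length_word_cayley_end[OF \<xi>(1)] by metis
    then show "\<xi> ?n = h" using word_inj[OF h cayley_endD(2)[OF \<xi>(1)]] by metis
  qed
  then show "boundary_iso \<T> x0 F g b \<alpha> \<eta> \<in> Cyl F g b h \<longleftrightarrow> \<eta> \<in> shadow (stem v0 (word h))"
    using Cyl_iff[OF h, of \<xi>] \<xi>(1) by (simp add: \<xi>_def)
qed

end


section \<open>Irreducibility of the edge adjacency relation\<close>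

locale pf_cover = marked_cover G \<T> \<pi> B x0 b e
  for G :: "'a pair_pre_digraph" and \<T> :: "'b pair_pre_digraph" and \<pi> :: "'b \<Rightarrow> 'a"
    and B :: "'a pair_pre_digraph" and x0 :: 'b and b :: nat and e :: "nat \<Rightarrow> 'a \<times> 'a" +
  fixes p :: "'a \<times> 'a \<Rightarrow> real"
  assumes no_leaves: "\<And>v. v \<in> pverts G \<Longrightarrow> degree G v \<noteq> 1"
    and b: "b > 1"
    and pf: "pf_eigenvector G p"
begin

definition succs :: "'a \<times> 'a \<Rightarrow> ('a \<times> 'a) set" where
  "succs a = {c \<in> parcs G. fst c = snd a \<and> c \<noteq> prod.swap a}"

definition follows :: "'a \<times> 'a \<Rightarrow> 'a \<times> 'a \<Rightarrow> bool" where
  "follows a c \<longleftrightarrow> a \<in> parcs G \<and> c \<in> succs a"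

lemma finite_succs [simp]: "finite (succs a)"
  using G.pair_finite_arcs by (simp add: succs_def)

lemma succs_ne:
  assumes "a \<in> parcs G" shows "succs a \<noteq> {}"
proof
  assume none: "succs a = {}"
  have "prod.swap a \<in> parcs G" using assms G.swap_arc by simp
  with none have "{c \<in> parcs G. fst c = snd a} = {prod.swap a}" by (auto simp: succs_def)
  then have "degree G (snd a) = 1" by (simp add: out_degree_def out_arcs_def)
  then show False using no_leaves G.arc_snd_in_verts[OF assms] by blast
qed

lemma follows_rev: "follows a c \<Longrightarrow> follows (prod.swap c) (prod.swap a)"
  using G.swap_arc by (auto simp: follows_def succs_def)

lemma follows_rtrancl_rev: "follows\<^sup>*\<^sup>* a c \<Longrightarrow> follows\<^sup>*\<^sup>* (prod.swap c) (prod.swap a)"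
  by (induction rule: rtranclp_induct) (auto intro: converse_rtranclp_into_rtranclp follows_rev)

lemma nb_walk_follows:
  "walk G u (a # q) v \<Longrightarrow> nonbacktracking (a # q) \<Longrightarrow> c \<in> set (a # q) \<Longrightarrow> follows\<^sup>*\<^sup>* a c"
proof (induction q arbitrary: u a)
  case (Cons d q)
  show ?case
  proof (cases "c = a")
    case False
    have "follows a d" using Cons.prems by (auto simp: follows_def succs_def nonbacktracking_Cons)
    moreover have "follows\<^sup>*\<^sup>* d c"
      using Cons.IH[of "fst d" d] Cons.prems False by (auto simp: nonbacktracking_Cons)
    ultimately show ?thesis by (rule converse_rtranclp_into_rtranclp)
  qed simp
qed simp

text \<open>In a reduced word a letter can be followed by all letters but its inverse, and the inverse can be
  reached through a letter of another index; this is where two generators are needed.\<close>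

lemma cotree_follows:
  assumes l: "fst l < b" and l': "fst l' < b" shows "follows\<^sup>*\<^sup>* (letter_arc l) (letter_arc l')"
proof -
  have step: "follows\<^sup>*\<^sup>* (letter_arc l) (letter_arc l')" if "fst l < b" "fst l' < b" "l' \<noteq> flip l" for l l'
  proof -
    have r: "reduced_word b [l, l']" using that by (simp add: reduced_word_Cons)
    let ?u = "fst (letter_arc l)"
    note u = letter_arc_verts(1)[OF that(1)]
    let ?q = "B.tpath (snd (letter_arc l)) (fst (letter_arc l')) @ [letter_arc l']"
    have eq: "stem ?u [l, l'] = letter_arc l # ?q" using u by simp
    have w: "walk G ?u (stem ?u [l, l']) (stem_end ?u [l, l'])"
      using that by (intro walk_stem u) auto
    show ?thesis by (rule nb_walk_follows[OF w[unfolded eq] nb_stem[OF u r, unfolded eq]]) simp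
  qed
  show ?thesis
  proof (cases "l' = flip l")
    case True
    obtain j where j: "j < b" "j \<noteq> fst l" using b by (metis less_trans zero_less_one less_numeral_extra(3) neq0_conv)
    have "follows\<^sup>*\<^sup>* (letter_arc l) (letter_arc (j, True))"
      by (rule step) (use j l in auto)
    also have "follows\<^sup>*\<^sup>* \<dots> (letter_arc l')"
      by (rule step) (use j l l' True in auto)
    finally show ?thesis .
  qed (use step l l' in blast)
qed

text \<open>Without leaves, a non-backtracking walk can always be continued, and the finite spanning tree
  cannot hold it forever.\<close>

lemma reaches_cotree:
  assumes a: "a \<in> parcs G" shows "\<exists>l. fst l < b \<and> follows\<^sup>*\<^sup>* a (letter_arc l)"
proof (rule ccontr)
  assume no: "\<not> ?thesis"
  have inB: "c \<in> parcs B" if "follows\<^sup>*\<^sup>* a c" for c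
  proof (rule ccontr)
    assume "c \<notin> parcs B"
    moreover have "c \<in> parcs G" using that by (cases rule: rtranclp.cases) (auto simp: a follows_def succs_def)
    ultimately show False using letter_arc_surj no that by blast
  qed
  have long: "\<exists>q v. length q = n \<and> walk G (fst a) (a # q) v \<and> nonbacktracking (a # q)" for n
  proof (induction n)
    case 0
    then show ?case using a G.arc_snd_in_verts by auto
  next
    case (Suc n)
    then obtain q v where q: "length q = n" "walk G (fst a) (a # q) v" "nonbacktracking (a # q)" by blast
    have "last (a # q) \<in> parcs G" using G.walk_arcs[OF q(2)] last_in_set[of "a # q"] by blast
    then obtain c where c: "c \<in> succs (last (a # q))" using succs_ne by blast
    have v: "v = snd (last (a # q))" using G.walk_last[OF q(2)] by simp
    have "walk G (fst a) ((a # q) @ [c]) (snd c)"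
      unfolding G.walk_append
      using q(2) c G.arc_snd_in_verts by (intro exI[of _ v]) (auto simp: v succs_def)
    moreover have "nonbacktracking ((a # q) @ [c])"
      using q(3) c unfolding nonbacktracking_append by (auto simp: succs_def)
    ultimately show ?case using q(1) by (intro exI[of _ "q @ [c]"] exI[of _ "snd c"]) simp
  qed
  obtain q v where q: "length q = card (pverts G)" "walk G (fst a) (a # q) v" "nonbacktracking (a # q)"
    using long by blast
  have "set (a # q) \<subseteq> parcs B" using nb_walk_follows[OF q(2,3)] inB by blast
  then have w: "walk B (fst a) (a # q) v" using walk_in_B[OF q(2)] by blast
  have "distinct (map snd (a # q))" by (rule B.distinct_nb_walk[OF w q(3)])
  then have "card (snd ` set (a # q)) = Suc (card (pverts G))"
    using distinct_card[of "map snd (a # q)"] q(1) by simp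
  moreover have "snd ` set (a # q) \<subseteq> pverts G" using G.walk_arcs[OF q(2)] by (blast intro: G.arc_snd_in_verts)
  ultimately show False using card_mono[OF G.pair_finite_verts, of "snd ` set (a # q)"] by simp
qed

text \<open>Both \<open>a\<close> and the inverse of \<open>c\<close> lead to arcs outside the spanning tree. Reversing the second way
  and connecting the two yields a way from \<open>a\<close> to \<open>c\<close>.\<close>

lemma irreducible:
  assumes "a \<in> parcs G" "c \<in> parcs G" shows "follows\<^sup>*\<^sup>* a c"
proof -
  obtain l where l: "fst l < b" "follows\<^sup>*\<^sup>* a (letter_arc l)" using reaches_cotree assms by blast
  obtain l' where l': "fst l' < b" "follows\<^sup>*\<^sup>* (prod.swap c) (letter_arc l')"
    using reaches_cotree[of "prod.swap c"] assms G.swap_arc by auto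
  have "follows\<^sup>*\<^sup>* (letter_arc l) (letter_arc (flip l'))" using cotree_follows l l' by simp
  moreover have "follows\<^sup>*\<^sup>* (letter_arc (flip l')) c"
    using follows_rtrancl_rev[OF l'(2)] letter_arc_flip[of l'] by simp
  ultimately show ?thesis using l(2) by (meson rtranclp_trans)
qed

definition nb_walks :: "('a \<times> 'a) list set" where
  "nb_walks = {q. (\<exists>v. walk G v0 q v) \<and> nonbacktracking q}"

lemma nb_walks_snoc: "q @ [c] \<in> nb_walks \<longleftrightarrow> q \<in> nb_walks \<and> c \<in> parcs G \<and> (if q = [] then fst c = v0 else c \<in> succs (last q))"
proof (cases "q = []")
  case True
  then show ?thesis using v0 G.arc_snd_in_verts by (auto simp: nb_walks_def)
next
  case False
  have "(\<exists>v. walk G v0 (q @ [c]) v) \<longleftrightarrow> (\<exists>v. walk G v0 q v) \<and> c \<in> parcs G \<and> fst c = snd (last q)"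
    unfolding G.walk_append
    using False G.walk_last[of v0 q] G.arc_snd_in_verts by auto
  then show ?thesis using False by (auto simp: nb_walks_def nonbacktracking_append succs_def)
qed

lemma arc_at_v0: "\<exists>a. [a] \<in> nb_walks"
proof -
  have r: "reduced_word b [(0, True)]" using b by (simp add: reduced_word_Cons)
  then have "stem v0 [(0, True)] \<in> nb_walks"
    using walk_stem[OF v0, of "[(0, True)]"] nb_stem[OF v0 r] b by (auto simp: nb_walks_def)
  moreover have "stem v0 [(0, True)] \<noteq> []" by simp
  ultimately obtain a q where aq: "a # q \<in> nb_walks" by (cases "stem v0 [(0, True)]") auto
  then have "[a] \<in> nb_walks" using G.arc_snd_in_verts by (auto simp: nb_walks_def nonbacktracking_Cons)
  then show ?thesis by blast
qed

lemma nb_walks_ending: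
  assumes "c \<in> parcs G" shows "\<exists>q\<in>nb_walks. q \<noteq> [] \<and> last q = c"
proof -
  obtain a where a: "[a] \<in> nb_walks" using arc_at_v0 by blast
  then have "a \<in> parcs G" by (auto simp: nb_walks_def)
  from irreducible[OF this assms] show ?thesis
  proof (induction rule: rtranclp_induct)
    case base
    then show ?case using a by (intro bexI[of _ "[a]"]) auto
  next
    case (step d c)
    then obtain q where q: "q \<in> nb_walks" "q \<noteq> []" "last q = d" by blast
    then have "q @ [c] \<in> nb_walks" using step(2) by (simp add: nb_walks_snoc follows_def succs_def)
    then show ?case by (intro bexI[of _ "q @ [c]"]) auto
  qed
qed


section \<open>The Perron--Frobenius eigenvector\<close>

abbreviation lam :: real where "lam \<equiv> pf_eigenvalue G"

text \<open>Inverting all arcs transposes the edge adjacency matrix, which turns the row eigenvector into a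
  column eigenvector.\<close>

definition col_vec :: "'a \<times> 'a \<Rightarrow> real" where "col_vec a = p (prod.swap a)"

lemma col_vec_pos: "a \<in> parcs G \<Longrightarrow> 0 < col_vec a"
  using pf G.swap_arc by (simp add: col_vec_def pf_eigenvector_def)

lemma col_vec_eigen:
  assumes a: "a \<in> parcs G" shows "(\<Sum>c\<in>succs a. col_vec c) = lam * col_vec a"
proof -
  have sa: "prod.swap a \<in> parcs G" using a G.swap_arc by simp
  have "lam * col_vec a = (\<Sum>d\<in>parcs G. p d * edge_adj d (prod.swap a))"
    using pf sa by (simp add: col_vec_def pf_eigenvector_def)
  also have "\<dots> = (\<Sum>c\<in>parcs G. col_vec c * edge_adj (prod.swap c) (prod.swap a))"
    by (rule sum.reindex_bij_witness[of _ prod.swap prod.swap]) (auto simp: col_vec_def G.swap_arc)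
  also have "\<dots> = (\<Sum>c\<in>parcs G. if c \<in> succs a then col_vec c else 0)"
    by (intro sum.cong refl) (auto simp: edge_adj_def succs_def swap_eq_iff)
  also have "\<dots> = (\<Sum>c\<in>succs a. col_vec c)"
    using G.pair_finite_arcs by (subst sum.inter_filter[symmetric]) (auto simp: succs_def intro!: sum.cong)
  finally show ?thesis by simp
qed

lemma succs_arcs: "c \<in> succs a \<Longrightarrow> c \<in> parcs G"
  by (simp add: succs_def)

lemma lam_pos: "0 < lam"
proof -
  obtain a where a: "a \<in> parcs G" using arc_at_v0 by (auto simp: nb_walks_def)
  have "0 < (\<Sum>c\<in>succs a. col_vec c)" using succs_ne[OF a] col_vec_pos succs_arcs by (intro sum_pos) auto
  then show ?thesis using col_vec_eigen[OF a] col_vec_pos[OF a] by (simp add: zero_less_mult_iff)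
qed

text \<open>Subtract the largest multiple of the positive eigenvector that keeps a non-negative eigenvector
  non-negative. The difference vanishes at some arc, hence at all arcs that can be reached from
  it, hence everywhere.\<close>

lemma eigenvector_unique:
  assumes nonneg: "\<And>a. a \<in> parcs G \<Longrightarrow> 0 \<le> Q a"
    and eigen: "\<And>a. a \<in> parcs G \<Longrightarrow> (\<Sum>c\<in>succs a. Q c) = lam * Q a"
  shows "\<exists>c\<ge>0. \<forall>a\<in>parcs G. Q a = c * col_vec a"
proof -
  have ne: "parcs G \<noteq> {}" using arc_at_v0 by (auto simp: nb_walks_def)
  define c where "c = Min ((\<lambda>a. Q a / col_vec a) ` parcs G)"
  have "c \<in> (\<lambda>a. Q a / col_vec a) ` parcs G" unfolding c_def using ne G.pair_finite_arcs by (intro Min_in) auto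
  then obtain a0 where a0: "a0 \<in> parcs G" "c = Q a0 / col_vec a0" by blast
  have le: "c * col_vec a \<le> Q a" if "a \<in> parcs G" for a
  proof -
    have "c \<le> Q a / col_vec a" unfolding c_def using that G.pair_finite_arcs by (intro Min_le) auto
    then show ?thesis using col_vec_pos[OF that] by (simp add: pos_le_divide_eq)
  qed
  have "Q a = c * col_vec a" if "follows\<^sup>*\<^sup>* a0 a" for a
    using that
  proof (induction rule: rtranclp_induct)
    case base
    then show ?case using a0 col_vec_pos[OF a0(1)] by simp
  next
    case (step a d)
    then have a: "a \<in> parcs G" and d: "d \<in> succs a" by (auto simp: follows_def)
    have "(\<Sum>d\<in>succs a. Q d - c * col_vec d) = 0"
      using eigen[OF a] col_vec_eigen[OF a] step.IH by (simp add: sum_subtractf sum_distrib_left[symmetric])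
    then have "\<forall>d\<in>succs a. Q d - c * col_vec d = 0"
      using le succs_arcs by (subst (asm) sum_nonneg_eq_0_iff) auto
    then show ?case using d by auto
  qed
  then have "\<forall>a\<in>parcs G. Q a = c * col_vec a" using irreducible[OF a0(1)] by blast
  moreover have "0 \<le> c" using a0 nonneg[OF a0(1)] col_vec_pos[OF a0(1)] by simp
  ultimately show ?thesis by blast
qed


section \<open>Convergence of the orbit series\<close>

definition nb_walks_level :: "nat \<Rightarrow> ('a \<times> 'a) list set" where
  "nb_walks_level n = {q \<in> nb_walks. length q = n}"

lemma finite_nb_walks_level [simp]: "finite (nb_walks_level n)"
proof (rule finite_subset)
  show "nb_walks_level n \<subseteq> {q. set q \<subseteq> parcs G \<and> length q = n}"
    using G.walk_arcs by (auto simp: nb_walks_level_def nb_walks_def)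
  show "finite {q. set q \<subseteq> parcs G \<and> length q = n}"
    using G.pair_finite_arcs by (rule finite_lists_length_eq)
qed

lemma sum_nb_walks_level_Suc:
  assumes "n > 0"
  shows "(\<Sum>q\<in>nb_walks_level (Suc n). f q) = (\<Sum>q\<in>nb_walks_level n. \<Sum>c\<in>succs (last q). f (q @ [c]))"
proof -
  have "(\<Sum>q\<in>nb_walks_level n. \<Sum>c\<in>succs (last q). f (q @ [c])) =
      (\<Sum>(q, c)\<in>Sigma (nb_walks_level n) (\<lambda>q. succs (last q)). f (q @ [c]))"
    by (rule sum.Sigma) auto
  also have "\<dots> = (\<Sum>q\<in>nb_walks_level (Suc n). f q)"
  proof (rule sum.reindex_bij_witness[of _ "\<lambda>q. (butlast q, last q)" "\<lambda>(q, c). q @ [c]"])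
    fix q assume q: "q \<in> nb_walks_level (Suc n)"
    then have q': "q = butlast q @ [last q]" by (cases q rule: rev_cases) (auto simp: nb_walks_level_def)
    then have "butlast q @ [last q] \<in> nb_walks" using q by (simp add: nb_walks_level_def)
    moreover have "length (butlast q) = n" using q by (simp add: nb_walks_level_def)
    then have "butlast q \<noteq> []" using assms by (metis less_not_refl list.size(3))
    ultimately show "(butlast q, last q) \<in> Sigma (nb_walks_level n) (\<lambda>q. succs (last q))"
      using q unfolding nb_walks_snoc by (auto simp: nb_walks_level_def)
    show "(case (butlast q, last q) of (q, c) \<Rightarrow> q @ [c]) = q" using q' by simp
  next
    fix x assume x: "x \<in> Sigma (nb_walks_level n) (\<lambda>q. succs (last q))"
    then obtain q c where qc: "x = (q, c)" "q \<in> nb_walks" "length q = n" "c \<in> succs (last q)"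
      by (auto simp: nb_walks_level_def)
    then have "q @ [c] \<in> nb_walks" using assms succs_arcs by (auto simp: nb_walks_snoc)
    then show "(case x of (q, c) \<Rightarrow> q @ [c]) \<in> nb_walks_level (Suc n)" using qc by (simp add: nb_walks_level_def)
  qed auto
  finally show ?thesis by simp
qed

text \<open>Prolonging walks by one arc multiplies the total of their eigenvector weights by the eigenvalue.\<close>

lemma weighted_count: "(\<Sum>q\<in>nb_walks_level (Suc n). col_vec (last q)) = lam ^ n * (\<Sum>q\<in>nb_walks_level 1. col_vec (last q))"
proof (induction n)
  case (Suc n)
  have "(\<Sum>q\<in>nb_walks_level (Suc (Suc n)). col_vec (last q)) = (\<Sum>q\<in>nb_walks_level (Suc n). \<Sum>c\<in>succs (last q). col_vec c)"
    by (simp add: sum_nb_walks_level_Suc)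
  also have "\<dots> = (\<Sum>q\<in>nb_walks_level (Suc n). lam * col_vec (last q))"
  proof (rule sum.cong[OF refl])
    fix q assume "q \<in> nb_walks_level (Suc n)"
    then have "last q \<in> parcs G" using G.walk_arcs last_in_set[of q] by (fastforce simp: nb_walks_level_def nb_walks_def)
    then show "(\<Sum>c\<in>succs (last q). col_vec c) = lam * col_vec (last q)" by (rule col_vec_eigen)
  qed
  also have "\<dots> = lam * (lam ^ n * (\<Sum>q\<in>nb_walks_level 1. col_vec (last q)))"
    using Suc by (simp only: sum_distrib_left[symmetric])
  finally show ?case by simp
qed simp

text \<open>The eigenvector weights are bounded away from 0, so the number of walks grows no faster than their
  total weight.\<close>

lemma card_nb_walks_level: "\<exists>K\<ge>0. \<forall>n. real (card (nb_walks_level n)) \<le> K * lam ^ n"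
proof -
  have ne: "parcs G \<noteq> {}" using arc_at_v0 by (auto simp: nb_walks_def)
  define m where "m = Min (col_vec ` parcs G)"
  have "m \<in> col_vec ` parcs G" unfolding m_def using ne G.pair_finite_arcs by (intro Min_in) auto
  then have m: "0 < m" using col_vec_pos by auto
  have m_le: "m \<le> col_vec a" if "a \<in> parcs G" for a
    unfolding m_def using that G.pair_finite_arcs by (intro Min_le) auto
  define W where "W = (\<Sum>q\<in>nb_walks_level 1. col_vec (last q))"
  have arcs: "last q \<in> parcs G" if "q \<in> nb_walks_level (Suc n)" for q n
    using that G.walk_arcs last_in_set[of q] by (fastforce simp: nb_walks_level_def nb_walks_def)
  have W: "0 \<le> W" unfolding W_def
    by (rule sum_nonneg) (use less_imp_le[OF col_vec_pos[OF arcs[of _ 0]]] in simp)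
  have bound: "real (card (nb_walks_level (Suc n))) \<le> W / (m * lam) * lam ^ Suc n" for n
  proof -
    have "real (card (nb_walks_level (Suc n))) * m \<le> (\<Sum>q\<in>nb_walks_level (Suc n). col_vec (last q))"
      using sum_bounded_below[of "nb_walks_level (Suc n)" m "\<lambda>q. col_vec (last q)"] arcs m_le by auto
    also have "\<dots> = lam ^ n * W" unfolding W_def by (rule weighted_count)
    finally show ?thesis using m lam_pos by (simp add: field_simps)
  qed
  have "nb_walks_level 0 \<subseteq> {[]}" by (auto simp: nb_walks_level_def)
  then have "card (nb_walks_level 0) \<le> card {[] :: ('a \<times> 'a) list}" by (rule card_mono[rotated]) simp
  then have zero: "real (card (nb_walks_level 0)) \<le> 1" by simp
  show ?thesis
  proof (intro exI[of _ "max 1 (W / (m * lam))"] conjI allI)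
    fix n
    show "real (card (nb_walks_level n)) \<le> max 1 (W / (m * lam)) * lam ^ n"
    proof (cases n)
      case 0
      then show ?thesis using zero by simp
    next
      case (Suc k)
      have "W / (m * lam) * lam ^ n \<le> max 1 (W / (m * lam)) * lam ^ n"
        using lam_pos by (intro mult_right_mono) auto
      then show ?thesis using bound[of k] unfolding Suc by (rule order_trans[rotated])
    qed
  qed simp
qed

lemma summable_nb_walks:
  assumes s: "s > ln lam"
  shows "(\<lambda>q. exp (- s * real (length q))) summable_on nb_walks"
proof (rule nonneg_bdd_above_summable_on)
  obtain K where K: "0 \<le> K" "\<And>n. real (card (nb_walks_level n)) \<le> K * lam ^ n" using card_nb_walks_level by blast
  define x where "x = lam * exp (- s)"
  have "x = exp (ln lam - s)" using lam_pos by (simp add: x_def exp_diff exp_minus field_simps)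
  then have x: "0 \<le> x" "x < 1" using s by auto
  have level: "(\<Sum>q\<in>nb_walks_level n. exp (- s * real (length q))) \<le> K * x ^ n" for n
  proof -
    have "(\<Sum>q\<in>nb_walks_level n. exp (- s * real (length q))) = (\<Sum>q\<in>nb_walks_level n. exp (- s) ^ n)"
      by (intro sum.cong refl) (auto simp: nb_walks_level_def exp_of_nat_mult[symmetric] mult.commute)
    also have "\<dots> = real (card (nb_walks_level n)) * exp (- s) ^ n" by simp
    also have "\<dots> \<le> K * lam ^ n * exp (- s) ^ n" using K(2) by (intro mult_right_mono) auto
    finally show ?thesis by (simp add: x_def power_mult_distrib mult.assoc)
  qed
  show "bdd_above (sum (\<lambda>q. exp (- s * real (length q))) ` {F. F \<subseteq> nb_walks \<and> finite F})"
  proof (rule bdd_aboveI2)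
    fix A assume A: "A \<in> {F. F \<subseteq> nb_walks \<and> finite F}"
    define N where "N = Suc (Max (insert 0 (length ` A)))"
    have "A \<subseteq> (\<Union>n<N. nb_walks_level n)"
    proof
      fix q assume q: "q \<in> A"
      then have "length q \<le> Max (insert 0 (length ` A))" using A by (intro Max_ge) auto
      then have "length q < N" by (simp only: N_def less_Suc_eq_le)
      moreover have "q \<in> nb_walks_level (length q)" using q A by (auto simp: nb_walks_level_def)
      ultimately show "q \<in> (\<Union>n<N. nb_walks_level n)" by blast
    qed
    then have "(\<Sum>q\<in>A. exp (- s * real (length q))) \<le> (\<Sum>q\<in>(\<Union>n<N. nb_walks_level n). exp (- s * real (length q)))"
      by (intro sum_mono2) auto
    also have "\<dots> = (\<Sum>n<N. \<Sum>q\<in>nb_walks_level n. exp (- s * real (length q)))"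
      by (rule sum.UNION_disjoint) (simp_all, auto simp: nb_walks_level_def)
    also have "\<dots> \<le> (\<Sum>n<N. K * x ^ n)" by (intro sum_mono level)
    also have "\<dots> = K * (\<Sum>n<N. x ^ n)" by (simp add: sum_distrib_left)
    also have "\<dots> \<le> K * (1 / (1 - x))"
    proof (intro mult_left_mono K)
      have "(\<Sum>n<N. x ^ n) \<le> (\<Sum>n. x ^ n)" using x by (intro sum_le_suminf summable_geometric) auto
      then show "(\<Sum>n<N. x ^ n) \<le> 1 / (1 - x)" using suminf_geometric[of x] x by simp
    qed
    finally show "(\<Sum>q\<in>A. exp (- s * real (length q))) \<le> K * (1 / (1 - x))" .
  qed
qed simp

end


section \<open>The Patterson--Sullivan measure of a shadow\<close>

lemma space_borel_of [simp]: "space (borel_of X) = topspace X"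
  by (simp add: borel_of_def space_measure_of_conv)

lemma open_in_borel_of: "openin X U \<Longrightarrow> U \<in> sets (borel_of X)"
  unfolding borel_of_def using openin_subset by (subst sets_measure_of) (auto intro: sigma_sets.Basic)

context pf_cover
begin

lemma nb_walks_walk: "q \<in> nb_walks \<Longrightarrow> \<exists>v. walk G v0 q v" "q \<in> nb_walks \<Longrightarrow> nonbacktracking q"
  by (auto simp: nb_walks_def)

lemma label_nb_walks: "y \<in> pverts \<T> \<Longrightarrow> label x0 y \<in> nb_walks"
  using walk_label_x0 nb_label[OF x0] by (auto simp: nb_walks_def)

lemma shadow_cylinder:
  assumes "q \<in> nb_walks" "q \<noteq> []"
  shows "\<exists>a\<in>parcs \<T>. shadow q = {\<xi> \<in> E. \<exists>n. \<xi> n = fst a \<and> \<xi> (Suc n) = snd a}"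
proof -
  obtain u y where uy: "(u, y) \<in> parcs \<T>" "label x0 y = q" "label x0 u = butlast q"
    using cone_is_half_tree nb_walks_walk[OF assms(1)] assms(2) by blast
  have v: "u \<in> pverts \<T>" "y \<in> pverts \<T>" using T.in_arcsD1[OF uy(1)] T.in_arcsD2[OF uy(1)] by auto
  have "shadow q = {\<xi> \<in> E. \<exists>n. \<xi> n = u \<and> \<xi> (Suc n) = y}"
  proof (intro subset_antisym subsetI)
    fix \<xi> assume s: "\<xi> \<in> shadow q"
    then have \<xi>: "\<xi> \<in> E" by (rule shadowD)
    obtain k where k: "length q = Suc k" using assms(2) by (cases q) auto
    have lab: "label x0 (\<xi> (Suc k)) = q" using s k by (simp add: shadow_def)
    then have "label x0 (\<xi> k) = butlast q" using label_end_Suc[OF \<xi>, of k] by (metis butlast_snoc)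
    then have "\<xi> k = u" "\<xi> (Suc k) = y"
      using lab uy lift_label[OF x0 v(1)] lift_label[OF x0 v(2)] lift_label[OF x0 endsD(4)[OF \<xi>, of k]]
        lift_label[OF x0 endsD(4)[OF \<xi>, of "Suc k"]] by simp_all
    then show "\<xi> \<in> {\<xi> \<in> E. \<exists>n. \<xi> n = u \<and> \<xi> (Suc n) = y}" using \<xi> by blast
  next
    fix \<xi> assume "\<xi> \<in> {\<xi> \<in> E. \<exists>n. \<xi> n = u \<and> \<xi> (Suc n) = y}"
    then obtain n where "\<xi> \<in> E" "\<xi> (Suc n) = y" by blast
    then show "\<xi> \<in> shadow q" using label_in_shadow[of \<xi> "Suc n"] uy(2) by simp
  qed
  then show ?thesis using uy(1) by (intro bexI[of _ "(u, y)"]) auto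
qed

lemma open_shadow: "q \<in> nb_walks \<Longrightarrow> q \<noteq> [] \<Longrightarrow> openin (ends_topology \<T> x0) (shadow q)"
  using shadow_cylinder[of q] unfolding ends_topology_def
  by (intro topology_generated_by_Basis) (auto simp: image_iff case_prod_beta)

lemma topspace_ends: "topspace (ends_topology \<T> x0) = E"
proof -
  have "\<xi> \<in> (\<Union>(u, v)\<in>parcs \<T>. {\<xi> \<in> E. \<exists>n. \<xi> n = u \<and> \<xi> (Suc n) = v})" if "\<xi> \<in> E" for \<xi>
    using that endsD(2)[OF that, of 0] by blast
  then show ?thesis by (auto simp: ends_topology_def)
qed

lemma topspace_compactification: "topspace compactification = total"
  using arc_at_v0 open_cone(3) nb_walks_walk by (metis not_Cons_self2)

lemma open_cone_nb_walks: "q \<in> nb_walks \<Longrightarrow> openin compactification (cone q)"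
  "q \<in> nb_walks \<Longrightarrow> openin compactification (total - cone q)"
  using open_cone nb_walks_walk openin_topspace[of compactification] topspace_compactification
  by (cases "q = []"; force)+

lemma continuous_cone:
  assumes "q \<in> nb_walks" shows "continuous_map compactification euclideanreal (indicator (cone q) :: _ \<Rightarrow> real)"
  unfolding continuous_map_def
proof (intro conjI allI impI)
  fix U :: "real set"
  have eq: "{x \<in> topspace compactification. indicator (cone q) x \<in> U} =
      (if 1 \<in> U then cone q else {}) \<union> (if 0 \<in> U then total - cone q else {})"
    using cone_total[of q] by (auto simp: topspace_compactification indicator_def)
  have "openin compactification (if 1 \<in> U then cone q else {})"
    "openin compactification (if 0 \<in> U then total - cone q else {})"
    using open_cone_nb_walks[OF assms] by simp_all
  then show "openin compactification {x \<in> topspace compactification. indicator (cone q) x \<in> U}"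
    unfolding eq by (rule openin_Un)
qed simp

definition closed_nb_walks :: "('a \<times> 'a) list set" where
  "closed_nb_walks = {q \<in> nb_walks. walk G v0 q v0}"

text \<open>The orbit of the base point is its fibre, and the action is free; so deck transformations
  correspond to non-backtracking closed walks.\<close>

lemma deck_closed_nb_walks: "bij_betw (\<lambda>\<gamma>. label x0 (\<gamma> x0)) (carrier deck) closed_nb_walks"
  unfolding bij_betw_def
proof (intro conjI inj_onI)
  fix \<gamma> \<delta> assume d: "\<gamma> \<in> carrier deck" "\<delta> \<in> carrier deck" "label x0 (\<gamma> x0) = label x0 (\<delta> x0)"
  have "\<gamma> x0 = \<delta> x0"
    using arg_cong[OF d(3), of "lift_end x0"]
    unfolding lift_label[OF x0 deckD(2)[OF d(1) x0]] lift_label[OF x0 deckD(2)[OF d(2) x0]] .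
  then show "\<gamma> = \<delta>" by (rule deck_eqI[OF d(1,2) x0])
next
  show "(\<lambda>\<gamma>. label x0 (\<gamma> x0)) ` carrier deck = closed_nb_walks"
  proof (intro subset_antisym subsetI)
    fix q assume "q \<in> (\<lambda>\<gamma>. label x0 (\<gamma> x0)) ` carrier deck"
    then obtain \<gamma> where \<gamma>: "\<gamma> \<in> carrier deck" "q = label x0 (\<gamma> x0)" by blast
    note gx = deckD(2)[OF \<gamma>(1) x0] deckD(3)[OF \<gamma>(1) x0]
    show "q \<in> closed_nb_walks" using walk_label_x0[OF gx(1)] label_nb_walks[OF gx(1)] \<gamma>(2) gx(2) by (simp add: closed_nb_walks_def)
  next
    fix q assume "q \<in> closed_nb_walks"
    then have q: "walk G v0 q v0" "nonbacktracking q" by (auto simp: closed_nb_walks_def nb_walks_def)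
    obtain \<gamma> where "\<gamma> \<in> carrier deck" "\<gamma> x0 = lift_end x0 q"
      using deck_exists[OF x0 lift_end_vertex[OF x0 q(1)]] proj_lift_end[OF x0 q(1)] by auto
    then show "q \<in> (\<lambda>\<gamma>. label x0 (\<gamma> x0)) ` carrier deck"
      using label_lift_end[OF x0 q] by (intro image_eqI[of _ _ \<gamma>]) auto
  qed
qed

definition weight :: "real \<Rightarrow> ('a \<times> 'a) list \<Rightarrow> real" where
  "weight s q = exp (- s * real (length q))"

definition orbit_series :: "real \<Rightarrow> real" where
  "orbit_series s = (\<Sum>\<^sub>\<infinity>q\<in>closed_nb_walks. weight s q)"

lemma summable_closed_nb_walks: "s > ln lam \<Longrightarrow> weight s summable_on closed_nb_walks"
  unfolding weight_def by (rule summable_on_subset_banach[OF summable_nb_walks]) (auto simp: closed_nb_walks_def)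

lemma Nil_closed_nb_walks: "[] \<in> closed_nb_walks"
  using v0 by (auto simp: closed_nb_walks_def nb_walks_def intro!: exI[of _ v0])

lemma orbit_series_pos:
  assumes "s > ln lam" shows "0 < orbit_series s"
proof -
  have "sum (weight s) {[]} \<le> orbit_series s"
    unfolding orbit_series_def using summable_closed_nb_walks[OF assms] Nil_closed_nb_walks
    by (intro finite_sum_le_infsum) (auto simp: weight_def)
  then show ?thesis by (simp add: weight_def)
qed

text \<open>The indicator function is integrated, rather than the measure of the set taken, because this is
  the form in which weak convergence speaks about a set that is open and closed.\<close>

definition orbit_mass :: "real \<Rightarrow> ('b + (nat \<Rightarrow> 'b)) set \<Rightarrow> real" where
  "orbit_mass s A = integral\<^sup>L (orbit_measure \<T> \<pi> x0 s) (indicator A)"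

lemma orbit_mass_eq:
  assumes s: "s > ln lam" and A: "A \<in> sets (borel_of compactification)"
  shows "orbit_mass s A =
    (\<Sum>\<^sub>\<infinity>q\<in>{q \<in> closed_nb_walks. Inl (lift_end x0 q) \<in> A}. weight s q) / orbit_series s"
proof -
  define w where "w \<gamma> = weight s (label x0 (\<gamma> x0))" for \<gamma>
  have gd: "exp (- s * real (gdist \<T> x0 (\<gamma> x0))) = w \<gamma>" if "\<gamma> \<in> carrier deck" for \<gamma>
    using gdist_eq_length_label[OF x0 deckD(2)[OF that x0]] by (simp add: w_def weight_def)
  have Zw: "(\<Sum>\<^sub>\<infinity>\<gamma>\<in>carrier deck. exp (- s * real (gdist \<T> x0 (\<gamma> x0)))) = orbit_series s"
  proof -
    have "(\<Sum>\<^sub>\<infinity>\<gamma>\<in>carrier deck. exp (- s * real (gdist \<T> x0 (\<gamma> x0)))) = (\<Sum>\<^sub>\<infinity>\<gamma>\<in>carrier deck. w \<gamma>)"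
      using gd by (rule infsum_cong)
    also have "\<dots> = orbit_series s" unfolding orbit_series_def w_def by (rule infsum_reindex_bij_betw[OF deck_closed_nb_walks])
    finally show ?thesis .
  qed
  have wsum: "w summable_on carrier deck"
    unfolding w_def using summable_on_reindex_bij_betw[OF deck_closed_nb_walks, of "weight s"] summable_closed_nb_walks[OF s] by simp
  define f where "f \<gamma> = (w \<gamma> / orbit_series s) * indicator A (Inl (\<gamma> x0))" for \<gamma> :: "'b \<Rightarrow> 'b"
  have meas: "(\<lambda>\<gamma>. Inl (\<gamma> x0)) \<in> measurable (density (count_space (carrier deck))
       (\<lambda>\<gamma>. ennreal (exp (- s * real (gdist \<T> x0 (\<gamma> x0))) / orbit_series s))) (borel_of compactification)"
    using deckD(2)[OF _ x0] by (auto simp: topspace_compactification)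
  have "orbit_mass s A =
      (\<integral>\<gamma>. indicator A (Inl (\<gamma> x0)) \<partial>density (count_space (carrier deck))
         (\<lambda>\<gamma>. ennreal (exp (- s * real (gdist \<T> x0 (\<gamma> x0))) / orbit_series s)))"
    unfolding orbit_mass_def orbit_measure_def Let_def Zw
    by (rule integral_distr[OF meas]) (use A in simp)
  also have "\<dots> = (\<integral>\<gamma>. (exp (- s * real (gdist \<T> x0 (\<gamma> x0))) / orbit_series s) *\<^sub>R indicator A (Inl (\<gamma> x0)) \<partial>count_space (carrier deck))"
    by (rule integral_density) (use orbit_series_pos[OF s] in \<open>auto simp: AE_count_space\<close>)
  also have "\<dots> = infsetsum f (carrier deck)"
    unfolding infsetsum_def f_def by (intro Bochner_Integration.integral_cong refl) (simp add: gd[simplified])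
  also have "\<dots> = infsum f (carrier deck)"
  proof (rule infsetsum_infsum)
    have "(\<lambda>\<gamma>. norm (f \<gamma>)) summable_on carrier deck"
    proof (rule Infinite_Sum.abs_summable_on_comparison_test)
      show "(\<lambda>\<gamma>. norm (w \<gamma> * (1 / orbit_series s))) summable_on carrier deck"
        using summable_on_cmult_left'[of "1 / orbit_series s" w] wsum orbit_series_pos[OF s]
        by (simp add: w_def weight_def abs_mult)
      show "norm (f \<gamma>) \<le> norm (w \<gamma> * (1 / orbit_series s))" for \<gamma>
        using orbit_series_pos[OF s] by (auto simp: f_def indicator_def w_def weight_def)
    qed
    then show "Infinite_Set_Sum.abs_summable_on f (carrier deck)" using abs_summable_equivalent by blast
  qed
  also have "\<dots> = infsum (\<lambda>\<gamma>. (\<lambda>q. weight s q / orbit_series s * indicator A (Inl (lift_end x0 q))) (label x0 (\<gamma> x0))) (carrier deck)"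
    using lift_label[OF x0 deckD(2)[OF _ x0]] by (intro infsum_cong) (simp add: f_def w_def)
  also have "\<dots> = infsum (\<lambda>q. weight s q / orbit_series s * indicator A (Inl (lift_end x0 q))) closed_nb_walks"
    by (rule infsum_reindex_bij_betw[OF deck_closed_nb_walks])
  also have "\<dots> = infsum (\<lambda>q. weight s q * (1 / orbit_series s)) {q \<in> closed_nb_walks. Inl (lift_end x0 q) \<in> A}"
    by (rule infsum_cong_neutral) auto
  also have "\<dots> = infsum (weight s) {q \<in> closed_nb_walks. Inl (lift_end x0 q) \<in> A} * (1 / orbit_series s)"
    by (rule infsum_cmult_left')
  finally show ?thesis by simp
qed

text \<open>The orbit points beyond an oriented edge lie at the ends of the continuations of the walk that
  leads there; these depend only on the edge of \<open>G\<close> below, so the weight of a cone is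
  the weight of the walk times a function of its last edge.\<close>

definition tails :: "'a \<times> 'a \<Rightarrow> ('a \<times> 'a) list set" where
  "tails a = {t. walk G (snd a) t v0 \<and> nonbacktracking (a # t)}"

lemma closed_nb_walks_cone:
  assumes q: "q \<in> nb_walks"
  shows "{t \<in> closed_nb_walks. Inl (lift_end x0 t) \<in> cone q} = {t \<in> closed_nb_walks. prefix q t}"
proof -
  have "Inl (lift_end x0 t) \<in> cone q \<longleftrightarrow> prefix q t" if "t \<in> closed_nb_walks" for t
  proof -
    have t: "walk G v0 t v0" "nonbacktracking t" using that by (auto simp: closed_nb_walks_def nb_walks_def)
    show ?thesis using label_lift_end[OF x0 t] lift_end_vertex[OF x0 t(1)] by (auto simp: cone_def)
  qed
  then show ?thesis by blast
qed

lemma orbit_mass_cone: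
  assumes s: "s > ln lam" and q: "q \<in> nb_walks" "q \<noteq> []"
  shows "orbit_mass s (cone q) =
    weight s q * (infsum (weight s) (tails (last q)) / orbit_series s)"
proof -
  obtain v where v: "walk G v0 q v" using q nb_walks_walk by blast
  have v': "v = snd (last q)" using G.walk_last[OF v q(2)] .
  have eq: "{t \<in> closed_nb_walks. prefix q t} = (\<lambda>t. q @ t) ` tails (last q)"
  proof (intro subset_antisym subsetI)
    fix t assume "t \<in> {t \<in> closed_nb_walks. prefix q t}"
    then obtain t' where t: "t = q @ t'" "q @ t' \<in> closed_nb_walks" by (auto simp: prefix_def)
    have "walk G v t' v0"
      using t(2) G.walk_end_unique[OF v] by (auto simp: closed_nb_walks_def G.walk_append)
    moreover have "nonbacktracking (last q # t')"
      using t(2) q(2) by (auto simp: closed_nb_walks_def nb_walks_def nonbacktracking_append nonbacktracking_Cons)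
    ultimately show "t \<in> (\<lambda>t. q @ t) ` tails (last q)" using t v' by (auto simp: tails_def)
  next
    fix t assume "t \<in> (\<lambda>t. q @ t) ` tails (last q)"
    then obtain t' where t: "t = q @ t'" "walk G v t' v0" "nonbacktracking (last q # t')"
      using v' by (auto simp: tails_def)
    have "walk G v0 t v0" unfolding t G.walk_append using v t(2) by blast
    moreover have "nonbacktracking t"
      using t nb_walks_walk(2)[OF q(1)] by (auto simp: nonbacktracking_append nonbacktracking_Cons)
    ultimately show "t \<in> {t \<in> closed_nb_walks. prefix q t}" using t(1) by (auto simp: closed_nb_walks_def nb_walks_def)
  qed
  have "infsum (weight s) {t \<in> closed_nb_walks. prefix q t} = infsum (weight s \<circ> (\<lambda>t. q @ t)) (tails (last q))"
    unfolding eq by (rule infsum_reindex) (simp add: inj_on_def)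
  also have "\<dots> = infsum (\<lambda>t. weight s q * weight s t) (tails (last q))"
    by (intro infsum_cong) (simp add: weight_def exp_add[symmetric] algebra_simps)
  also have "\<dots> = weight s q * infsum (weight s) (tails (last q))" by (rule infsum_cmult_right')
  finally have "infsum (weight s) {t \<in> closed_nb_walks. prefix q t} = weight s q * infsum (weight s) (tails (last q))" .
  then show ?thesis
    using orbit_mass_eq[OF s open_in_borel_of[OF open_cone_nb_walks(1)[OF q(1)]]] closed_nb_walks_cone[OF q(1)] by simp
qed

lemma orbit_mass_total:
  assumes s: "s > ln lam"
  shows "orbit_mass s (cone []) = 1"
proof -
  have n: "[] \<in> nb_walks" using Nil_closed_nb_walks by (simp add: closed_nb_walks_def)
  show ?thesis
    using orbit_mass_eq[OF s open_in_borel_of[OF open_cone_nb_walks(1)[OF n]]] closed_nb_walks_cone[OF n] orbit_series_pos[OF s]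
    by (simp add: orbit_series_def)
qed

end

locale ps_cover = pf_cover G \<T> \<pi> B x0 b e p
  for G :: "'a pair_pre_digraph" and \<T> :: "'b pair_pre_digraph" and \<pi> :: "'b \<Rightarrow> 'a"
    and B :: "'a pair_pre_digraph" and x0 :: 'b and b :: nat and e :: "nat \<Rightarrow> 'a \<times> 'a"
    and p :: "'a \<times> 'a \<Rightarrow> real" +
  fixes M :: "(nat \<Rightarrow> 'b) measure"
  assumes ps: "patterson_sullivan G \<T> \<pi> x0 M"
begin

sublocale M: finite_measure M
  using ps by (simp add: patterson_sullivan_def)

lemma sets_M: "sets M = sets (borel_of (ends_topology \<T> x0))"
  using ps by (simp add: patterson_sullivan_def)

lemma space_M: "space M = E"
  using sets_eq_imp_space_eq[OF sets_M] by (simp add: topspace_ends)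

lemma shadow_sets: "q \<in> nb_walks \<Longrightarrow> shadow q \<in> sets M"
proof (cases "q = []")
  case True
  then have "shadow q = space M" by (auto simp: space_M shadow_iff)
  then show ?thesis by simp
qed (auto simp: sets_M intro: open_in_borel_of open_shadow)

text \<open>A cone is open and closed, so weak convergence applies to its indicator function.\<close>

lemma limit_cone:
  assumes "q \<in> nb_walks"
  shows "((\<lambda>s. orbit_mass s (cone q)) \<longlongrightarrow> measure M (shadow q))
    (at_right (ln lam))"
proof -
  have "(\<integral>\<xi>. indicator (cone q) (Inr \<xi> :: 'b + (nat \<Rightarrow> 'b)) \<partial>M) = (\<integral>\<xi>. indicator (shadow q) \<xi> \<partial>M)"
    by (rule Bochner_Integration.integral_cong) (auto simp: cone_def indicator_def)
  also have "\<dots> = measure M (shadow q)"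
    using shadow_sets[OF assms] by (simp add: Int_absorb1 sets.sets_into_space)
  finally have eq: "(\<integral>\<xi>. indicator (cone q) (Inr \<xi> :: 'b + (nat \<Rightarrow> 'b)) \<partial>M) = measure M (shadow q)" .
  have "((\<lambda>s. integral\<^sup>L (orbit_measure \<T> \<pi> x0 s) (indicator (cone q) :: _ \<Rightarrow> real)) \<longlongrightarrow>
      (\<integral>\<xi>. indicator (cone q) (Inr \<xi> :: 'b + (nat \<Rightarrow> 'b)) \<partial>M)) (at_right (ln lam))"
    using ps continuous_cone[OF assms] unfolding patterson_sullivan_def by blast
  then show ?thesis unfolding eq orbit_mass_def .
qed

text \<open>Each orbit measure is a probability measure when its series converges, and no mass is lost in a
  weak limit on the compactification. In particular the limit is not zero.\<close>

lemma shadow_total: "measure M E = 1"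
proof -
  have n: "[] \<in> nb_walks" using Nil_closed_nb_walks by (simp add: closed_nb_walks_def)
  have "\<forall>\<^sub>F s in at_right (ln lam). orbit_mass s (cone []) = 1"
    using eventually_at_right_less[of "ln lam"] by (rule eventually_mono) (rule orbit_mass_total)
  then have "((\<lambda>s. 1) \<longlongrightarrow> measure M (shadow [])) (at_right (ln lam))"
    by (rule Lim_transform_eventually[OF limit_cone[OF n]])
  then have "measure M (shadow []) = 1"
    using tendsto_unique[OF trivial_limit_at_right_real _ tendsto_const] by blast
  moreover have "shadow [] = E" by (auto simp: shadow_iff)
  ultimately show ?thesis by simp
qed

text \<open>The weight of the walk up to its last arc is the exponential factor, which has a limit of its own.
  What remains depends on the last arc only.\<close>

lemma limit_tails:
  assumes q: "q \<in> nb_walks" "q \<noteq> []"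
  shows "((\<lambda>s. infsum (weight s) (tails (last q)) / orbit_series s) \<longlongrightarrow> lam ^ length q * measure M (shadow q))
    (at_right (ln lam))"
proof -
  have "((\<lambda>s. exp (s * real (length q))) \<longlongrightarrow> exp (ln lam * real (length q))) (at_right (ln lam))"
    by (intro tendsto_intros)
  moreover have "exp (ln lam * real (length q)) = lam ^ length q"
    using lam_pos by (simp add: exp_of_nat2_mult)
  ultimately have "((\<lambda>s. exp (s * real (length q))) \<longlongrightarrow> lam ^ length q) (at_right (ln lam))"
    by (simp only:)
  from tendsto_mult[OF this limit_cone[OF q(1)]]
  have lim: "((\<lambda>s. exp (s * real (length q)) * orbit_mass s (cone q))
      \<longlongrightarrow> lam ^ length q * measure M (shadow q)) (at_right (ln lam))" .
  have "\<forall>\<^sub>F s in at_right (ln lam). exp (s * real (length q)) * orbit_mass s (cone q) =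
      infsum (weight s) (tails (last q)) / orbit_series s"
    using eventually_at_right_less[of "ln lam"]
  proof (rule eventually_mono)
    fix s assume s: "ln lam < s"
    have "exp (s * real (length q)) * weight s q = 1" by (simp add: weight_def exp_minus)
    then show "exp (s * real (length q)) * orbit_mass s (cone q) =
        infsum (weight s) (tails (last q)) / orbit_series s"
      unfolding orbit_mass_cone[OF s q] by (simp add: mult.assoc[symmetric])
  qed
  then show ?thesis by (rule Lim_transform_eventually[OF lim])
qed

lemma shadow_split:
  assumes "q \<in> nb_walks" "q \<noteq> []"
  shows "measure M (shadow q) = (\<Sum>c\<in>succs (last q). measure M (shadow (q @ [c])))"
proof -
  have nb_walks: "q @ [c] \<in> nb_walks" if "c \<in> succs (last q)" for c
    using that assms succs_arcs by (auto simp: nb_walks_snoc)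
  have "shadow q = (\<Union>c\<in>succs (last q). shadow (q @ [c]))"
  proof (intro subset_antisym subsetI)
    fix \<xi> assume s: "\<xi> \<in> shadow q"
    note \<xi> = shadowD[OF s]
    let ?n = "length q"
    obtain c where c: "label x0 (\<xi> (Suc ?n)) = q @ [c]"
      using s label_end_Suc[OF \<xi>, of ?n] by (simp add: shadow_def)
    then have "q @ [c] \<in> nb_walks" using label_nb_walks[OF endsD(4)[OF \<xi>]] by metis
    then have "c \<in> succs (last q)" using assms(2) by (simp add: nb_walks_snoc)
    moreover have "\<xi> \<in> shadow (q @ [c])" using label_in_shadow[OF \<xi>] c by metis
    ultimately show "\<xi> \<in> (\<Union>c\<in>succs (last q). shadow (q @ [c]))" by blast
  next
    fix \<xi> assume "\<xi> \<in> (\<Union>c\<in>succs (last q). shadow (q @ [c]))"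
    then show "\<xi> \<in> shadow q" using shadow_antimono[of q "q @ [_]"] by auto
  qed
  moreover have "disjoint_family_on (\<lambda>c. shadow (q @ [c])) (succs (last q))"
    unfolding disjoint_family_on_def using shadow_compatible by fastforce
  moreover have "(\<lambda>c. shadow (q @ [c])) ` succs (last q) \<subseteq> sets M"
    using nb_walks shadow_sets by blast
  ultimately show ?thesis
    using M.finite_measure_finite_Union[OF finite_succs] by metis
qed

lemma shadow_total_split: "1 = (\<Sum>a\<in>{a. [a] \<in> nb_walks}. measure M (shadow [a]))"
proof -
  have "E = (\<Union>a\<in>{a. [a] \<in> nb_walks}. shadow [a])"
  proof (intro subset_antisym subsetI)
    fix \<xi> assume \<xi>: "\<xi> \<in> E"
    obtain a where a: "label x0 (\<xi> (Suc 0)) = [a]"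
      using length_label_end[OF \<xi>, of "Suc 0"] by (auto simp: length_Suc_conv)
    then have "[a] \<in> nb_walks" using label_nb_walks[OF endsD(4)[OF \<xi>]] by metis
    moreover have "\<xi> \<in> shadow [a]" using label_in_shadow[OF \<xi>] a by metis
    ultimately show "\<xi> \<in> (\<Union>a\<in>{a. [a] \<in> nb_walks}. shadow [a])" by blast
  qed (auto dest: shadowD)
  moreover have "disjoint_family_on (\<lambda>a. shadow [a]) {a. [a] \<in> nb_walks}"
    unfolding disjoint_family_on_def using shadow_compatible by fastforce
  moreover have "finite {a. [a] \<in> nb_walks}"
    using G.pair_finite_arcs by (rule finite_subset[rotated]) (auto simp: nb_walks_def)
  moreover have "(\<lambda>a. shadow [a]) ` {a. [a] \<in> nb_walks} \<subseteq> sets M" using shadow_sets by blast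
  ultimately show ?thesis
    using M.finite_measure_finite_Union[of "{a. [a] \<in> nb_walks}" "\<lambda>a. shadow [a]"] shadow_total by metis
qed

text \<open>Rescaled by the length of the walk, the measure of a shadow depends on the last edge only, and
  by additivity it is an eigenvector in that edge.\<close>

theorem measure_shadow:
  "\<exists>c>0. \<forall>q\<in>nb_walks. q \<noteq> [] \<longrightarrow> measure M (shadow q) = c * (lam powi (- int (length q)) * col_vec (last q))"
proof -
  define Q where "Q a = Lim (at_right (ln lam)) (\<lambda>s. infsum (weight s) (tails a) / orbit_series s)" for a
  have Q: "Q (last q) = lam ^ length q * measure M (shadow q)" if "q \<in> nb_walks" "q \<noteq> []" for q
    unfolding Q_def using limit_tails[OF that] by (intro tendsto_Lim) simp_all
  have "\<exists>c\<ge>0. \<forall>a\<in>parcs G. Q a = c * col_vec a"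
  proof (rule eigenvector_unique)
    fix a assume a: "a \<in> parcs G"
    obtain q where q: "q \<in> nb_walks" "q \<noteq> []" "last q = a" using nb_walks_ending[OF a] by blast
    show "0 \<le> Q a" using Q[OF q(1,2)] q(3) lam_pos by simp
    have "Q c = lam ^ Suc (length q) * measure M (shadow (q @ [c]))" if "c \<in> succs a" for c
    proof -
      have "q @ [c] \<in> nb_walks" using that q succs_arcs by (auto simp: nb_walks_snoc)
      from Q[OF this] show ?thesis by simp
    qed
    then have "(\<Sum>c\<in>succs a. Q c) = lam ^ Suc (length q) * (\<Sum>c\<in>succs a. measure M (shadow (q @ [c])))"
      by (simp add: sum_distrib_left)
    also have "\<dots> = lam * (lam ^ length q * measure M (shadow q))"
      using shadow_split[OF q(1,2)] q(3) by simp
    finally show "(\<Sum>c\<in>succs a. Q c) = lam * Q a" using Q[OF q(1,2)] q(3) by simp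
  qed
  then obtain c where c: "0 \<le> c" "\<And>a. a \<in> parcs G \<Longrightarrow> Q a = c * col_vec a" by blast
  have main: "measure M (shadow q) = c * (lam powi (- int (length q)) * col_vec (last q))" if q: "q \<in> nb_walks" "q \<noteq> []" for q
  proof -
    have "last q \<in> parcs G" using q G.walk_arcs last_in_set[of q] by (fastforce simp: nb_walks_def)
    then have "lam ^ length q * measure M (shadow q) = c * col_vec (last q)" using Q[OF q] c(2) by simp
    then show ?thesis using lam_pos by (simp add: power_int_minus field_simps)
  qed
  \<comment> \<open>The total mass is 1, so the shadows of single arcs do not all have measure 0.\<close>
  have "c \<noteq> 0"
  proof
    assume "c = 0"
    then have "(\<Sum>a\<in>{a. [a] \<in> nb_walks}. measure M (shadow [a])) = 0" using main by simp
    then show False using shadow_total_split by simp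
  qed
  then show ?thesis using c(1) main by (intro exI[of _ c]) auto
qed

end


section \<open>Cylinders generate the Borel sets\<close>

text \<open>There are only countably many finite intersections of members of the subbasis, so every open set is
  a countable union of such intersections.\<close>

lemma sets_borel_of_countable_subbasis:
  assumes "countable S"
  shows "sets (borel_of (topology_generated_by S)) = sigma_sets (\<Union>S) S"
proof -
  have sub: "S \<subseteq> Pow (\<Union>S)" by blast
  have "{U. openin (topology_generated_by S) U} \<subseteq> Pow (\<Union>S)"
    using openin_subset[of "topology_generated_by S"] by auto
  then have "sets (borel_of (topology_generated_by S)) = sigma_sets (\<Union>S) {U. openin (topology_generated_by S) U}"
    by (simp add: borel_of_def)
  also have "\<dots> = sigma_sets (\<Union>S) S"
  proof (rule sigma_sets_eqI)
    fix U assume "U \<in> {U. openin (topology_generated_by S) U}"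
    then have "generate_topology_on S U" by (simp add: openin_topology_generated_by_iff)
    then have "(arbitrary union_of finite' intersection_of (\<lambda>x. x \<in> S)) U"
      by (simp only: generate_topology_on_eq)
    then obtain K where K: "K \<subseteq> Collect (finite' intersection_of (\<lambda>x. x \<in> S))" "\<Union>K = U"
      by (auto simp: union_of_def)
    have fin: "\<exists>A. finite A \<and> A \<noteq> {} \<and> A \<subseteq> S \<and> \<Inter>A = V" if "V \<in> K" for V
      using K(1) that by (auto simp: intersection_of_def subset_eq)
    have "K \<subseteq> Inter ` {A. finite A \<and> A \<subseteq> S}" using fin by (auto simp: image_iff)
    then have "countable K"
      using countable_Collect_finite_subset[OF assms] by (meson countable_image countable_subset)
    moreover have "K \<subseteq> sets (sigma (\<Union>S) S)"
    proof
      fix V assume "V \<in> K"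
      then obtain A where A: "finite A" "A \<noteq> {}" "A \<subseteq> S" "\<Inter>A = V" using fin by blast
      have "(\<Inter>X\<in>A. X) \<in> sets (sigma (\<Union>S) S)"
        using A sub by (intro sets.finite_INT) (auto simp: sets_measure_of)
      then show "V \<in> sets (sigma (\<Union>S) S)" using A(4) by simp
    qed
    ultimately have "\<Union>K \<in> sets (sigma (\<Union>S) S)" by (rule sets.countable_Union)
    then show "U \<in> sigma_sets (\<Union>S) S" using K(2) sub by (simp add: sets_measure_of)
  next
    fix U assume "U \<in> S"
    then show "U \<in> sigma_sets (\<Union>S) {U. openin (topology_generated_by S) U}"
      by (intro sigma_sets.Basic) (simp add: topology_generated_by_Basis)
  qed
  finally show ?thesis .
qed

context marked_deck
begin

definition cylinders :: "(nat \<Rightarrow> 'f) set set" where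
  "cylinders = insert {} (Cyl F g b ` (carrier F - {\<one>\<^bsub>F\<^esub>}))"

lemma countable_carrier: "countable (carrier F)"
proof -
  have "carrier F = word_val F g ` {w. reduced_word b w}" using word_val_bij by (simp add: bij_betw_def)
  then show ?thesis by simp
qed

text \<open>Only arcs that lengthen the word are crossed by a ray from the identity.\<close>

lemma cayley_cylinder:
  assumes "(h, h') \<in> parcs (cayley_graph F g b)"
  shows "word h' = word h @ [l] \<Longrightarrow> {\<xi> \<in> CE. \<exists>n. \<xi> n = h \<and> \<xi> (Suc n) = h'} = Cyl F g b h'"
    and "word h = word h' @ [l] \<Longrightarrow> {\<xi> \<in> CE. \<exists>n. \<xi> n = h \<and> \<xi> (Suc n) = h'} = {}"
proof -
  note h = cayley_arcD(1,2)[OF assms]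
  {
    assume l: "word h' = word h @ [l]"
    show "{\<xi> \<in> CE. \<exists>n. \<xi> n = h \<and> \<xi> (Suc n) = h'} = Cyl F g b h'"
    proof (intro subset_antisym subsetI)
      fix \<xi> assume "\<xi> \<in> {\<xi> \<in> CE. \<exists>n. \<xi> n = h \<and> \<xi> (Suc n) = h'}"
      then obtain n where n: "\<xi> \<in> CE" "\<xi> (Suc n) = h'" by blast
      then have "length (word h') = Suc n" using length_word_cayley_end by metis
      then show "\<xi> \<in> Cyl F g b h'" using n Cyl_iff[OF h(2)] by simp
    next
      fix \<xi> assume "\<xi> \<in> Cyl F g b h'"
      then have \<xi>: "\<xi> \<in> CE" "\<xi> (Suc (length (word h))) = h'" using Cyl_iff[OF h(2)] l by auto
      obtain l' where "word (\<xi> (Suc (length (word h)))) = word (\<xi> (length (word h))) @ [l']"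
        using word_cayley_end_Suc[OF \<xi>(1)] by blast
      then have "word (\<xi> (length (word h))) = word h" using \<xi>(2) l by simp
      then have "\<xi> (length (word h)) = h" using word_inj[OF cayley_endD(2)[OF \<xi>(1)] h(1)] by blast
      then show "\<xi> \<in> {\<xi> \<in> CE. \<exists>n. \<xi> n = h \<and> \<xi> (Suc n) = h'}" using \<xi> by blast
    qed
  }
  {
    assume l: "word h = word h' @ [l]"
    have False if \<xi>: "\<xi> \<in> CE" "\<xi> n = h" "\<xi> (Suc n) = h'" for \<xi> n
      using length_word_cayley_end[OF \<xi>(1), of n] length_word_cayley_end[OF \<xi>(1), of "Suc n"] l
      unfolding \<xi>(2,3) by simp
    then show "{\<xi> \<in> CE. \<exists>n. \<xi> n = h \<and> \<xi> (Suc n) = h'} = {}" by blast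
  }
qed

lemma Cyl_subset: "h \<in> carrier F \<Longrightarrow> Cyl F g b h \<subseteq> CE"
  by (auto simp: Cyl_def)

lemma Union_first_cylinders: "(\<Union>h\<in>{h \<in> carrier F. length (word h) = 1}. Cyl F g b h) = CE"
proof (intro subset_antisym subsetI)
  fix \<xi> assume \<xi>: "\<xi> \<in> CE"
  have "\<xi> \<in> Cyl F g b (\<xi> 1)"
    using \<xi> Cyl_iff[OF cayley_endD(2)[OF \<xi>]] length_word_cayley_end[OF \<xi>] by simp
  then show "\<xi> \<in> (\<Union>h\<in>{h \<in> carrier F. length (word h) = 1}. Cyl F g b h)"
    using cayley_endD(2)[OF \<xi>, of 1] length_word_cayley_end[OF \<xi>, of 1] by blast
qed (use Cyl_subset in blast)

lemma first_cylinders: "Cyl F g b ` {h \<in> carrier F. length (word h) = 1} \<subseteq> cylinders"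
  using word_one by (fastforce simp: cylinders_def)

lemma cylinders_subset: "cylinders \<subseteq> Pow CE"
  using Cyl_subset by (auto simp: cylinders_def)

lemma sets_cayley: "sets (cayley_ends_borel F g b) = sigma_sets CE cylinders"
proof -
  define S where "S = (\<lambda>(u, v). {\<xi> \<in> CE. \<exists>n. \<xi> n = u \<and> \<xi> (Suc n) = v}) ` parcs (cayley_graph F g b)"
  have "parcs (cayley_graph F g b) \<subseteq> carrier F \<times> carrier F" using cayley_arcD by auto
  then have "countable S"
    unfolding S_def using countable_carrier by (meson countable_SIGMA countable_image countable_subset)
  then have sets: "sets (cayley_ends_borel F g b) = sigma_sets (\<Union>S) S"
    using sets_borel_of_countable_subbasis[of S]
    by (simp add: cayley_ends_borel_def ends_topology_def S_def cayley_ends_def)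
  have S_cyl: "S \<subseteq> cylinders"
  proof
    fix A assume "A \<in> S"
    then obtain h h' where hh: "(h, h') \<in> parcs (cayley_graph F g b)"
      and A: "A = {\<xi> \<in> CE. \<exists>n. \<xi> n = h \<and> \<xi> (Suc n) = h'}" by (auto simp: S_def)
    from cayley_arcD(3)[OF hh] show "A \<in> cylinders"
    proof (elim disjE exE)
      fix l assume l: "word h' = word h @ [l]"
      then have "h' \<noteq> \<one>\<^bsub>F\<^esub>" by auto
      then show ?thesis using cayley_cylinder(1)[OF hh l] cayley_arcD(2)[OF hh] A by (simp add: cylinders_def)
    next
      fix l assume l: "word h = word h' @ [l]"
      show ?thesis using cayley_cylinder(2)[OF hh l] A by (simp add: cylinders_def)
    qed
  qed
  have Cyl_S: "Cyl F g b h \<in> S" if h: "h \<in> carrier F" "h \<noteq> \<one>\<^bsub>F\<^esub>" for h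
  proof -
    obtain w l where w: "word h = w @ [l]" using word_ne[OF h(1)] h(2) by (metis rev_exhaust)
    have rw: "reduced_word b w" using word_reduced[OF h(1)] w by (simp add: reduced_word_append)
    define h0 where "h0 = word_val F g w"
    have h0: "h0 \<in> carrier F" "word h0 = w"
      using word_val_closed[of w] word_word_val[OF rw] rw by (auto simp: h0_def reduced_word_def)
    have arc: "(h0, h) \<in> parcs (cayley_graph F g b)" using cayley_arcI[OF h0(1) h(1)] h0(2) w by simp
    then have "{\<xi> \<in> CE. \<exists>n. \<xi> n = h0 \<and> \<xi> (Suc n) = h} \<in> S"
      unfolding S_def by (rule rev_image_eqI) simp
    then show ?thesis using cayley_cylinder(1)[OF arc, of l] h0(2) w by simp
  qed
  have "\<Union>S = CE"
  proof (rule subset_antisym)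
    show "\<Union>S \<subseteq> CE" using S_cyl cylinders_subset by blast
    have "Cyl F g b h \<in> S" if "h \<in> carrier F" "length (word h) = 1" for h
      using Cyl_S[OF that(1)] that(2) by fastforce
    then show "CE \<subseteq> \<Union>S" unfolding Union_first_cylinders[symmetric] by blast
  qed
  moreover have "sigma_sets CE S = sigma_sets CE cylinders"
  proof (rule sigma_sets_eqI)
    fix A assume "A \<in> cylinders"
    then show "A \<in> sigma_sets CE S"
      using Cyl_S by (auto simp: cylinders_def intro: sigma_sets.Empty sigma_sets.Basic)
  qed (use S_cyl in \<open>auto intro: sigma_sets.Basic\<close>)
  ultimately show ?thesis using sets by simp
qed

lemma Cyl_antimono:
  assumes "h \<in> carrier F" "h' \<in> carrier F" "prefix (word h) (word h')"
  shows "Cyl F g b h' \<subseteq> Cyl F g b h"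
  using assms(3) by (auto simp: Cyl_def elim!: eventually_mono intro: prefix_order.trans)

lemma Int_stable_cylinders: "Int_stable cylinders"
proof (rule Int_stableI)
  fix A A' assume "A \<in> cylinders" "A' \<in> cylinders"
  moreover have "Cyl F g b h \<inter> Cyl F g b h' \<in> cylinders"
    if h: "h \<in> carrier F - {\<one>\<^bsub>F\<^esub>}" "h' \<in> carrier F - {\<one>\<^bsub>F\<^esub>}" for h h'
  proof (cases "Cyl F g b h \<inter> Cyl F g b h' = {}")
    case False
    then obtain \<xi> where "\<xi> \<in> Cyl F g b h" "\<xi> \<in> Cyl F g b h'" by blast
    then have "\<forall>\<^sub>F n in sequentially. prefix (word h) (word (\<xi> n)) \<and> prefix (word h') (word (\<xi> n))"
      by (auto simp: Cyl_def intro: eventually_conj)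
    then obtain n where "prefix (word h) (word (\<xi> n))" "prefix (word h') (word (\<xi> n))"
      using eventually_happens' sequentially_bot by blast
    then have "prefix (word h) (word h') \<or> prefix (word h') (word h)" by (rule prefix_same_cases)
    then have "Cyl F g b h \<inter> Cyl F g b h' \<in> {Cyl F g b h, Cyl F g b h'}"
      using Cyl_antimono h by blast
    then show ?thesis using h by (auto simp: cylinders_def)
  qed (simp add: cylinders_def)
  ultimately show "A \<inter> A' \<in> cylinders" unfolding cylinders_def by auto
qed

text \<open>Cylinders are nested or disjoint, so they form a generator of the Borel sets that is stable under
  intersection, and countably many cylinders of finite measure cover the boundary.\<close>

lemma measure_determined:
  assumes sets: "sets \<mu> = sets (cayley_ends_borel F g b)" "sets \<nu> = sets (cayley_ends_borel F g b)"
    and \<mu>: "0 < c" "\<And>h. h \<in> carrier F - {\<one>\<^bsub>F\<^esub>} \<Longrightarrow> emeasure \<mu> (Cyl F g b h) = ennreal (c * f h)"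
    and \<nu>: "0 < d" "\<And>h. h \<in> carrier F - {\<one>\<^bsub>F\<^esub>} \<Longrightarrow> emeasure \<nu> (Cyl F g b h) = ennreal (d * f h)"
  shows "\<nu> = scale_measure (ennreal (d / c)) \<mu>"
proof (rule measure_eqI_generator_eq_countable[OF Int_stable_cylinders cylinders_subset])
  show "sets \<nu> = sigma_sets CE cylinders" using sets(2) by (simp only: sets_cayley)
  show "sets (scale_measure (ennreal (d / c)) \<mu>) = sigma_sets CE cylinders"
    using sets(1) by (simp add: sets_cayley)
  show "Cyl F g b ` {h \<in> carrier F. length (word h) = 1} \<subseteq> cylinders" by (rule first_cylinders)
  show "\<Union> (Cyl F g b ` {h \<in> carrier F. length (word h) = 1}) = CE" by (rule Union_first_cylinders)
  show "countable (Cyl F g b ` {h \<in> carrier F. length (word h) = 1})"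
    by (rule countable_image[OF countable_subset[OF _ countable_carrier]]) blast
next
  fix A assume "A \<in> Cyl F g b ` {h \<in> carrier F. length (word h) = 1}"
  then obtain h where "h \<in> carrier F - {\<one>\<^bsub>F\<^esub>}" "A = Cyl F g b h" using word_one by fastforce
  then show "emeasure \<nu> A \<noteq> \<infinity>" using \<nu>(2) by simp
next
  fix A assume "A \<in> cylinders"
  then consider "A = {}" | h where "h \<in> carrier F - {\<one>\<^bsub>F\<^esub>}" "A = Cyl F g b h"
    by (auto simp: cylinders_def)
  then show "emeasure \<nu> A = emeasure (scale_measure (ennreal (d / c)) \<mu>) A"
  proof cases
    case 2
    have "ennreal (d * f h) = ennreal (d / c * (c * f h))" using \<mu>(1) by simp
    also have "\<dots> = ennreal (d / c) * ennreal (c * f h)" using \<mu>(1) \<nu>(1) by (intro ennreal_mult') simp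
    finally show ?thesis using \<mu>(2) \<nu>(2) 2 by simp
  qed simp
qed

end

locale marked_ps = marked_deck G \<T> \<pi> B x0 b e \<gamma> F \<alpha> g + ps_cover G \<T> \<pi> B x0 b e p M
  for G :: "'a pair_pre_digraph" and \<T> :: "'b pair_pre_digraph" and \<pi> :: "'b \<Rightarrow> 'a"
    and B :: "'a pair_pre_digraph" and x0 :: 'b and b :: nat and e :: "nat \<Rightarrow> 'a \<times> 'a"
    and \<gamma> :: "nat \<Rightarrow> 'b \<Rightarrow> 'b" and F :: "'f monoid" and \<alpha> :: "'f \<Rightarrow> 'b \<Rightarrow> 'b" and g :: "nat \<Rightarrow> 'f"
    and p :: "'a \<times> 'a \<Rightarrow> real" and M :: "(nat \<Rightarrow> 'b) measure"
begin

abbreviation \<Phi> :: "(nat \<Rightarrow> 'b) \<Rightarrow> (nat \<Rightarrow> 'f)" where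
  "\<Phi> \<equiv> boundary_iso \<T> x0 F g b \<alpha>"

lemma stem_nb_walks: "h \<in> carrier F \<Longrightarrow> stem v0 (word h) \<in> nb_walks"
  using walk_stem[OF v0 word_letters] nb_stem[OF v0 word_reduced] by (auto simp: nb_walks_def)

lemma vimage_Cyl: "h \<in> carrier F \<Longrightarrow> \<Phi> -` Cyl F g b h \<inter> space M = shadow (stem v0 (word h))"
  using boundary_iso_Cyl_iff shadowD by (auto simp: space_M)

lemma \<Phi>_measurable: "\<Phi> \<in> measurable M (cayley_ends_borel F g b)"
proof (rule measurable_sigma_sets[OF sets_cayley cylinders_subset])
  show "\<Phi> \<in> space M \<rightarrow> CE" using boundary_iso_Cyl_iff(1) F.one_closed by (auto simp: space_M)
next
  fix A assume "A \<in> cylinders"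
  then consider "A = {}" | h where "h \<in> carrier F" "A = Cyl F g b h" by (auto simp: cylinders_def)
  then show "\<Phi> -` A \<inter> space M \<in> sets M"
    using vimage_Cyl shadow_sets stem_nb_walks by cases auto
qed

lemma emeasure_push_forward:
  assumes h: "h \<in> carrier F - {\<one>\<^bsub>F\<^esub>}"
  shows "emeasure (distr M (cayley_ends_borel F g b) \<Phi>) (Cyl F g b h) = ennreal (measure M (shadow (stem v0 (word h))))"
proof -
  have "Cyl F g b h \<in> sets (cayley_ends_borel F g b)"
    unfolding sets_cayley using h by (intro sigma_sets.Basic) (simp add: cylinders_def)
  then show ?thesis
    using emeasure_distr[OF \<Phi>_measurable] vimage_Cyl h by (simp add: M.emeasure_eq_measure)
qed

text \<open>The preimage of a cylinder is the shadow of a stem. Its measure is governed by the length of the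
  stem and by its last arc, which is the inverse of the final edge.\<close>

theorem push_forward_Cyl:
  assumes "tree_realises_distances G B v0"
  shows "\<exists>c>0. \<forall>h\<in>carrier F - {\<one>\<^bsub>F\<^esub>}. emeasure (distr M (cayley_ends_borel F g b) \<Phi>) (Cyl F g b h) =
    ennreal (c * (lam powi (- int (length (closed_walk \<T> \<pi> x0 (\<alpha> h))) +
      int (gdist (remove_edge G (final_edge F g b e h)) v0 (fst (final_edge F g b e h)))) * p (final_edge F g b e h)))"
proof -
  obtain c where c: "c > 0" "\<And>q. q \<in> nb_walks \<Longrightarrow> q \<noteq> [] \<Longrightarrow>
      measure M (shadow q) = c * (lam powi (- int (length q)) * col_vec (last q))"
    using measure_shadow by blast
  have "measure M (shadow (stem v0 (word h))) =
    c * (lam powi (- int (length (closed_walk \<T> \<pi> x0 (\<alpha> h))) +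
      int (gdist (remove_edge G (final_edge F g b e h)) v0 (fst (final_edge F g b e h)))) * p (final_edge F g b e h))"
    if h: "h \<in> carrier F - {\<one>\<^bsub>F\<^esub>}" for h
  proof -
    have h': "h \<in> carrier F" "h \<noteq> \<one>\<^bsub>F\<^esub>" and ne: "word h \<noteq> []" using h word_ne by auto
    have "col_vec (last (stem v0 (word h))) = p (final_edge F g b e h)"
      using last_stem[OF ne] final_edge_eq[OF h'] by (simp add: col_vec_def)
    then show ?thesis
      using c(2)[OF stem_nb_walks[OF h'(1)] stem_ne[OF ne]] length_closed_walk[OF h' assms] by simp
  qed
  then show ?thesis using c(1) emeasure_push_forward by (intro exI[of _ c]) auto
qed

end


section \<open>The Patterson--Sullivan measure of a cylinder\<close>

theorem theorem3p2:
  fixes G B :: "'a pair_pre_digraph" and \<T> :: "'b pair_pre_digraph" and \<pi> :: "'b \<Rightarrow> 'a"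
    and v0 :: 'a and x0 :: 'b and b :: nat
    and e :: "nat \<Rightarrow> 'a \<times> 'a" and \<gamma> :: "nat \<Rightarrow> 'b \<Rightarrow> 'b"
    and F :: "'f monoid" and \<alpha> :: "'f \<Rightarrow> 'b \<Rightarrow> 'b" and g :: "nat \<Rightarrow> 'f"
    and \<mu>\<^sub>x\<^sub>0 :: "(nat \<Rightarrow> 'b) measure" and p :: "'a \<times> 'a \<Rightarrow> real"
  defines "\<Gamma> \<equiv> deck_group \<T> \<pi>"
    and "C \<equiv> cayley_ends_borel F g b"
    and "\<mu> \<equiv> distr \<mu>\<^sub>x\<^sub>0 (cayley_ends_borel F g b) (boundary_iso \<T> x0 F g b \<alpha>)"
    and "\<tau> \<equiv> final_edge F g b e"
    and "len \<equiv> (\<lambda>\<delta>. length (closed_walk \<T> \<pi> x0 \<delta>))"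
    and "lam \<equiv> pf_eigenvalue G"
  assumes G: "pair_graph G" "connected_graph G" "\<forall>v\<in>pverts G. degree G v \<noteq> 1"
    and b: "first_betti G = int b" "b > 1"
    and cover: "universal_cover G \<T> \<pi>" "x0 \<in> pverts \<T>" "\<pi> x0 = v0"
    and B: "spanning_graph_tree B G" "tree_realises_distances G B v0"
    and e: "cotree_edges G B b e"
    and \<gamma>: "cotree_generators \<T> \<pi> x0 b e \<gamma>"
    and \<alpha>: "free_group_of_rank F b" "\<alpha> \<in> iso F \<Gamma>"
    and g: "\<forall>i<b. g i = inv_into (carrier F) \<alpha> (\<gamma> i)"
    and \<mu>0: "patterson_sullivan G \<T> \<pi> x0 \<mu>\<^sub>x\<^sub>0"
    and p: "pf_eigenvector G p"
  defines "is_given_by \<equiv> (\<lambda>\<nu> :: (nat \<Rightarrow> 'f) measure. \<exists>c>0. \<forall>h\<in>carrier F - {\<one>\<^bsub>F\<^esub>}.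
      emeasure \<nu> (Cyl F g b h) = ennreal (c *
        (lam powi (- int (len (\<alpha> h)) + int (gdist (remove_edge G (\<tau> h)) v0 (fst (\<tau> h)))) * p (\<tau> h))))"
  shows "is_given_by \<mu> \<and>
    (\<forall>\<nu>. sets \<nu> = sets C \<and> is_given_by \<nu> \<longrightarrow> (\<exists>k>0. \<nu> = scale_measure (ennreal k) \<mu>))"
proof -
  have marked: "marked_cover G \<T> \<pi> B x0 b e"
    using covering_tree.intro[OF G(1) cover(1)] marked_cover_axioms.intro[OF cover(2) B(1) e]
    by (rule marked_cover.intro)
  have "group F" using \<alpha>(1) by (simp add: free_group_of_rank_def)
  with marked have "marked_deck G \<T> \<pi> B x0 b e \<gamma> F \<alpha> g"
    using \<gamma> \<alpha>(2) g by (intro marked_deck.intro marked_deck_axioms.intro) (simp_all add: \<Gamma>_def)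
  moreover have "pf_cover G \<T> \<pi> B x0 b e p"
    using marked G(3) b(2) p by (intro pf_cover.intro pf_cover_axioms.intro) simp_all
  then have "ps_cover G \<T> \<pi> B x0 b e p \<mu>\<^sub>x\<^sub>0"
    using \<mu>0 by (intro ps_cover.intro ps_cover_axioms.intro)
  ultimately interpret P: marked_ps G \<T> \<pi> B x0 b e \<gamma> F \<alpha> g p \<mu>\<^sub>x\<^sub>0
    by (rule marked_ps.intro)
  have \<mu>: "is_given_by \<mu>"
    using P.push_forward_Cyl B(2) unfolding is_given_by_def \<mu>_def \<tau>_def len_def lam_def cover(3) by blast
  moreover have "\<exists>k>0. \<nu> = scale_measure (ennreal k) \<mu>" if \<nu>: "sets \<nu> = sets C" "is_given_by \<nu>" for \<nu>
  proof -
    have sets: "sets \<mu> = sets (cayley_ends_borel F g b)" by (simp add: \<mu>_def)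
    obtain c d where c: "0 < c" "\<And>h. h \<in> carrier F - {\<one>\<^bsub>F\<^esub>} \<Longrightarrow> emeasure \<mu> (Cyl F g b h) = ennreal (c *
        (lam powi (- int (len (\<alpha> h)) + int (gdist (remove_edge G (\<tau> h)) v0 (fst (\<tau> h)))) * p (\<tau> h)))"
      and d: "0 < d" "\<And>h. h \<in> carrier F - {\<one>\<^bsub>F\<^esub>} \<Longrightarrow> emeasure \<nu> (Cyl F g b h) = ennreal (d *
        (lam powi (- int (len (\<alpha> h)) + int (gdist (remove_edge G (\<tau> h)) v0 (fst (\<tau> h)))) * p (\<tau> h)))"
      using \<mu> \<nu>(2) unfolding is_given_by_def by blast
    have "\<nu> = scale_measure (ennreal (d / c)) \<mu>"
      using P.measure_determined[OF sets \<nu>(1)[unfolded C_def] c d] .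
    then show ?thesis using c(1) d(1) by (intro exI[of _ "d / c"]) simp
  qed
  ultimately show ?thesis by blast
qed

end
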